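(* Let $R$ be an integral domain. The following are equivalent. (1) Each proper ideal of $R$ is a product of radical ideals. (2) Each ideal of $R$ is a product of radical ideals $J_1\subseteq\cdots\subseteq J_n$; and for nonzero ideals these are unique when required to be proper (i.e. each nonzero ideal can be written uniquely as a product of proper radical ideals $J_1\subseteq\cdots\subseteq J_n$, with $R$ the empty product). (3) $\dim(R)\leq 1$ and each invertible ideal of $R$ is a product of radical ideals of $R$. (4) Each nonzero prime ideal is maximal and contains an invertible radical ideal. (5) The radical of each nonzero finitely generated ideal is invertible. (6) The multiplicative lattice of ideals of $R$ is isomorphic, as a multiplicative lattice, to $U_b(\mathrm{Max}^{-1}(R))$. (7) $R$ is a Prüfer domain for which the radical of each finitely generated ideal is finitely generated.
   Context: The multiplicative lattice of ideals of $R$ is the set of ideals ordered by inclusion, with ideal multiplication. An isomorphism of multiplicative lattices is an order isomorphism that is also a monoid isomorphism. $\mathrm{Max}^{-1}(R)$ is the set of maximal ideals of $R$ with the inverse topology, which has as a basis of open sets the sets $\{M\mid I\subseteq M\}$ with $I$ a finitely generated ideal; this is a Hausdorff space. For a Hausdorff space $X$, $U(X)$ is the monoid, under pointwise addition, of functions $f:X\to\mathbb{N}_0$ such that $f^{-1}([k,\infty))$ is compact for all $k\geq 1$ (the compactly supported upper semicontinuous functions), ordered by $f\leq_d g$ iff $f(x)\geq g(x)$ for all $x\in X$. $U_b(X)=U(X)\cup\{b\}$, where $b:X\to\mathbb{N}_0\cup\{\infty\}$, $b(x)=\infty$ for all $x\in X$, is appended as bottom element, with $b+f=f+b=b$ for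 all $f$. The monoid operation of $U_b(X)$ as a multiplicative lattice is $+$ and its top element is the zero function.
   Formalization: Condition (6) is shown equivalent to the others only when R is not a field: for a field (1)-(5) and (7) hold, but U_b(Max^{-1}(R)) is infinite while R has only two ideals, so (6) fails. The other equivalences hold for every integral domain. *)

theory Defs
  imports
    "HOL-Algebra.Ideal_Product"
    "HOL-Algebra.Group"
    "HOL-Analysis.Abstract_Topology"
    "HOL-Library.Extended_Nat"
begin

section \<open>Fraction field of a domain\<close>

definition fraction_rel :: "('a, 'm) ring_scheme \<Rightarrow> (('a \<times> 'a) \<times> ('a \<times> 'a)) set" where
  "fraction_rel R = {((a, b), (c, d)).
     a \<in> carrier R \<and> b \<in> carrier R - {\<zero>\<^bsub>R\<^esub>} \<and> c \<in> carrier R \<and> d \<in> carrier R - {\<zero>\<^bsub>R\<^esub>} \<and>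
     a \<otimes>\<^bsub>R\<^esub> d = c \<otimes>\<^bsub>R\<^esub> b}"

definition fraction :: "('a, 'm) ring_scheme \<Rightarrow> 'a \<Rightarrow> 'a \<Rightarrow> ('a \<times> 'a) set" where
  "fraction R a b = fraction_rel R `` {(a, b)}"

definition fraction_field :: "('a, 'm) ring_scheme \<Rightarrow> ('a \<times> 'a) set ring" where
  "fraction_field R =
    \<lparr>carrier = (carrier R \<times> (carrier R - {\<zero>\<^bsub>R\<^esub>})) // fraction_rel R,
     mult = (\<lambda>x y. \<Union>p\<in>x. \<Union>q\<in>y. fraction R (fst p \<otimes>\<^bsub>R\<^esub> fst q) (snd p \<otimes>\<^bsub>R\<^esub> snd q)),
     one = fraction R \<one>\<^bsub>R\<^esub> \<one>\<^bsub>R\<^esub>,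
     zero = fraction R \<zero>\<^bsub>R\<^esub> \<one>\<^bsub>R\<^esub>,
     add = (\<lambda>x y. \<Union>p\<in>x. \<Union>q\<in>y.
        fraction R (fst p \<otimes>\<^bsub>R\<^esub> snd q \<oplus>\<^bsub>R\<^esub> fst q \<otimes>\<^bsub>R\<^esub> snd p) (snd p \<otimes>\<^bsub>R\<^esub> snd q))\<rparr>"

definition to_fraction :: "('a, 'm) ring_scheme \<Rightarrow> 'a \<Rightarrow> ('a \<times> 'a) set" where
  "to_fraction R a = fraction R a \<one>\<^bsub>R\<^esub>"

context domain
begin

context
begin

private abbreviation "fr \<equiv> fraction R"
private abbreviation "K \<equiv> fraction_field R"
private abbreviation "R0 \<equiv> carrier R - {\<zero>}"

lemma nz_mult: "b \<in> R0 \<Longrightarrow> d \<in> R0 \<Longrightarrow> b \<otimes> d \<in> R0"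
  using integral by auto

lemma fraction_rel_equiv: "equiv (carrier R \<times> R0) (fraction_rel R)"
proof (rule equivI)
  show "trans (fraction_rel R)"
  proof (rule transI, clarify)
    fix a b c d e f
    assume 1: "((a, b), (c, d)) \<in> fraction_rel R" and 2: "((c, d), (e, f)) \<in> fraction_rel R"
    then have c: "a \<in> carrier R" "b \<in> carrier R" "c \<in> carrier R" "d \<in> carrier R" "d \<noteq> \<zero>"
      "e \<in> carrier R" "f \<in> carrier R" "b \<noteq> \<zero>" "f \<noteq> \<zero>"
      and ad: "a \<otimes> d = c \<otimes> b" and cf: "c \<otimes> f = e \<otimes> d"
      by (auto simp: fraction_rel_def)
    have "d \<otimes> (a \<otimes> f) = (a \<otimes> d) \<otimes> f" using c by (simp add: m_ac)
    also have "\<dots> = (c \<otimes> f) \<otimes> b" using c by (simp add: ad) (simp add: m_ac)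
    also have "\<dots> = d \<otimes> (e \<otimes> b)" using c by (simp add: cf) (simp add: m_ac)
    finally have "a \<otimes> f = e \<otimes> b" using c m_lcancel by simp
    then show "((a, b), (e, f)) \<in> fraction_rel R" using c by (auto simp: fraction_rel_def)
  qed
qed (auto simp: fraction_rel_def refl_on_def sym_def)

lemma fraction_eq_iff:
  assumes "a \<in> carrier R" "b \<in> R0" "c \<in> carrier R" "d \<in> R0"
  shows "fr a b = fr c d \<longleftrightarrow> a \<otimes> d = c \<otimes> b"
  unfolding fraction_def
  using eq_equiv_class_iff[OF fraction_rel_equiv, of "(a,b)" "(c,d)"] assms
  by (auto simp: fraction_rel_def)

lemma fraction_carrier:
  "x \<in> carrier K \<longleftrightarrow> (\<exists>a b. a \<in> carrier R \<and> b \<in> R0 \<and> x = fr a b)"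
  by (auto simp: fraction_field_def fraction_def quotient_def)

lemma fraction_mult:
  assumes "a \<in> carrier R" "b \<in> R0" "c \<in> carrier R" "d \<in> R0"
  shows "fr a b \<otimes>\<^bsub>K\<^esub> fr c d = fr (a \<otimes> c) (b \<otimes> d)"
proof -
  have "(\<Union>p\<in>fraction_rel R `` {(a, b)}. \<Union>q\<in>fraction_rel R `` {(c, d)}.
      fr (fst p \<otimes> fst q) (snd p \<otimes> snd q)) = fr (fst (a,b) \<otimes> fst (c,d)) (snd (a,b) \<otimes> snd (c,d))"
  proof (rule UN_equiv_class2[OF fraction_rel_equiv fraction_rel_equiv])
    show "congruent2 (fraction_rel R) (fraction_rel R)
        (\<lambda>p q. fr (fst p \<otimes> fst q) (snd p \<otimes> snd q))"
    proof (rule congruent2I', clarify)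
      fix a b a' b' c d c' d'
      assume "((a, b), (a', b')) \<in> fraction_rel R" and "((c, d), (c', d')) \<in> fraction_rel R"
      then have c: "a \<in> carrier R" "b \<in> R0" "a' \<in> carrier R" "b' \<in> R0"
        "c \<in> carrier R" "d \<in> R0" "c' \<in> carrier R" "d' \<in> R0"
        and e1: "a \<otimes> b' = a' \<otimes> b" and e2: "c \<otimes> d' = c' \<otimes> d"
        by (auto simp: fraction_rel_def)
      have cc: "b \<in> carrier R" "b' \<in> carrier R" "d \<in> carrier R" "d' \<in> carrier R" using c by auto
      have "(a \<otimes> c) \<otimes> (b' \<otimes> d') = (a \<otimes> b') \<otimes> (c \<otimes> d')" using c cc by (simp add: l_distr r_distr m_ac a_ac)
      also have "\<dots> = (a' \<otimes> c') \<otimes> (b \<otimes> d)" unfolding e1 e2 using c cc by (simp add: l_distr r_distr m_ac a_ac)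
      finally show "fr (fst (a, b) \<otimes> fst (c, d)) (snd (a, b) \<otimes> snd (c, d)) =
          fr (fst (a', b') \<otimes> fst (c', d')) (snd (a', b') \<otimes> snd (c', d'))"
        using c nz_mult by (simp add: fraction_eq_iff)
    qed
  qed (use assms in auto)
  then show ?thesis by (simp add: fraction_field_def fraction_def)
qed

lemma fraction_add:
  assumes "a \<in> carrier R" "b \<in> R0" "c \<in> carrier R" "d \<in> R0"
  shows "fr a b \<oplus>\<^bsub>K\<^esub> fr c d = fr (a \<otimes> d \<oplus> c \<otimes> b) (b \<otimes> d)"
proof -
  have "(\<Union>p\<in>fraction_rel R `` {(a, b)}. \<Union>q\<in>fraction_rel R `` {(c, d)}.
      fr (fst p \<otimes> snd q \<oplus> fst q \<otimes> snd p) (snd p \<otimes> snd q)) =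
      fr (fst (a,b) \<otimes> snd (c,d) \<oplus> fst (c,d) \<otimes> snd (a,b)) (snd (a,b) \<otimes> snd (c,d))"
  proof (rule UN_equiv_class2[OF fraction_rel_equiv fraction_rel_equiv])
    show "congruent2 (fraction_rel R) (fraction_rel R)
        (\<lambda>p q. fr (fst p \<otimes> snd q \<oplus> fst q \<otimes> snd p) (snd p \<otimes> snd q))"
    proof (rule congruent2I', clarify)
      fix a b a' b' c d c' d'
      assume "((a, b), (a', b')) \<in> fraction_rel R" and "((c, d), (c', d')) \<in> fraction_rel R"
      then have c: "a \<in> carrier R" "b \<in> R0" "a' \<in> carrier R" "b' \<in> R0"
        "c \<in> carrier R" "d \<in> R0" "c' \<in> carrier R" "d' \<in> R0"
        and e1: "a \<otimes> b' = a' \<otimes> b" and e2: "c \<otimes> d' = c' \<otimes> d"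
        by (auto simp: fraction_rel_def)
      have cc: "b \<in> carrier R" "b' \<in> carrier R" "d \<in> carrier R" "d' \<in> carrier R" using c by auto
      have "(a \<otimes> d \<oplus> c \<otimes> b) \<otimes> (b' \<otimes> d') =
          (a \<otimes> b') \<otimes> (d \<otimes> d') \<oplus> (c \<otimes> d') \<otimes> (b \<otimes> b')"
        using c cc by (simp add: l_distr r_distr m_ac a_ac)
      also have "\<dots> = (a' \<otimes> d' \<oplus> c' \<otimes> b') \<otimes> (b \<otimes> d)"
        unfolding e1 e2 using c cc by (simp add: l_distr r_distr m_ac a_ac)
      finally show "fr (fst (a, b) \<otimes> snd (c, d) \<oplus> fst (c, d) \<otimes> snd (a, b)) (snd (a, b) \<otimes> snd (c, d)) =
          fr (fst (a', b') \<otimes> snd (c', d') \<oplus> fst (c', d') \<otimes> snd (a', b')) (snd (a', b') \<otimes> snd (c', d'))"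
        using c cc nz_mult by (simp add: fraction_eq_iff)
    qed
  qed (use assms in auto)
  then show ?thesis by (simp add: fraction_field_def fraction_def)
qed

lemma fraction_zero: "\<zero>\<^bsub>K\<^esub> = fr \<zero> \<one>" and fraction_one: "\<one>\<^bsub>K\<^esub> = fr \<one> \<one>"
  by (simp_all add: fraction_field_def)

lemma one_R0: "\<one> \<in> R0"
  by simp

lemma fraction_field_field: "field K"
proof (rule cring.cring_fieldI2)
  have E: "\<exists>a b. a \<in> carrier R \<and> b \<in> carrier R \<and> b \<noteq> \<zero> \<and> x = fr a b" if "x \<in> carrier K" for x
    using that by (auto simp: fraction_carrier)
  note R0_D = nz_mult[simplified]
  note calc = fraction_add fraction_mult fraction_zero fraction_one fraction_eq_iff R0_D integral_iff
  have inI: "fr a b \<in> carrier K" if "a \<in> carrier R" "b \<in> carrier R" "b \<noteq> \<zero>" for a b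
    using that by (auto simp: fraction_carrier)
  show "cring K"
  proof (rule cringI)
    show "abelian_group K"
    proof (rule abelian_groupI)
      fix x y assume "x \<in> carrier K" "y \<in> carrier K"
      obtain a b where a: "a \<in> carrier R" "b \<in> carrier R" "b \<noteq> \<zero>" "x = fr a b"
        using E[OF \<open>x \<in> carrier K\<close>] by blast
      obtain c d where c: "c \<in> carrier R" "d \<in> carrier R" "d \<noteq> \<zero>" "y = fr c d"
        using E[OF \<open>y \<in> carrier K\<close>] by blast
      note * = a c
      show "x \<oplus>\<^bsub>K\<^esub> y \<in> carrier K" using * by (simp add: calc inI)
      show "x \<oplus>\<^bsub>K\<^esub> y = y \<oplus>\<^bsub>K\<^esub> x" using * by (simp add: calc l_distr r_distr m_ac a_ac)
      show "\<zero>\<^bsub>K\<^esub> \<oplus>\<^bsub>K\<^esub> x = x" using * by (simp add: calc)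
      have "fr (\<ominus> a) b \<oplus>\<^bsub>K\<^esub> x = \<zero>\<^bsub>K\<^esub>" using * by (simp add: calc l_minus l_neg)
      then show "\<exists>y\<in>carrier K. y \<oplus>\<^bsub>K\<^esub> x = \<zero>\<^bsub>K\<^esub>" using * inI by blast
      fix z assume "z \<in> carrier K"
      then obtain e f where "e \<in> carrier R" "f \<in> carrier R" "f \<noteq> \<zero>" "z = fr e f" using E by blast
      then show "x \<oplus>\<^bsub>K\<^esub> y \<oplus>\<^bsub>K\<^esub> z = x \<oplus>\<^bsub>K\<^esub> (y \<oplus>\<^bsub>K\<^esub> z)" using * by (simp add: calc l_distr r_distr m_ac a_ac)
    qed (simp add: fraction_zero inI)
    show "comm_monoid K"
    proof (rule comm_monoidI)
      fix x y assume "x \<in> carrier K" "y \<in> carrier K"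
      obtain a b where a: "a \<in> carrier R" "b \<in> carrier R" "b \<noteq> \<zero>" "x = fr a b"
        using E[OF \<open>x \<in> carrier K\<close>] by blast
      obtain c d where c: "c \<in> carrier R" "d \<in> carrier R" "d \<noteq> \<zero>" "y = fr c d"
        using E[OF \<open>y \<in> carrier K\<close>] by blast
      note * = a c
      show "x \<otimes>\<^bsub>K\<^esub> y \<in> carrier K" using * by (simp add: calc inI)
      show "x \<otimes>\<^bsub>K\<^esub> y = y \<otimes>\<^bsub>K\<^esub> x" using * by (simp add: calc l_distr r_distr m_ac a_ac)
      show "\<one>\<^bsub>K\<^esub> \<otimes>\<^bsub>K\<^esub> x = x" using * by (simp add: calc)
      fix z assume "z \<in> carrier K"
      then obtain e f where "e \<in> carrier R" "f \<in> carrier R" "f \<noteq> \<zero>" "z = fr e f" using E by blast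
      then show "x \<otimes>\<^bsub>K\<^esub> y \<otimes>\<^bsub>K\<^esub> z = x \<otimes>\<^bsub>K\<^esub> (y \<otimes>\<^bsub>K\<^esub> z)" using * by (simp add: calc l_distr r_distr m_ac a_ac)
    qed (simp add: fraction_one inI)
    fix x y z assume "x \<in> carrier K" "y \<in> carrier K" "z \<in> carrier K"
    obtain a b where a: "a \<in> carrier R" "b \<in> carrier R" "b \<noteq> \<zero>" "x = fr a b"
      using E[OF \<open>x \<in> carrier K\<close>] by blast
    obtain c d where c: "c \<in> carrier R" "d \<in> carrier R" "d \<noteq> \<zero>" "y = fr c d"
      using E[OF \<open>y \<in> carrier K\<close>] by blast
    obtain e f where e: "e \<in> carrier R" "f \<in> carrier R" "f \<noteq> \<zero>" "z = fr e f"
      using E[OF \<open>z \<in> carrier K\<close>] by blast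
    from a c e show "(x \<oplus>\<^bsub>K\<^esub> y) \<otimes>\<^bsub>K\<^esub> z = x \<otimes>\<^bsub>K\<^esub> z \<oplus>\<^bsub>K\<^esub> y \<otimes>\<^bsub>K\<^esub> z" by (simp add: calc l_distr r_distr m_ac a_ac)
  qed
  show "\<zero>\<^bsub>K\<^esub> \<noteq> \<one>\<^bsub>K\<^esub>" by (simp add: calc)
  fix x assume "x \<in> carrier K" "x \<noteq> \<zero>\<^bsub>K\<^esub>"
  moreover from this obtain a b where *: "a \<in> carrier R" "b \<in> carrier R" "b \<noteq> \<zero>" "x = fr a b"
    using E by blast
  ultimately have "a \<noteq> \<zero>" by (auto simp: calc)
  with * have "x \<otimes>\<^bsub>K\<^esub> fr b a = \<one>\<^bsub>K\<^esub>" by (simp add: calc m_comm)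
  then show "\<exists>y\<in>carrier K. x \<otimes>\<^bsub>K\<^esub> y = \<one>\<^bsub>K\<^esub>" using * \<open>a \<noteq> \<zero>\<close> inI by blast
qed

lemma to_fraction_hom: "to_fraction R \<in> ring_hom R K"
proof (rule ring_hom_memI)
  fix x assume "x \<in> carrier R"
  then show "to_fraction R x \<in> carrier K"
    unfolding to_fraction_def fraction_carrier using one_R0 by blast
qed (simp_all add: to_fraction_def fraction_mult fraction_add fraction_one)

lemma to_fraction_inj: "inj_on (to_fraction R) (carrier R)"
  by (rule inj_onI) (simp add: to_fraction_def fraction_eq_iff)

end

end


section \<open>Ideals\<close>

definition fg_ideal :: "('a, 'm) ring_scheme \<Rightarrow> 'a set \<Rightarrow> bool" where
  "fg_ideal R I \<longleftrightarrow> (\<exists>S. finite S \<and> S \<subseteq> carrier R \<and> I = genideal R S)"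

definition radical :: "('a, 'm) ring_scheme \<Rightarrow> 'a set \<Rightarrow> 'a set" where
  "radical R I = {a \<in> carrier R. \<exists>n::nat. n \<ge> 1 \<and> a [^]\<^bsub>R\<^esub> n \<in> I}"

definition radical_ideal :: "('a, 'm) ring_scheme \<Rightarrow> 'a set \<Rightarrow> bool" where
  "radical_ideal R I \<longleftrightarrow> ideal I R \<and> radical R I = I"

text \<open>The empty product is the unit ideal.\<close>

definition ideal_list_prod :: "('a, 'm) ring_scheme \<Rightarrow> 'a set list \<Rightarrow> 'a set" where
  "ideal_list_prod R Js = foldr (ideal_prod R) Js (carrier R)"

definition fractional_ideal :: "('a, 'm) ring_scheme \<Rightarrow> ('a \<times> 'a) set set \<Rightarrow> bool" where
  "fractional_ideal R J \<longleftrightarrow>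
     additive_subgroup J (fraction_field R) \<and>
     (\<forall>r \<in> carrier R. \<forall>x \<in> J. to_fraction R r \<otimes>\<^bsub>fraction_field R\<^esub> x \<in> J) \<and>
     (\<exists>d \<in> carrier R - {\<zero>\<^bsub>R\<^esub>}. \<forall>x \<in> J.
        to_fraction R d \<otimes>\<^bsub>fraction_field R\<^esub> x \<in> to_fraction R ` carrier R)"

text \<open>\<^const>\<open>ideal_prod\<close> over the fraction field forms the sums of products of elements of two
  subsets, so on fractional ideals it is their product as \<open>R\<close>-submodules, not as ideals of the
  field.\<close>

definition invertible_ideal :: "('a, 'm) ring_scheme \<Rightarrow> 'a set \<Rightarrow> bool" where
  "invertible_ideal R I \<longleftrightarrow> ideal I R \<and>
     (\<exists>J. fractional_ideal R J \<and>
          ideal_prod (fraction_field R) (to_fraction R ` I) J = to_fraction R ` carrier R)"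

definition prufer_domain :: "('a, 'm) ring_scheme \<Rightarrow> bool" where
  "prufer_domain R \<longleftrightarrow> domain R \<and>
     (\<forall>I. fg_ideal R I \<and> I \<noteq> {\<zero>\<^bsub>R\<^esub>} \<longrightarrow> invertible_ideal R I)"

definition krull_dim :: "('a, 'm) ring_scheme \<Rightarrow> enat" where
  "krull_dim R = Sup {enat n | n. \<exists>P :: nat \<Rightarrow> 'a set.
     (\<forall>i \<le> n. primeideal (P i) R) \<and> (\<forall>i < n. P i \<subset> P (Suc i))}"


section \<open>The inverse topology on the maximal spectrum\<close>

definition Max_inv :: "('a, 'm) ring_scheme \<Rightarrow> 'a set topology" where
  "Max_inv R = topology (arbitrary union_of
     (\<lambda>U. \<exists>I. fg_ideal R I \<and> U = {M. maximalideal M R \<and> I \<subseteq> M}))"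

lemma (in cring) openin_Max_inv:
  "openin (Max_inv R) = arbitrary union_of
     (\<lambda>U. \<exists>I. fg_ideal R I \<and> U = {M. maximalideal M R \<and> I \<subseteq> M})"
  unfolding Max_inv_def
proof (rule topology_inverse', rule istopology_base)
  have *: "genideal R S \<subseteq> M \<longleftrightarrow> S \<subseteq> M" if "S \<subseteq> carrier R" "maximalideal M R" for S M
    using that genideal_self genideal_minimal maximalideal.axioms(1) by blast
  fix U V
  assume "\<exists>I. fg_ideal R I \<and> U = {M. maximalideal M R \<and> I \<subseteq> M}"
    and "\<exists>I. fg_ideal R I \<and> V = {M. maximalideal M R \<and> I \<subseteq> M}"
  then obtain S T where "finite S" "S \<subseteq> carrier R" "finite T" "T \<subseteq> carrier R"
    and "U = {M. maximalideal M R \<and> genideal R S \<subseteq> M}"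
        "V = {M. maximalideal M R \<and> genideal R T \<subseteq> M}"
    unfolding fg_ideal_def by blast
  moreover from this have "U = {M. maximalideal M R \<and> S \<subseteq> M}" "V = {M. maximalideal M R \<and> T \<subseteq> M}"
    by (simp_all add: * cong: conj_cong)
  moreover have "{M. maximalideal M R \<and> genideal R (S \<union> T) \<subseteq> M} =
      {M. maximalideal M R \<and> S \<union> T \<subseteq> M}"
    using \<open>S \<subseteq> carrier R\<close> \<open>T \<subseteq> carrier R\<close> by (simp add: * cong: conj_cong)
  ultimately have "finite (S \<union> T)" "S \<union> T \<subseteq> carrier R"
    "U \<inter> V = {M. maximalideal M R \<and> genideal R (S \<union> T) \<subseteq> M}"
    by auto
  then show "\<exists>I. fg_ideal R I \<and> U \<inter> V = {M. maximalideal M R \<and> I \<subseteq> M}"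
    unfolding fg_ideal_def by blast
qed

lemma (in cring) topspace_Max_inv: "topspace (Max_inv R) = {M. maximalideal M R}"
proof -
  have fg: "fg_ideal R (genideal R {})" unfolding fg_ideal_def by blast
  have "genideal R {} \<subseteq> M" if "maximalideal M R" for M
    using that genideal_minimal maximalideal.axioms(1) by blast
  with fg have "openin (Max_inv R) {M. maximalideal M R}"
    unfolding openin_Max_inv
    by (intro union_of_inc) (auto simp: arbitrary_def intro!: exI[of _ "genideal R {}"])
  moreover have "U \<subseteq> {M. maximalideal M R}" if "openin (Max_inv R) U" for U
    using that unfolding openin_Max_inv union_of_def by auto
  ultimately show ?thesis unfolding topspace_def by blast
qed


section \<open>Multiplicative lattices\<close>

record 'a mult_lattice = "'a monoid" +
  ml_le :: "'a \<Rightarrow> 'a \<Rightarrow> bool"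

definition mult_lattice_iso ::
    "('a, 'm) mult_lattice_scheme \<Rightarrow> ('b, 'n) mult_lattice_scheme \<Rightarrow> ('a \<Rightarrow> 'b) set" where
  "mult_lattice_iso L L' = {h \<in> iso L L'. h \<one>\<^bsub>L\<^esub> = \<one>\<^bsub>L'\<^esub> \<and>
     (\<forall>x \<in> carrier L. \<forall>y \<in> carrier L. ml_le L x y \<longleftrightarrow> ml_le L' (h x) (h y))}"

definition ideal_lattice :: "('a, 'm) ring_scheme \<Rightarrow> 'a set mult_lattice" where
  "ideal_lattice R =
    \<lparr>carrier = {I. ideal I R}, mult = ideal_prod R, one = carrier R, ml_le = (\<subseteq>)\<rparr>"

text \<open>Functions on a space \<open>X\<close> are extensional on \<^term>\<open>topspace X\<close>.\<close>

definition U_carrier :: "'a topology \<Rightarrow> ('a \<Rightarrow> nat) set" where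
  "U_carrier X = {f \<in> extensional (topspace X).
     \<forall>k \<ge> 1. compactin X {x \<in> topspace X. f x \<ge> k}}"

text \<open>Members of \<^term>\<open>U_carrier X\<close> are regarded as functions into \<^typ>\<open>enat\<close>, so that pointwise
  addition also covers the bottom element with constant value \<open>\<infinity>\<close>. The order is the reverse of the
  pointwise one. If \<open>R\<close> is a field, its maximal spectrum is a single point, so \<open>Ub (Max_inv R)\<close> is
  infinite while \<open>R\<close> has only two ideals; the lattice description thus needs \<open>R\<close> not to be a
  field.\<close>

definition Ub :: "'a topology \<Rightarrow> ('a \<Rightarrow> enat) mult_lattice" where
  "Ub X =
    \<lparr>carrier = (\<lambda>f. \<lambda>x\<in>topspace X. enat (f x)) ` U_carrier X \<union> {\<lambda>x\<in>topspace X. \<infinity>},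
     mult = (\<lambda>f g. \<lambda>x\<in>topspace X. f x + g x),
     one = (\<lambda>x\<in>topspace X. 0),
     ml_le = (\<lambda>f g. \<forall>x\<in>topspace X. f x \<ge> g x)\<rparr>"

end

theory Submission
  imports Defs "HOL-Algebra.Ring_Divisibility" "HOL-Analysis.T1_Spaces"
begin

text \<open>Suppose that every proper ideal is a product of radical ideals. Locally at a prime \<open>P\<close>
  with \<open>P \<noteq> P\<^sup>2\<close>, every element of \<open>P - P\<^sup>2\<close> generates \<open>P\<close>; as an invertible radical ideal is locally
  principal and squarefree, \<open>P\<close> then contains no smaller nonzero prime. If \<open>P\<close> is a nonzero prime
  properly contained in a maximal ideal \<open>M\<close> and \<open>a \<in> M - P\<close>, a prime \<open>N\<close> minimal over \<open>P + (a)\<close> is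
  therefore locally idempotent. Locally at \<open>N\<close> every proper radical factor of \<open>P + (a\<^sup>2)\<close> is \<open>N\<close>, so \<open>a\<close>
  lies in \<open>P + (a\<^sup>2)\<close> locally, which is absurd. Hence nonzero primes are maximal.

  Conversely, if nonzero primes are maximal and contain invertible radical ideals, then each maximal
  ideal \<open>M\<close> has a local uniformizer, and a nonzero ideal \<open>I\<close> is determined by its orders
  \<open>ord M I\<close>. As a function of \<open>M\<close> the order is upper semicontinuous with compact support for the
  inverse topology, and intersections of compact sets of maximal ideals realise the characteristic
  functions of these sets. Decomposing a function into the characteristic functions of its level sets
  yields the chain of radical factors and the lattice isomorphism.\<close>

text \<open>No localization is constructed. A property holds at a prime \<open>P\<close> when it
  holds after multiplication by some \<open>s\<close> outside \<open>P\<close>; membership,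
  generation and orders are all phrased with such multipliers, and they are glued by noting that the
  multipliers of an element form an ideal contained in no maximal ideal. Fractional ideals enter
  once, to show that invertibility means \<open>I \<cdot> J = PIdl a\<close> for an ideal
  \<open>J\<close> and a nonzero \<open>a\<close>.

  Condition (4) is the hub: (1), (3) and (5) imply it, it implies (2), (7) and, outside fields, (6);
  the circle closes because (2) and (6) give (1), (1) gives (3), and (7) gives (5). The point of (4)
  is that an invertible radical ideal inside \<open>M\<close> is locally principal and, in dimension
  one, locally equal to \<open>M\<close>. This produces uniformizers although \<open>R\<close> need
  not be Noetherian; its finite generators also control orders on a whole neighbourhood of
  \<open>M\<close>, so that compactness replaces finiteness of the set of prime divisors. A field
  satisfies (4) vacuously, but its maximal ideal is zero and has no uniformizer, so fields are
  treated separately.\<close>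

no_notation Sum_Type.Plus (infixr \<open><+>\<close> 65)

subsection \<open>Prime ideals from Zorn's lemma\<close>

context cring
begin

lemma ideal_subset_carrier: "ideal I R \<Longrightarrow> I \<subseteq> carrier R"
  by (simp add: additive_subgroup.a_subset ideal.axioms(1))

lemma ideal_zero_mem: "ideal I R \<Longrightarrow> \<zero> \<in> I"
  by (simp add: additive_subgroup.zero_closed ideal.axioms(1))

lemma ideal_add_mem: "ideal I R \<Longrightarrow> x \<in> I \<Longrightarrow> y \<in> I \<Longrightarrow> x \<oplus> y \<in> I"
  by (simp add: additive_subgroup.a_closed ideal.axioms(1))

lemma idealI_cring:
  assumes "I \<subseteq> carrier R" "\<zero> \<in> I" "\<And>x y. x \<in> I \<Longrightarrow> y \<in> I \<Longrightarrow> x \<oplus> y \<in> I"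
    and "\<And>r x. r \<in> carrier R \<Longrightarrow> x \<in> I \<Longrightarrow> r \<otimes> x \<in> I"
  shows "ideal I R"
proof (rule idealI[OF ring_axioms])
  have "\<ominus> x \<in> I" if "x \<in> I" for x
  proof -
    have "\<ominus> x = \<ominus> \<one> \<otimes> x" using that assms(1) l_minus by auto
    then show ?thesis using assms(4)[of "\<ominus> \<one>" x] that by simp
  qed
  then show "subgroup I (add_monoid R)"
    using assms by (intro add.subgroupI) (auto simp: a_inv_def)
  show "r \<otimes> x \<in> I" if "x \<in> I" "r \<in> carrier R" for r x using assms that by simp
  show "x \<otimes> r \<in> I" if "x \<in> I" "r \<in> carrier R" for r x
    using assms(4)[of r x] that assms(1) m_comm by (metis subsetD)
qed

lemma proper_ideal_one: "ideal I R \<Longrightarrow> I \<noteq> carrier R \<longleftrightarrow> \<one> \<notin> I"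
  using ideal.one_imp_carrier by auto

lemma PIdl_mem_iff: "x \<in> PIdl a \<longleftrightarrow> (\<exists>c\<in>carrier R. x = c \<otimes> a)"
  unfolding cgenideal_def by auto

lemma add_ideal_mem_iff: "x \<in> I <+> J \<longleftrightarrow> (\<exists>i\<in>I. \<exists>j\<in>J. x = i \<oplus> j)"
  unfolding set_add_def' by auto

lemma add_ideal_subset:
  assumes "ideal I R" "ideal J R"
  shows "I \<subseteq> I <+> J" "J \<subseteq> I <+> J"
  using union_genideal[OF assms] genideal_self[of "I \<union> J"] assms ideal_subset_carrier by auto

lemma prime_mult_notin:
  assumes "primeideal P R" "s \<in> carrier R - P" "s' \<in> carrier R - P"
  shows "s \<otimes> s' \<in> carrier R - P"
  using assms primeideal.I_prime[OF assms(1)] by auto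

lemma prime_one_notin:
  assumes "primeideal P R" shows "\<one> \<in> carrier R - P"
  using assms proper_ideal_one[of P] primeideal.I_notcarr[OF assms]
  by (auto simp: primeideal.axioms(1))

lemma prime_pow_notin:
  assumes "primeideal P R" "s \<in> carrier R - P"
  shows "s [^] (n::nat) \<in> carrier R - P"
  using assms prime_one_notin prime_mult_notin by (induction n) auto

lemma prime_pow_mem:
  assumes "primeideal P R" "x \<in> carrier R" "x [^] (n::nat) \<in> P" shows "x \<in> P"
  using prime_pow_notin[OF assms(1), of x n] assms by blast

lemma add_PIdl_mem:
  assumes "ideal I R" "x \<in> carrier R"
  shows "ideal (I <+> PIdl x) R" "I \<subseteq> I <+> PIdl x" "x \<in> I <+> PIdl x"
proof -
  note J = cgenideal_ideal[OF assms(2)]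
  show "ideal (I <+> PIdl x) R" by (rule add_ideals[OF assms(1) J])
  show "I \<subseteq> I <+> PIdl x" by (rule add_ideal_subset(1)[OF assms(1) J])
  show "x \<in> I <+> PIdl x"
    using add_ideal_subset(2)[OF assms(1) J] cgenideal_self[OF assms(2)] by (rule subsetD)
qed

text \<open>If neither \<open>a\<close> nor \<open>b\<close> lies in \<open>Q\<close>, maximality
  makes \<open>Q + (a)\<close> and \<open>Q + (b)\<close> both meet \<open>S\<close>. Multiplying
  the two elements of \<open>S\<close> gives an element of \<open>Q + (a \<otimes> b)\<close>, hence
  of \<open>Q\<close> when \<open>a \<otimes> b\<close> lies in \<open>Q\<close>.\<close>

lemma maximal_avoiding_ideal_is_prime:
  assumes Q: "ideal Q R" "Q \<inter> S = {}"
    and max: "\<And>Q'. ideal Q' R \<Longrightarrow> Q \<subseteq> Q' \<Longrightarrow> Q' \<inter> S = {} \<Longrightarrow> Q' = Q"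
    and S: "\<one> \<in> S" "\<And>s s'. s \<in> S \<Longrightarrow> s' \<in> S \<Longrightarrow> s \<otimes> s' \<in> S" "S \<subseteq> carrier R"
  shows "primeideal Q R"
proof (rule primeidealI[OF Q(1) is_cring])
  show "carrier R \<noteq> Q" using Q S by auto
  fix a b assume ab: "a \<in> carrier R" "b \<in> carrier R" "a \<otimes> b \<in> Q"
  have *: "\<exists>s\<in>S. \<exists>q\<in>Q. \<exists>c\<in>carrier R. s = q \<oplus> c \<otimes> x" if x: "x \<in> carrier R" "x \<notin> Q" for x
  proof -
    note K = add_PIdl_mem[OF Q(1) x(1)]
    have "(Q <+> PIdl x) \<inter> S \<noteq> {}"
      using max[OF K(1,2)] K(3) x(2) by auto
    then obtain s where s: "s \<in> S" "s \<in> Q <+> PIdl x" by auto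
    then obtain q j where "q \<in> Q" "j \<in> PIdl x" "s = q \<oplus> j" using add_ideal_mem_iff by auto
    then show ?thesis using s PIdl_mem_iff by auto
  qed
  show "a \<in> Q \<or> b \<in> Q"
  proof (rule ccontr)
    assume "\<not> ?thesis"
    then obtain s q c s' q' c' where
      s: "s \<in> S" "q \<in> Q" "c \<in> carrier R" "s = q \<oplus> c \<otimes> a" and
      s': "s' \<in> S" "q' \<in> Q" "c' \<in> carrier R" "s' = q' \<oplus> c' \<otimes> b" using *[OF ab(1)] *[OF ab(2)] by blast
    have car: "q \<in> carrier R" "q' \<in> carrier R" using s s' Q ideal_subset_carrier by auto
    have "s \<otimes> s' = s' \<otimes> q \<oplus> ((c \<otimes> a) \<otimes> q' \<oplus> (c \<otimes> c') \<otimes> (a \<otimes> b))"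
      unfolding s s' using car s s' ab by (simp add: l_distr r_distr m_ac a_ac)
    moreover have "s' \<in> carrier R" using s' S by auto
    ultimately have "s \<otimes> s' \<in> Q"
      using s s' ab Q(1) ideal_add_mem[OF Q(1)] ideal.I_l_closed[OF Q(1)] by simp
    then show False using S(2)[OF s(1) s'(1)] Q(2) by auto
  qed
qed

text \<open>Zorn's lemma in a form that serves twice: a multiplicatively closed \<open>S\<close>
  leads to primes, and \<open>S = {\<one>}\<close> leads to maximal ideals.\<close>

lemma ideal_maximal_avoiding:
  assumes I: "ideal I R" "I \<inter> S = {}"
  shows "\<exists>Q. ideal Q R \<and> I \<subseteq> Q \<and> Q \<inter> S = {} \<and>
    (\<forall>Q'. ideal Q' R \<and> Q \<subseteq> Q' \<and> Q' \<inter> S = {} \<longrightarrow> Q' = Q)"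
proof -
  let ?A = "{Q. ideal Q R \<and> I \<subseteq> Q \<and> Q \<inter> S = {}}"
  have "\<exists>M\<in>?A. \<forall>X\<in>?A. M \<subseteq> X \<longrightarrow> X = M"
  proof (rule subset_Zorn_nonempty)
    show "?A \<noteq> {}" using I by auto
    fix C assume C: "C \<noteq> {}" "subset.chain ?A C"
    then have "subset.chain {I. ideal I R} C" "C \<subseteq> ?A"
      by (auto simp: subset_chain_def)
    then show "\<Union>C \<in> ?A" using chain_Union_is_ideal[of C] C(1) by auto
  qed
  then obtain Q where Q: "ideal Q R" "I \<subseteq> Q" "Q \<inter> S = {}"
    and m: "\<forall>X. ideal X R \<and> I \<subseteq> X \<and> X \<inter> S = {} \<longrightarrow> Q \<subseteq> X \<longrightarrow> X = Q" by auto
  show ?thesis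
  proof (intro exI[of _ Q] conjI allI impI)
    show "Q' = Q" if "ideal Q' R \<and> Q \<subseteq> Q' \<and> Q' \<inter> S = {}" for Q'
      using m that Q(2) by auto
  qed (use Q in auto)
qed

lemma primeideal_avoiding:
  assumes "ideal I R" "I \<inter> S = {}"
    and "\<one> \<in> S" "\<And>s s'. s \<in> S \<Longrightarrow> s' \<in> S \<Longrightarrow> s \<otimes> s' \<in> S" "S \<subseteq> carrier R"
  obtains Q where "primeideal Q R" "I \<subseteq> Q" "Q \<inter> S = {}"
proof -
  obtain Q where Q: "ideal Q R" "I \<subseteq> Q" "Q \<inter> S = {}"
    and max: "\<forall>Q'. ideal Q' R \<and> Q \<subseteq> Q' \<and> Q' \<inter> S = {} \<longrightarrow> Q' = Q"
    using ideal_maximal_avoiding[OF assms(1,2)] by auto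
  have "primeideal Q R" by (rule maximal_avoiding_ideal_is_prime[OF Q(1,3) _ assms(3-5)]) (use max in auto)
  then show ?thesis using Q(2,3) by (rule that)
qed

lemma maximalideal_above:
  assumes I: "ideal I R" "I \<noteq> carrier R"
  obtains M where "maximalideal M R" "I \<subseteq> M"
proof -
  have "I \<inter> {\<one>} = {}" using I proper_ideal_one by auto
  then obtain Q where Q: "ideal Q R" "I \<subseteq> Q" "Q \<inter> {\<one>} = {}"
    and max: "\<forall>Q'. ideal Q' R \<and> Q \<subseteq> Q' \<and> Q' \<inter> {\<one>} = {} \<longrightarrow> Q' = Q"
    using ideal_maximal_avoiding[OF I(1) \<open>I \<inter> {\<one>} = {}\<close>] by auto
  have "maximalideal Q R"
    using Q max proper_ideal_one by (intro maximalidealI) auto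
  then show ?thesis using that Q by auto
qed

section \<open>Minimal primes over an ideal\<close>

definition minimal_prime :: "'a set \<Rightarrow> 'a set \<Rightarrow> bool" where
  "minimal_prime I P \<longleftrightarrow> primeideal P R \<and> I \<subseteq> P \<and> (\<forall>Q. primeideal Q R \<and> I \<subseteq> Q \<and> Q \<subseteq> P \<longrightarrow> Q = P)"

lemma minimal_primeD:
  assumes "minimal_prime I P"
  shows "primeideal P R" "I \<subseteq> P" "\<And>Q. primeideal Q R \<Longrightarrow> I \<subseteq> Q \<Longrightarrow> Q \<subseteq> P \<Longrightarrow> Q = P"
  using assms unfolding minimal_prime_def by blast+

text \<open>If \<open>a\<close> is missing from \<open>P\<close> and \<open>b\<close> from
  \<open>Q\<close>, the smaller of the two primes contains neither factor, although it contains the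
  product.\<close>

lemma Inter_prime_chain:
  assumes "C \<noteq> {}" "\<And>P. P \<in> C \<Longrightarrow> primeideal P R" "\<And>P Q. P \<in> C \<Longrightarrow> Q \<in> C \<Longrightarrow> P \<subseteq> Q \<or> Q \<subseteq> P"
  shows "primeideal (\<Inter>C) R"
proof (rule primeidealI[OF _ is_cring])
  show "ideal (\<Inter>C) R" using assms by (intro i_Intersect) (auto simp: primeideal.axioms(1))
  show "carrier R \<noteq> \<Inter>C" using assms prime_one_notin by blast
  fix a b assume ab: "a \<in> carrier R" "b \<in> carrier R" "a \<otimes> b \<in> \<Inter>C"
  show "a \<in> \<Inter>C \<or> b \<in> \<Inter>C"
  proof (rule ccontr)
    assume "\<not> ?thesis"
    then obtain P Q where "P \<in> C" "Q \<in> C" "a \<notin> P" "b \<notin> Q" by auto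
    then show False using assms(2)[THEN primeideal.I_prime, of _ a b] assms(3)[of P Q] ab by blast
  qed
qed

lemma minimal_prime_below:
  assumes "primeideal P R" "I \<subseteq> P"
  obtains Q where "minimal_prime I Q" "Q \<subseteq> P"
proof -
  let ?B = "{Q. primeideal Q R \<and> I \<subseteq> Q \<and> Q \<subseteq> P}"
  \<comment> \<open>Zorn's lemma yields maximal elements, whereas a minimal prime is sought; passing
    to complements reverses inclusion and turns unions into complements of intersections.\<close>
  let ?A = "(\<lambda>Q. carrier R - Q) ` ?B"
  have sub: "Q \<subseteq> carrier R" if "Q \<in> ?B" for Q
    using that ideal_subset_carrier primeideal.axioms(1) by blast
  have inv: "carrier R - (carrier R - Q) = Q" if "Q \<in> ?B" for Q
    using sub[OF that] by auto
  have "\<exists>M\<in>?A. \<forall>X\<in>?A. M \<subseteq> X \<longrightarrow> X = M"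
  proof (rule subset_Zorn_nonempty)
    show "?A \<noteq> {}" using assms by auto
    fix C assume C: "C \<noteq> {}" "subset.chain ?A C"
    define D where "D = (\<lambda>X. carrier R - X) ` C"
    have CA: "C \<subseteq> ?A" using C by (auto simp: subset_chain_def)
    have DB: "D \<subseteq> ?B" using CA inv unfolding D_def by fastforce
    have "P' \<subseteq> Q' \<or> Q' \<subseteq> P'" if "P' \<in> D" "Q' \<in> D" for P' Q'
      using that C(2) unfolding D_def subset_chain_def by blast
    moreover have "D \<noteq> {}" using C(1) D_def by simp
    moreover have "primeideal P' R" if "P' \<in> D" for P' using DB that by auto
    ultimately have "primeideal (\<Inter>D) R" by (intro Inter_prime_chain)
    moreover have "I \<subseteq> \<Inter>D" "\<Inter>D \<subseteq> P" using DB C(1) D_def by auto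
    ultimately have "carrier R - \<Inter>D \<in> ?A" by auto
    moreover have "carrier R - \<Inter>D = \<Union>C" using CA unfolding D_def by auto
    ultimately show "\<Union>C \<in> ?A" by simp
  qed
  then obtain Q where Q: "Q \<in> ?B" and m: "\<And>X. X \<in> ?B \<Longrightarrow> carrier R - Q \<subseteq> carrier R - X \<Longrightarrow> carrier R - X = carrier R - Q"
    by (auto simp: image_iff)
  have "Q' = Q" if "Q' \<in> ?B" "Q' \<subseteq> Q" for Q'
    using m[OF that(1)] that(2) inv[OF that(1)] inv[OF Q] by auto
  then show ?thesis using that[of Q] Q unfolding minimal_prime_def by blast
qed

text \<open>Locally at \<open>P\<close> the only prime over \<open>I\<close> is \<open>P\<close>, so
  \<open>p\<close> is nilpotent modulo \<open>I\<close> there. The elements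
  \<open>s \<otimes> p [^] n\<close> form a multiplicatively closed set, and a prime over
  \<open>I\<close> avoiding it would lie in \<open>P\<close> and omit \<open>p\<close>.\<close>

lemma minimal_prime_power:
  assumes I: "ideal I R" and P: "minimal_prime I P" and p: "p \<in> P"
  obtains s n where "s \<in> carrier R - P" "s \<otimes> p [^] (n::nat) \<in> I"
proof -
  note PD = minimal_primeD[OF P]
  have pc: "p \<in> carrier R" using p PD ideal_subset_carrier primeideal.axioms(1) by blast
  let ?S = "{s \<otimes> p [^] (n::nat) | s n. s \<in> carrier R - P}"
  have S1: "\<one> \<in> ?S" using prime_one_notin[OF PD(1)] by (auto intro!: exI[of _ \<one>] exI[of _ "0::nat"])
  have S2: "x \<otimes> y \<in> ?S" if xy: "x \<in> ?S" "y \<in> ?S" for x y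
  proof -
    obtain s n s' n' where *: "x = s \<otimes> p [^] (n::nat)" "s \<in> carrier R - P"
      "y = s' \<otimes> p [^] (n'::nat)" "s' \<in> carrier R - P" using xy by blast
    have "x \<otimes> y = (s \<otimes> s') \<otimes> p [^] (n + n')"
      using * pc by (simp add: nat_pow_mult[symmetric] m_ac)
    then show ?thesis using prime_mult_notin[OF PD(1) *(2,4)] by blast
  qed
  have S3: "?S \<subseteq> carrier R" using pc by auto
  have "I \<inter> ?S \<noteq> {}"
  proof
    assume disj: "I \<inter> ?S = {}"
    obtain Q where Q: "primeideal Q R" "I \<subseteq> Q" "Q \<inter> ?S = {}"
      by (rule primeideal_avoiding[OF I disj S1 S2 S3])
    have "Q \<subseteq> P"
    proof
      fix x assume x: "x \<in> Q"
      then have xc: "x \<in> carrier R" using Q ideal_subset_carrier primeideal.axioms(1) by blast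
      show "x \<in> P"
      proof (rule ccontr)
        assume "x \<notin> P"
        then have "x \<in> ?S" using xc by (auto intro!: exI[of _ x] exI[of _ "0::nat"])
        then show False using Q x by blast
      qed
    qed
    then have "Q = P" using PD Q by auto
    moreover have "p \<in> ?S" using pc prime_one_notin[OF PD(1)]
      by (auto intro!: exI[of _ \<one>] exI[of _ "1::nat"])
    ultimately show False using Q p by blast
  qed
  then show ?thesis using that by blast
qed

end

subsection \<open>Products of ideals\<close>

context cring
begin

lemma ideal_prod_subset:
  assumes "ideal K R" "\<And>i j. i \<in> I \<Longrightarrow> j \<in> J \<Longrightarrow> i \<otimes> j \<in> K"
  shows "I \<cdot> J \<subseteq> K"
proof
  fix x assume "x \<in> I \<cdot> J"
  then show "x \<in> K" by induction (auto simp: assms ideal_add_mem)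
qed

lemma ideal_prod_mono: "I \<subseteq> I' \<Longrightarrow> J \<subseteq> J' \<Longrightarrow> I \<cdot> J \<subseteq> I' \<cdot> J'"
proof
  fix x assume s: "I \<subseteq> I'" "J \<subseteq> J'" and "x \<in> I \<cdot> J"
  from this(3) show "x \<in> I' \<cdot> J'" by induction (use s in \<open>auto intro: ideal_prod.intros\<close>)
qed

lemma ideal_prod_carrier:
  assumes "ideal I R" shows "I \<cdot> carrier R = I" "carrier R \<cdot> I = I"
  using ideal_prod_one[OF assms] ideal_prod_commute[OF assms oneideal] by auto

lemma PIdl_prod_mem_iff:
  assumes "a \<in> carrier R" "ideal I R"
  shows "x \<in> (PIdl a) \<cdot> I \<longleftrightarrow> (\<exists>y\<in>I. x = a \<otimes> y)"
proof
  note sub = ideal_subset_carrier[OF assms(2)]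
  have "ideal {a \<otimes> y | y. y \<in> I} R"
  proof (rule idealI_cring)
    show "{a \<otimes> y | y. y \<in> I} \<subseteq> carrier R" using sub assms by auto
    show "\<zero> \<in> {a \<otimes> y | y. y \<in> I}" using ideal_zero_mem[OF assms(2)] assms(1) by force
    fix x y assume "x \<in> {a \<otimes> y | y. y \<in> I}" "y \<in> {a \<otimes> y | y. y \<in> I}"
    then obtain u v where *: "x = a \<otimes> u" "y = a \<otimes> v" "u \<in> I" "v \<in> I" by blast
    then have "x \<oplus> y = a \<otimes> (u \<oplus> v)" using sub assms r_distr by (metis subsetD)
    then show "x \<oplus> y \<in> {a \<otimes> y | y. y \<in> I}" using * ideal_add_mem[OF assms(2)] by blast
  next
    fix r x assume r: "r \<in> carrier R" "x \<in> {a \<otimes> y | y. y \<in> I}"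
    then obtain u where u: "x = a \<otimes> u" "u \<in> I" by auto
    then have "r \<otimes> x = a \<otimes> (r \<otimes> u)" using r sub assms m_lcomm by auto
    then show "r \<otimes> x \<in> {a \<otimes> y | y. y \<in> I}" using u r ideal.I_l_closed[OF assms(2)] by blast
  qed
  moreover have "i \<otimes> j \<in> {a \<otimes> y | y. y \<in> I}" if i: "i \<in> PIdl a" and j: "j \<in> I" for i j
  proof -
    obtain c where c: "c \<in> carrier R" "i = c \<otimes> a" using i PIdl_mem_iff by auto
    then have "i \<otimes> j = a \<otimes> (c \<otimes> j)" using c j assms sub by (auto simp: m_ac)
    then show ?thesis using c j ideal.I_l_closed[OF assms(2)] by blast
  qed
  ultimately have *: "(PIdl a) \<cdot> I \<subseteq> {a \<otimes> y | y. y \<in> I}" by (rule ideal_prod_subset)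
  show "\<exists>y\<in>I. x = a \<otimes> y" if "x \<in> (PIdl a) \<cdot> I" using that * by auto
  show "x \<in> (PIdl a) \<cdot> I" if "\<exists>y\<in>I. x = a \<otimes> y"
    using that ideal_prod.prod[OF cgenideal_self[OF assms(1)]] by auto
qed

lemma ideal_list_prod_simps [simp]:
  "ideal_list_prod R [] = carrier R"
  "ideal_list_prod R (J # Js) = J \<cdot> ideal_list_prod R Js"
  by (simp_all add: ideal_list_prod_def)

lemma ideal_list_prod_ideal: "\<forall>J\<in>set Js. ideal J R \<Longrightarrow> ideal (ideal_list_prod R Js) R"
  by (induction Js) (auto simp: oneideal ideal_prod_is_ideal)

lemma ideal_list_prod_factor:
  assumes "\<forall>J\<in>set Js. ideal J R" "K \<in> set Js"
  shows "\<exists>B. ideal B R \<and> ideal_list_prod R Js = K \<cdot> B"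
  using assms
proof (induction Js)
  case (Cons J Js)
  show ?case
  proof (cases "K = J")
    case True
    then show ?thesis
      using Cons.prems ideal_list_prod_ideal[of Js] by (intro exI[of _ "ideal_list_prod R Js"]) simp
  next
    case False
    then obtain B where B: "ideal B R" "ideal_list_prod R Js = K \<cdot> B"
      using Cons.IH Cons.prems by auto
    have K: "ideal K R" "ideal J R" using Cons.prems by auto
    have "J \<cdot> (K \<cdot> B) = (J \<cdot> K) \<cdot> B" using K B(1) by (simp add: ideal_prod_assoc)
    also have "J \<cdot> K = K \<cdot> J" using K by (intro ideal_prod_commute)
    also have "(K \<cdot> J) \<cdot> B = K \<cdot> (J \<cdot> B)" using K B(1) by (simp add: ideal_prod_assoc)
    finally have "J \<cdot> (K \<cdot> B) = K \<cdot> (J \<cdot> B)" .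
    then show ?thesis using B K ideal_prod_is_ideal[of J B] by (intro exI[of _ "J \<cdot> B"]) simp
  qed
qed simp

lemma prime_list_prod_subset:
  assumes "primeideal P R" "\<forall>J\<in>set Js. ideal J R" "ideal_list_prod R Js \<subseteq> P"
  shows "\<exists>J\<in>set Js. J \<subseteq> P"
  using assms(2,3)
proof (induction Js)
  case Nil
  then show ?case using prime_one_notin[OF assms(1)] by auto
next
  case (Cons J Js)
  then have "J \<subseteq> P \<or> ideal_list_prod R Js \<subseteq> P"
    using primeideal_divides_ideal_prod[OF assms(1), of J] ideal_list_prod_ideal[of Js] by simp
  then show ?case using Cons by auto
qed

end

subsection \<open>Invertible ideals\<close>

context domain
begin

text \<open>Denominators are cleared so that everything afterwards happens inside \<open>R\<close>:
  a fractional inverse \<open>J\<close> with common denominator \<open>d\<close> becomes the ideal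
  \<open>d J\<close>, and conversely \<open>a^-1 J\<close> is a fractional inverse when
  \<open>I \<cdot> J = PIdl a\<close>.\<close>

lemma invertible_ideal_iff:
  "invertible_ideal R I \<longleftrightarrow>
     ideal I R \<and> (\<exists>J a. ideal J R \<and> a \<in> carrier R \<and> a \<noteq> \<zero> \<and> I \<cdot> J = PIdl a)"
proof -
  let ?K = "fraction_field R" and ?\<phi> = "to_fraction R"
  interpret K: field ?K by (rule fraction_field_field)
  interpret \<phi>: ring_hom_cring R ?K ?\<phi>
    by (intro ring_hom_cring.intro is_cring K.is_cring ring_hom_cring_axioms.intro to_fraction_hom)
  have inj: "x = y" if "?\<phi> x = ?\<phi> y" "x \<in> carrier R" "y \<in> carrier R" for x y
    using that to_fraction_inj by (auto dest: inj_onD)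
  have nz: "?\<phi> a \<noteq> \<zero>\<^bsub>?K\<^esub>" if "a \<in> carrier R" "a \<noteq> \<zero>" for a
    using inj[of a \<zero>] that by auto
  show ?thesis
  proof (cases "ideal I R")
    case False
    then show ?thesis by (simp add: invertible_ideal_def)
  next
    case I: True
    have Ic: "i \<in> carrier R" if "i \<in> I" for i using that ideal_subset_carrier[OF I] by auto
    have "\<exists>J a. ideal J R \<and> a \<in> carrier R \<and> a \<noteq> \<zero> \<and> I \<cdot> J = PIdl a"
      if J: "fractional_ideal R J"
        and prod: "ideal_prod ?K (?\<phi> ` I) J = ?\<phi> ` carrier R" for J
    proof -
      have ag: "additive_subgroup J ?K" using J unfolding fractional_ideal_def by (rule conjunct1)
      have mult: "\<And>r x. r \<in> carrier R \<Longrightarrow> x \<in> J \<Longrightarrow> ?\<phi> r \<otimes>\<^bsub>?K\<^esub> x \<in> J"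
        using J unfolding fractional_ideal_def by simp
      have "\<exists>d\<in>carrier R - {\<zero>}. \<forall>x\<in>J. ?\<phi> d \<otimes>\<^bsub>?K\<^esub> x \<in> ?\<phi> ` carrier R"
        using J unfolding fractional_ideal_def by simp
      then obtain d where d': "d \<in> carrier R - {\<zero>}" "\<forall>x\<in>J. ?\<phi> d \<otimes>\<^bsub>?K\<^esub> x \<in> ?\<phi> ` carrier R" ..
      then have d: "d \<in> carrier R" "d \<noteq> \<zero>" "\<And>x. x \<in> J \<Longrightarrow> ?\<phi> d \<otimes>\<^bsub>?K\<^esub> x \<in> ?\<phi> ` carrier R"
        by auto
      have Jc: "j \<in> carrier ?K" if "j \<in> J" for j
        using that additive_subgroup.a_subset[OF ag] by auto
      \<comment> \<open>\<open>J'\<close> is the ideal \<open>d J\<close> pulled back to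
        \<open>R\<close>.\<close>
      define J' where "J' = {x \<in> carrier R. \<exists>j\<in>J. ?\<phi> x = ?\<phi> d \<otimes>\<^bsub>?K\<^esub> j}"
      have J': "ideal J' R"
      proof (rule idealI_cring)
        show "J' \<subseteq> carrier R" by (auto simp: J'_def)
        show "\<zero> \<in> J'" using additive_subgroup.zero_closed[OF ag] d(1)
          by (auto simp: J'_def intro!: bexI[of _ "\<zero>\<^bsub>?K\<^esub>"])
        fix x y assume "x \<in> J'" "y \<in> J'"
        then obtain i j where "x \<in> carrier R" "y \<in> carrier R" "i \<in> J" "j \<in> J"
          "?\<phi> x = ?\<phi> d \<otimes>\<^bsub>?K\<^esub> i" "?\<phi> y = ?\<phi> d \<otimes>\<^bsub>?K\<^esub> j" by (auto simp: J'_def)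
        then show "x \<oplus> y \<in> J'" using additive_subgroup.a_closed[OF ag] d(1) Jc
          by (auto simp: J'_def K.r_distr intro!: bexI[of _ "i \<oplus>\<^bsub>?K\<^esub> j"])
      next
        fix r x assume r: "r \<in> carrier R" "x \<in> J'"
        then obtain i where "x \<in> carrier R" "i \<in> J" "?\<phi> x = ?\<phi> d \<otimes>\<^bsub>?K\<^esub> i" by (auto simp: J'_def)
        then show "r \<otimes> x \<in> J'" using r mult d(1) Jc
          by (auto simp: J'_def K.m_lcomm intro!: bexI[of _ "?\<phi> r \<otimes>\<^bsub>?K\<^esub> i"])
      qed
      have J'I: "\<exists>x\<in>J'. ?\<phi> x = ?\<phi> d \<otimes>\<^bsub>?K\<^esub> j" if "j \<in> J" for j
        using d(3)[OF that] that by (auto simp: J'_def)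
      \<comment> \<open>Multiplication by \<open>d\<close> carries the product of \<open>I\<close>
        with \<open>J\<close> into that of \<open>I\<close> with \<open>J'\<close>; applied to the
        unit element it puts \<open>d\<close> into \<open>I \<cdot> J'\<close>.\<close>
      have lift: "\<exists>z\<in>I \<cdot> J'. ?\<phi> z = ?\<phi> d \<otimes>\<^bsub>?K\<^esub> y" if "y \<in> ideal_prod ?K (?\<phi> ` I) J" for y
      proof -
        have "y \<in> carrier ?K \<and> (\<exists>z\<in>I \<cdot> J'. ?\<phi> z = ?\<phi> d \<otimes>\<^bsub>?K\<^esub> y)" using that
        proof induction
          case (prod i j)
          then obtain i' x where *: "i = ?\<phi> i'" "i' \<in> I" "x \<in> J'" "?\<phi> x = ?\<phi> d \<otimes>\<^bsub>?K\<^esub> j"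
            using J'I by blast
          then have "?\<phi> (i' \<otimes> x) = ?\<phi> d \<otimes>\<^bsub>?K\<^esub> (i \<otimes>\<^bsub>?K\<^esub> j)"
            using Ic Jc prod d(1) ideal_subset_carrier[OF J'] by (auto simp: K.m_lcomm subset_iff)
          then show ?case using * prod Ic Jc ideal_prod.prod[of i' I x J' R] by auto
        next
          case (sum y1 y2)
          then obtain z1 z2 where *: "z1 \<in> I \<cdot> J'" "z2 \<in> I \<cdot> J'"
            "?\<phi> z1 = ?\<phi> d \<otimes>\<^bsub>?K\<^esub> y1" "?\<phi> z2 = ?\<phi> d \<otimes>\<^bsub>?K\<^esub> y2" by auto
          moreover have "z1 \<in> carrier R" "z2 \<in> carrier R"
            using * ideal_prod_in_carrier[OF I J'] by auto
          ultimately have "?\<phi> (z1 \<oplus> z2) = ?\<phi> d \<otimes>\<^bsub>?K\<^esub> (y1 \<oplus>\<^bsub>?K\<^esub> y2)"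
            using sum d(1) by (simp add: K.r_distr)
          then show ?case using sum ideal_prod.sum[OF *(1,2)] by auto
        qed
        then show ?thesis ..
      qed
      have "?\<phi> \<one> \<in> ideal_prod ?K (?\<phi> ` I) J" unfolding prod by (rule imageI) simp
      then obtain z where z: "z \<in> I \<cdot> J'" "?\<phi> z = ?\<phi> d \<otimes>\<^bsub>?K\<^esub> ?\<phi> \<one>" using lift by auto
      then have "z = d" using d(1) ideal_prod_in_carrier[OF I J'] by (intro inj) auto
      then have "PIdl d \<subseteq> I \<cdot> J'"
        using z(1) cgenideal_minimal[OF ideal_prod_is_ideal[OF I J']] by auto
      moreover have "I \<cdot> J' \<subseteq> PIdl d"
      proof (rule ideal_prod_subset[OF cgenideal_ideal[OF d(1)]])
        fix i x assume i: "i \<in> I" and "x \<in> J'"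
        then obtain j where j: "x \<in> carrier R" "j \<in> J" "?\<phi> x = ?\<phi> d \<otimes>\<^bsub>?K\<^esub> j" by (auto simp: J'_def)
        have "?\<phi> i \<otimes>\<^bsub>?K\<^esub> j \<in> ideal_prod ?K (?\<phi> ` I) J" using i j by (intro ideal_prod.prod) auto
        then obtain r where r: "r \<in> carrier R" "?\<phi> i \<otimes>\<^bsub>?K\<^esub> j = ?\<phi> r" using prod by auto
        have "?\<phi> (i \<otimes> x) = ?\<phi> d \<otimes>\<^bsub>?K\<^esub> (?\<phi> i \<otimes>\<^bsub>?K\<^esub> j)"
          using i j Ic Jc d(1) by (simp add: K.m_lcomm)
        also have "\<dots> = ?\<phi> (r \<otimes> d)" using r d(1) by (simp add: K.m_comm)
        finally have "i \<otimes> x = r \<otimes> d" using i j Ic r d(1) by (intro inj) auto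
        then show "i \<otimes> x \<in> PIdl d" using r PIdl_mem_iff by auto
      qed
      ultimately show ?thesis using J' d by blast
    qed
    moreover have "\<exists>J'. fractional_ideal R J' \<and> ideal_prod ?K (?\<phi> ` I) J' = ?\<phi> ` carrier R"
      if J: "ideal J R" and a: "a \<in> carrier R" "a \<noteq> \<zero>" and prod: "I \<cdot> J = PIdl a" for J a
    proof -
      have Jc: "j \<in> carrier R" if "j \<in> J" for j using that ideal_subset_carrier[OF J] by auto
      \<comment> \<open>\<open>J'\<close> is \<open>a^-1 J\<close>, described by the equation that
        holds after multiplying by \<open>a\<close>.\<close>
      define J' where "J' = {y \<in> carrier ?K. \<exists>x\<in>J. ?\<phi> a \<otimes>\<^bsub>?K\<^esub> y = ?\<phi> x}"
      have cancel: "y = y'" if "?\<phi> a \<otimes>\<^bsub>?K\<^esub> y = ?\<phi> a \<otimes>\<^bsub>?K\<^esub> y'" "y \<in> carrier ?K" "y' \<in> carrier ?K" for y y'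
        using that a nz[OF a] K.m_lcancel by simp
      have sub: "subgroup J' (add_monoid ?K)"
      proof (rule K.add.subgroupI)
        show "J' \<subseteq> carrier ?K" by (auto simp: J'_def)
        have "\<zero>\<^bsub>?K\<^esub> \<in> J'" using ideal_zero_mem[OF J] a(1)
          by (auto simp: J'_def intro!: bexI[of _ \<zero>])
        then show "J' \<noteq> {}" by auto
        fix y assume "y \<in> J'"
        then obtain x where y: "y \<in> carrier ?K" "x \<in> J" "?\<phi> a \<otimes>\<^bsub>?K\<^esub> y = ?\<phi> x" by (auto simp: J'_def)
        then have "?\<phi> a \<otimes>\<^bsub>?K\<^esub> (\<ominus>\<^bsub>?K\<^esub> y) = ?\<phi> (\<ominus> x)" using a Jc by (simp add: K.r_minus)
        moreover have "\<ominus> x \<in> J" using y J by (simp add: additive_subgroup.a_inv_closed ideal.axioms(1))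
        ultimately show "\<ominus>\<^bsub>?K\<^esub> y \<in> J'" using y(1) by (auto simp: J'_def)
        fix y' assume "y' \<in> J'"
        then obtain x' where y': "y' \<in> carrier ?K" "x' \<in> J" "?\<phi> a \<otimes>\<^bsub>?K\<^esub> y' = ?\<phi> x'" by (auto simp: J'_def)
        then have "?\<phi> a \<otimes>\<^bsub>?K\<^esub> (y \<oplus>\<^bsub>?K\<^esub> y') = ?\<phi> (x \<oplus> x')" using y a Jc by (simp add: K.r_distr)
        then show "y \<oplus>\<^bsub>?K\<^esub> y' \<in> J'"
          using y y' ideal_add_mem[OF J y(2) y'(2)] by (auto simp: J'_def)
      qed
      have "fractional_ideal R J'" unfolding fractional_ideal_def
      proof (intro conjI ballI)
        show "additive_subgroup J' ?K" using sub by (rule additive_subgroupI)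
        show "?\<phi> r \<otimes>\<^bsub>?K\<^esub> y \<in> J'" if r: "r \<in> carrier R" and "y \<in> J'" for r y
        proof -
          from that obtain x where y: "y \<in> carrier ?K" "x \<in> J" "?\<phi> a \<otimes>\<^bsub>?K\<^esub> y = ?\<phi> x" by (auto simp: J'_def)
          then have "?\<phi> a \<otimes>\<^bsub>?K\<^esub> (?\<phi> r \<otimes>\<^bsub>?K\<^esub> y) = ?\<phi> (r \<otimes> x)"
            using r a Jc K.m_lcomm[of "?\<phi> a" "?\<phi> r" y] by simp
          then show ?thesis using y r ideal.I_l_closed[OF J y(2) r] by (auto simp: J'_def)
        qed
        show "\<exists>d\<in>carrier R - {\<zero>}. \<forall>x\<in>J'. ?\<phi> d \<otimes>\<^bsub>?K\<^esub> x \<in> ?\<phi> ` carrier R"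
          using a Jc by (intro bexI[of _ a]) (auto simp: J'_def)
      qed
      moreover have "ideal_prod ?K (?\<phi> ` I) J' \<subseteq> ?\<phi> ` carrier R"
      proof
        fix y assume "y \<in> ideal_prod ?K (?\<phi> ` I) J'"
        then show "y \<in> ?\<phi> ` carrier R"
        proof induction
          case (prod i y)
          then obtain i' x where *: "i = ?\<phi> i'" "i' \<in> I" "y \<in> carrier ?K" "x \<in> J" "?\<phi> a \<otimes>\<^bsub>?K\<^esub> y = ?\<phi> x"
            by (auto simp: J'_def)
          have "i' \<otimes> x \<in> PIdl a" using ideal_prod.prod[of i' I x J R] * \<open>I \<cdot> J = PIdl a\<close> by simp
          then obtain r where r: "r \<in> carrier R" "i' \<otimes> x = r \<otimes> a" using PIdl_mem_iff by auto
          have "?\<phi> a \<otimes>\<^bsub>?K\<^esub> (i \<otimes>\<^bsub>?K\<^esub> y) = ?\<phi> (i' \<otimes> x)"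
            using * a Ic Jc K.m_lcomm[of "?\<phi> a" i y] by simp
          also have "\<dots> = ?\<phi> a \<otimes>\<^bsub>?K\<^esub> ?\<phi> r" using r a by (simp add: K.m_comm)
          finally have "i \<otimes>\<^bsub>?K\<^esub> y = ?\<phi> r"
            by (rule cancel) (use *(1-3) Ic[OF *(2)] r(1) in simp_all)
          then show ?case using r by auto
        next
          case (sum y1 y2)
          then obtain r1 r2 where "r1 \<in> carrier R" "y1 = ?\<phi> r1" "r2 \<in> carrier R" "y2 = ?\<phi> r2" by auto
          then have "y1 \<oplus>\<^bsub>?K\<^esub> y2 = ?\<phi> (r1 \<oplus> r2)" "r1 \<oplus> r2 \<in> carrier R" by auto
          then show ?case by blast
        qed
      qed
      moreover have "?\<phi> r \<in> ideal_prod ?K (?\<phi> ` I) J'" if r: "r \<in> carrier R" for r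
      proof -
        \<comment> \<open>Division by \<open>a\<close> carries \<open>I \<cdot> J\<close> into the
          product with \<open>J'\<close>; since \<open>r \<otimes> a\<close> lies in
          \<open>I \<cdot> J\<close>, this reaches every \<open>r\<close>.\<close>
        have lift: "\<exists>y\<in>ideal_prod ?K (?\<phi> ` I) J'. y \<in> carrier ?K \<and> ?\<phi> z = ?\<phi> a \<otimes>\<^bsub>?K\<^esub> y"
          if "z \<in> I \<cdot> J" for z
        proof -
          have "z \<in> carrier R \<and> (\<exists>y\<in>ideal_prod ?K (?\<phi> ` I) J'. y \<in> carrier ?K \<and> ?\<phi> z = ?\<phi> a \<otimes>\<^bsub>?K\<^esub> y)"
            using that
          proof induction
            case (prod i x)
            define y where "y = inv\<^bsub>?K\<^esub> (?\<phi> a) \<otimes>\<^bsub>?K\<^esub> ?\<phi> x"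
            have u: "?\<phi> a \<in> Units ?K" using nz[OF a] a by (simp add: K.field_Units)
            have y: "y \<in> carrier ?K" using u prod Jc by (simp add: y_def)
            have ay: "?\<phi> a \<otimes>\<^bsub>?K\<^esub> y = ?\<phi> x" using u prod Jc a
              by (simp add: y_def K.m_assoc[symmetric])
            then have "y \<in> J'" using y prod by (auto simp: J'_def)
            then have "?\<phi> i \<otimes>\<^bsub>?K\<^esub> y \<in> ideal_prod ?K (?\<phi> ` I) J'"
              using prod by (intro ideal_prod.prod) auto
            moreover have "?\<phi> (i \<otimes> x) = ?\<phi> a \<otimes>\<^bsub>?K\<^esub> (?\<phi> i \<otimes>\<^bsub>?K\<^esub> y)"
              using K.m_lcomm[of "?\<phi> a" "?\<phi> i" y] prod Ic Jc a y ay by simp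
            moreover have "?\<phi> i \<otimes>\<^bsub>?K\<^esub> y \<in> carrier ?K" "i \<otimes> x \<in> carrier R"
              using y prod Ic Jc by auto
            ultimately show ?case by (intro conjI bexI[of _ "?\<phi> i \<otimes>\<^bsub>?K\<^esub> y"])
          next
            case (sum z1 z2)
            then obtain y1 y2 where *: "y1 \<in> ideal_prod ?K (?\<phi> ` I) J'" "y1 \<in> carrier ?K" "?\<phi> z1 = ?\<phi> a \<otimes>\<^bsub>?K\<^esub> y1"
               "y2 \<in> ideal_prod ?K (?\<phi> ` I) J'" "y2 \<in> carrier ?K" "?\<phi> z2 = ?\<phi> a \<otimes>\<^bsub>?K\<^esub> y2" by auto
            then have "?\<phi> (z1 \<oplus> z2) = ?\<phi> a \<otimes>\<^bsub>?K\<^esub> (y1 \<oplus>\<^bsub>?K\<^esub> y2)" using sum a by (simp add: K.r_distr)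
            then show ?case using ideal_prod.sum[OF *(1,4)] * sum by auto
          qed
          then show ?thesis by blast
        qed
        have "r \<otimes> a \<in> I \<cdot> J" using r \<open>I \<cdot> J = PIdl a\<close> PIdl_mem_iff by auto
        then obtain y where y: "y \<in> ideal_prod ?K (?\<phi> ` I) J'" "y \<in> carrier ?K"
          "?\<phi> (r \<otimes> a) = ?\<phi> a \<otimes>\<^bsub>?K\<^esub> y" using lift by blast
        have "?\<phi> a \<otimes>\<^bsub>?K\<^esub> ?\<phi> r = ?\<phi> a \<otimes>\<^bsub>?K\<^esub> y"
          unfolding y(3)[symmetric] using r a(1) by (simp add: K.m_comm)
        then have "?\<phi> r = y" by (rule cancel) (use r y(2) in simp_all)
        then show ?thesis using y by simp
      qed
      ultimately show ?thesis by blast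
    qed
    ultimately show ?thesis unfolding invertible_ideal_def using I by blast
  qed
qed


lemma invertible_idealE:
  assumes "invertible_ideal R I"
  obtains J a where "ideal I R" "ideal J R" "a \<in> carrier R" "a \<noteq> \<zero>" "I \<cdot> J = PIdl a"
  using assms unfolding invertible_ideal_iff by auto

lemma invertible_idealI:
  "ideal I R \<Longrightarrow> ideal J R \<Longrightarrow> a \<in> carrier R \<Longrightarrow> a \<noteq> \<zero> \<Longrightarrow> I \<cdot> J = PIdl a \<Longrightarrow> invertible_ideal R I"
  unfolding invertible_ideal_iff by auto

lemma invertible_ideal_ideal: "invertible_ideal R I \<Longrightarrow> ideal I R"
  by (simp add: invertible_ideal_def)

lemma invertible_PIdl: "a \<in> carrier R \<Longrightarrow> a \<noteq> \<zero> \<Longrightarrow> invertible_ideal R (PIdl a)"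
  using invertible_idealI[OF cgenideal_ideal oneideal] ideal_prod_carrier(1)[OF cgenideal_ideal] by simp

section \<open>Factors, cancellation and division of invertible ideals\<close>

lemma invertible_prodD:
  assumes I: "ideal I R" and J: "ideal J R" and inv: "invertible_ideal R (I \<cdot> J)"
  shows "invertible_ideal R I" "invertible_ideal R J"
proof -
  obtain B a where B: "ideal B R" "a \<in> carrier R" "a \<noteq> \<zero>" "(I \<cdot> J) \<cdot> B = PIdl a"
    by (rule invertible_idealE[OF inv])
  have "I \<cdot> (J \<cdot> B) = PIdl a" using B I J by (simp add: ideal_prod_assoc)
  then show "invertible_ideal R I"
    by (rule invertible_idealI[OF I ideal_prod_is_ideal[OF J B(1)] B(2,3)])
  have "J \<cdot> (I \<cdot> B) = (J \<cdot> I) \<cdot> B" using B I J by (simp add: ideal_prod_assoc)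
  also have "J \<cdot> I = I \<cdot> J" by (rule ideal_prod_commute[OF J I])
  finally have "J \<cdot> (I \<cdot> B) = PIdl a" using B by simp
  then show "invertible_ideal R J"
    by (rule invertible_idealI[OF J ideal_prod_is_ideal[OF I B(1)] B(2,3)])
qed

text \<open>Multiplication by the complement \<open>J\<close> of \<open>I\<close> turns both
  products into multiples of \<open>PIdl a\<close>, where the nonzero \<open>a\<close> cancels
  elementwise.\<close>

lemma invertible_cancel_subset:
  assumes inv: "invertible_ideal R I" and A: "ideal A R" and B: "ideal B R" and sub: "I \<cdot> A \<subseteq> I \<cdot> B"
  shows "A \<subseteq> B"
proof
  fix x assume x: "x \<in> A"
  obtain J a where J: "ideal I R" "ideal J R" "a \<in> carrier R" "a \<noteq> \<zero>" "I \<cdot> J = PIdl a"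
    by (rule invertible_idealE[OF inv])
  have JI: "J \<cdot> I = PIdl a" using ideal_prod_commute[OF J(2,1)] J(5) by simp
  have "J \<cdot> (I \<cdot> A) \<subseteq> J \<cdot> (I \<cdot> B)" by (rule ideal_prod_mono[OF subset_refl sub])
  then have "(PIdl a) \<cdot> A \<subseteq> (PIdl a) \<cdot> B"
    using JI ideal_prod_assoc[OF J(2,1) A] ideal_prod_assoc[OF J(2,1) B] by simp
  moreover have "a \<otimes> x \<in> (PIdl a) \<cdot> A" using PIdl_prod_mem_iff[OF J(3) A] x by auto
  ultimately have "a \<otimes> x \<in> (PIdl a) \<cdot> B" ..
  then obtain y where y: "y \<in> B" "a \<otimes> x = a \<otimes> y" using PIdl_prod_mem_iff[OF J(3) B] by auto
  have "x \<in> carrier R" "y \<in> carrier R" using x y A B ideal_subset_carrier by auto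
  then have "x = y" using y J m_lcancel by simp
  then show "x \<in> B" using y by simp
qed

lemma invertible_cancel:
  assumes "invertible_ideal R I" "ideal A R" "ideal B R" "I \<cdot> A = I \<cdot> B"
  shows "A = B"
  using invertible_cancel_subset[OF assms(1-3)] invertible_cancel_subset[OF assms(1,3,2)] assms(4) by simp

text \<open>To contain is to divide. The quotient is \<open>a^-1 (A \<cdot> J)\<close>, which lies
  in \<open>R\<close> because \<open>A \<cdot> J \<subseteq> I \<cdot> J = PIdl a\<close>. The
  factor \<open>J\<close> cancels at the end, being itself a divisor of a nonzero principal
  ideal.\<close>

lemma invertible_divides:
  assumes inv: "invertible_ideal R I" and A: "ideal A R" and sub: "A \<subseteq> I"
  shows "\<exists>B. ideal B R \<and> A = I \<cdot> B"
proof -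
  obtain J a where J: "ideal I R" "ideal J R" "a \<in> carrier R" "a \<noteq> \<zero>" "I \<cdot> J = PIdl a"
    by (rule invertible_idealE[OF inv])
  have AJ: "ideal (A \<cdot> J) R" by (rule ideal_prod_is_ideal[OF A J(2)])
  define B where "B = {x \<in> carrier R. a \<otimes> x \<in> A \<cdot> J}"
  have B: "ideal B R"
  proof (rule idealI_cring)
    show "B \<subseteq> carrier R" "\<zero> \<in> B" using ideal_zero_mem[OF AJ] J(3) by (auto simp: B_def)
    show "x \<oplus> y \<in> B" if "x \<in> B" "y \<in> B" for x y
      using that J(3) ideal_add_mem[OF AJ] by (auto simp: B_def r_distr)
    show "r \<otimes> x \<in> B" if "r \<in> carrier R" "x \<in> B" for r x
      using that J(3) ideal.I_l_closed[OF AJ] m_lcomm[of a r x] by (simp add: B_def)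
  qed
  have "(PIdl a) \<cdot> B = A \<cdot> J"
  proof
    show "(PIdl a) \<cdot> B \<subseteq> A \<cdot> J"
      using PIdl_prod_mem_iff[OF J(3) B] by (auto simp: B_def)
    show "A \<cdot> J \<subseteq> (PIdl a) \<cdot> B"
    proof
      fix x assume x: "x \<in> A \<cdot> J"
      then have "x \<in> PIdl a" using ideal_prod_mono[OF sub subset_refl, of J] J(5) by auto
      then obtain c where c: "c \<in> carrier R" "x = c \<otimes> a" using PIdl_mem_iff by auto
      then have "c \<in> B" "x = a \<otimes> c" using x J(3) by (auto simp: B_def m_comm)
      then show "x \<in> (PIdl a) \<cdot> B" using PIdl_prod_mem_iff[OF J(3) B] by auto
    qed
  qed
  then have "J \<cdot> (I \<cdot> B) = J \<cdot> A"
    using ideal_prod_assoc[OF J(2,1) B] ideal_prod_commute[OF J(2,1)] ideal_prod_commute[OF J(2) A] J(5) by simp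
  moreover have "invertible_ideal R J"
    using invertible_prodD(2)[OF J(1,2)] invertible_PIdl[OF J(3,4)] J(5) by simp
  ultimately have "I \<cdot> B = A"
    using invertible_cancel[OF _ ideal_prod_is_ideal[OF J(1) B] A] by simp
  then show ?thesis using B by auto
qed

lemma ideal_prod_finite_support:
  assumes "I \<subseteq> carrier R" "J \<subseteq> carrier R" "x \<in> I \<cdot> J"
  shows "\<exists>S. finite S \<and> S \<subseteq> I \<and> x \<in> genideal R S \<cdot> J"
  using assms(3)
proof induction
  case (prod i j)
  then have "i \<otimes> j \<in> genideal R {i} \<cdot> J"
    using assms(1) genideal_self'[of i] by (intro ideal_prod.prod) auto
  then show ?case using prod by (intro exI[of _ "{i}"]) auto
next
  case (sum x y)
  then obtain S T where S: "finite S" "S \<subseteq> I" "x \<in> genideal R S \<cdot> J"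
    and T: "finite T" "T \<subseteq> I" "y \<in> genideal R T \<cdot> J" by auto
  have "S \<union> T \<subseteq> genideal R (S \<union> T)" using S T assms(1) by (intro genideal_self) auto
  then have "genideal R S \<subseteq> genideal R (S \<union> T)" "genideal R T \<subseteq> genideal R (S \<union> T)"
    using genideal_minimal[OF genideal_ideal[of "S \<union> T"]] S T assms(1) by auto
  then have "x \<oplus> y \<in> genideal R (S \<union> T) \<cdot> J"
    using S T by (intro ideal_prod.sum) (auto intro: subsetD[OF ideal_prod_mono])
  then show ?case using S T by (intro exI[of _ "S \<union> T"]) auto
qed

text \<open>The relation \<open>a \<in> I \<cdot> J\<close> involves only finitely many elements of
  \<open>I\<close>. The ideal they generate already has a product with \<open>J\<close> containing
  \<open>PIdl a = I \<cdot> J\<close>, and \<open>J\<close> cancels.\<close>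

lemma invertible_fg:
  assumes inv: "invertible_ideal R I" shows "fg_ideal R I"
proof -
  obtain J a where J: "ideal I R" "ideal J R" "a \<in> carrier R" "a \<noteq> \<zero>" "I \<cdot> J = PIdl a"
    by (rule invertible_idealE[OF inv])
  have "a \<in> I \<cdot> J" using J cgenideal_self by simp
  then obtain S where S: "finite S" "S \<subseteq> I" "a \<in> genideal R S \<cdot> J"
    using ideal_prod_finite_support[of I J a] J(1,2) ideal_subset_carrier by auto
  have SR: "S \<subseteq> carrier R" using S J(1) ideal_subset_carrier by auto
  have G: "ideal (genideal R S) R" using SR by (rule genideal_ideal)
  have sub: "genideal R S \<subseteq> I" using J(1) S(2) by (rule genideal_minimal)
  have "J \<cdot> I \<subseteq> J \<cdot> genideal R S"
    using cgenideal_minimal[OF ideal_prod_is_ideal[OF G J(2)] S(3)] J(5)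
      ideal_prod_commute[OF J(2,1)] ideal_prod_commute[OF J(2) G] by simp
  moreover have "invertible_ideal R J"
    using invertible_prodD(2)[OF J(1,2)] invertible_PIdl[OF J(3,4)] J(5) by simp
  ultimately have "I \<subseteq> genideal R S" using invertible_cancel_subset[OF _ J(1) G] by simp
  then show ?thesis using sub S SR unfolding fg_ideal_def by auto
qed

lemma invertible_nonzero:
  assumes inv: "invertible_ideal R I" shows "\<exists>x\<in>I. x \<noteq> \<zero>"
proof (rule ccontr)
  obtain J a where J: "ideal I R" "ideal J R" "a \<in> carrier R" "a \<noteq> \<zero>" "I \<cdot> J = PIdl a"
    by (rule invertible_idealE[OF inv])
  assume "\<not> ?thesis"
  then have "I \<cdot> J \<subseteq> {\<zero>}"
    using ideal_subset_carrier[OF J(2)] by (intro ideal_prod_subset[OF zeroideal]) force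
  then show False using J cgenideal_self by auto
qed

text \<open>Every product \<open>i \<otimes> j\<close> is some \<open>r \<otimes> a\<close>. If all
  these \<open>r\<close> lay in \<open>P\<close>, then \<open>a\<close> would lie in
  \<open>a P\<close> and \<open>\<one>\<close> in \<open>P\<close>. A pair with \<open>r\<close>
  outside \<open>P\<close> supplies the local generator \<open>z = i\<close>.\<close>

lemma invertible_locally_principal:
  assumes inv: "invertible_ideal R I" and P: "primeideal P R"
  shows "\<exists>z\<in>I. \<exists>r\<in>carrier R - P. \<forall>x\<in>I. \<exists>c\<in>carrier R. r \<otimes> x = c \<otimes> z"
proof -
  obtain J a where J: "ideal I R" "ideal J R" "a \<in> carrier R" "a \<noteq> \<zero>" "I \<cdot> J = PIdl a"
    by (rule invertible_idealE[OF inv])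
  note car = ideal_subset_carrier[OF J(1)] ideal_subset_carrier[OF J(2)]
  have PI: "ideal P R" by (rule primeideal.axioms(1)[OF P])
  have *: "\<exists>r\<in>carrier R. i \<otimes> j = r \<otimes> a" if "i \<in> I" "j \<in> J" for i j
    using ideal_prod.prod[OF that, of R] J(5) PIdl_mem_iff by simp
  have "\<exists>i\<in>I. \<exists>j\<in>J. \<exists>r\<in>carrier R - P. i \<otimes> j = r \<otimes> a"
  proof (rule ccontr)
    assume no: "\<not> ?thesis"
    have "i \<otimes> j \<in> (PIdl a) \<cdot> P" if ij: "i \<in> I" "j \<in> J" for i j
    proof -
      obtain r where r: "r \<in> carrier R" "i \<otimes> j = r \<otimes> a" using *[OF ij] by auto
      then have "r \<in> P" using no ij by auto
      then show ?thesis using PIdl_prod_mem_iff[OF J(3) PI] r J(3) m_comm by auto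
    qed
    then have "I \<cdot> J \<subseteq> (PIdl a) \<cdot> P"
      by (intro ideal_prod_subset ideal_prod_is_ideal cgenideal_ideal J(3) PI)
    then have "a \<in> (PIdl a) \<cdot> P" using J cgenideal_self by auto
    then obtain p where p: "p \<in> P" "a = a \<otimes> p" using PIdl_prod_mem_iff[OF J(3) PI] by auto
    have "p \<in> carrier R" using p PI ideal_subset_carrier by auto
    then have "p = \<one>" using p J m_lcancel[of a p \<one>] by simp
    then show False using p prime_one_notin[OF P] by simp
  qed
  then obtain i j r where i: "i \<in> I" "j \<in> J" and r: "r \<in> carrier R" "r \<notin> P" "i \<otimes> j = r \<otimes> a" by auto
  have ic: "i \<in> carrier R" "j \<in> carrier R" using i car by auto
  have "r \<noteq> \<zero>" using r ideal_zero_mem[OF PI] by auto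
  then have j: "j \<noteq> \<zero>" using r(1,3) J(3,4) ic integral_iff[of r a] by auto
  have "\<exists>c\<in>carrier R. r \<otimes> x = c \<otimes> i" if x: "x \<in> I" for x
  proof -
    have xc: "x \<in> carrier R" using x car by auto
    obtain c where c: "c \<in> carrier R" "x \<otimes> j = c \<otimes> a" using *[OF x i(2)] by auto
    \<comment> \<open>The relation is checked after multiplying by \<open>j\<close>, where
      \<open>x \<otimes> j\<close> and \<open>i \<otimes> j\<close> are known multiples of
      \<open>a\<close>; the nonzero \<open>j\<close> then cancels.\<close>
    have "j \<otimes> (r \<otimes> x) = r \<otimes> (x \<otimes> j)" using ic xc r(1) by (simp add: m_ac)
    also have "\<dots> = c \<otimes> (r \<otimes> a)" using c r(1) J(3) by (simp add: m_ac)
    also have "\<dots> = j \<otimes> (c \<otimes> i)" unfolding r(3)[symmetric] using c ic by (simp add: m_ac)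
    finally have "r \<otimes> x = c \<otimes> i" using m_lcancel[OF j] ic xc r(1) c(1) by simp
    then show ?thesis using c by auto
  qed
  then show ?thesis using i r by auto
qed

end

subsection \<open>Radical ideals\<close>

context cring
begin

lemma radical_is_ideal:
  assumes "ideal I R" shows "ideal (radical R I) R" "I \<subseteq> radical R I"
proof -
  show sub: "I \<subseteq> radical R I"
    using ideal_subset_carrier[OF assms] by (auto simp: radical_def intro!: exI[of _ "1::nat"])
  have absorb: "r \<otimes> x \<in> I" "x \<otimes> r \<in> I" if "x \<in> I" "r \<in> carrier R" for r x
    using that ideal.I_l_closed[OF assms] ideal.I_r_closed[OF assms] by auto
  show "ideal (radical R I) R"
  proof (rule idealI_cring)
    show "radical R I \<subseteq> carrier R" by (auto simp: radical_def)
    show "\<zero> \<in> radical R I" using sub ideal_zero_mem[OF assms] by auto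
    fix r x assume r: "r \<in> carrier R" "x \<in> radical R I"
    then obtain n where n: "x \<in> carrier R" "n \<ge> 1" "x [^] (n::nat) \<in> I" by (auto simp: radical_def)
    then have "(r \<otimes> x) [^] n \<in> I" using r absorb by (simp add: nat_pow_distrib)
    then show "r \<otimes> x \<in> radical R I" using r n by (auto simp: radical_def)
  next
    fix x y assume "x \<in> radical R I" "y \<in> radical R I"
    then obtain m n where m: "x \<in> carrier R" "m \<ge> 1" "x [^] (m::nat) \<in> I"
      and n: "y \<in> carrier R" "n \<ge> 1" "y [^] (n::nat) \<in> I" by (auto simp: radical_def)
    have xm: "x [^] k \<in> I" if "k \<ge> m" for k
    proof -
      have "x [^] k = x [^] m \<otimes> x [^] (k - m)" using that m(1) by (simp add: nat_pow_mult)
      then show ?thesis using m absorb by simp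
    qed
    have yn: "y [^] k \<in> I" if "k \<ge> n" for k
    proof -
      have "y [^] k = y [^] n \<otimes> y [^] (k - n)" using that n(1) by (simp add: nat_pow_mult)
      then show ?thesis using n absorb by simp
    qed
    \<comment> \<open>Avoids the binomial theorem: count down the number of factors \<open>x \<oplus> y\<close>.\<close>
    have "x [^] a \<otimes> y [^] b \<otimes> (x \<oplus> y) [^] k \<in> I" if "a + b + k \<ge> m + n" for a b k
      using that
    proof (induction k arbitrary: a b)
      case 0
      then have "a \<ge> m \<or> b \<ge> n" by auto
      then show ?case using xm[of a] yn[of b] absorb m(1) n(1) by auto
    next
      case (Suc k)
      have "x [^] a \<otimes> y [^] b \<otimes> (x \<oplus> y) [^] Suc k =
        x [^] Suc a \<otimes> y [^] b \<otimes> (x \<oplus> y) [^] k \<oplus> x [^] a \<otimes> y [^] Suc b \<otimes> (x \<oplus> y) [^] k"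
        using m(1) n(1) by (simp add: r_distr l_distr m_ac)
      then show ?case
        using Suc.IH[of "Suc a" b] Suc.IH[of a "Suc b"] Suc.prems ideal_add_mem[OF assms] by simp
    qed
    from this[of "0::nat" "0::nat" "m + n"] have "(x \<oplus> y) [^] (m + n) \<in> I" using m(1) n(1) by simp
    then show "x \<oplus> y \<in> radical R I" using m n by (auto simp: radical_def intro!: exI[of _ "m + n"])
  qed
qed

lemma radical_ideal_ideal: "radical_ideal R I \<Longrightarrow> ideal I R"
  by (simp add: radical_ideal_def)

lemma radical_idealD:
  assumes "radical_ideal R I" "x \<in> carrier R" "x [^] (n::nat) \<in> I" shows "x \<in> I"
proof (cases "n = 0")
  case True
  then have "\<one> \<in> I" using assms by simp
  then show ?thesis using ideal.one_imp_carrier[OF radical_ideal_ideal[OF assms(1)]] assms(2) by simp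
next
  case False
  then have "x \<in> radical R I" using assms by (auto simp: radical_def intro!: exI[of _ n])
  then show ?thesis using assms by (simp add: radical_ideal_def)
qed

lemma radical_ideal_sq:
  assumes "radical_ideal R I" "x \<in> carrier R" "x \<otimes> x \<in> I" shows "x \<in> I"
  using radical_idealD[OF assms(1,2), of 2] assms by (simp add: numeral_2_eq_2)

lemma radical_idealI_square:
  assumes I: "ideal I R" and sq: "\<And>x. x \<in> carrier R \<Longrightarrow> x \<otimes> x \<in> I \<Longrightarrow> x \<in> I"
  shows "radical_ideal R I"
proof -
  have "x \<in> I" if x: "x \<in> carrier R" and "x [^] n \<in> I" "n \<ge> 1" for x and n :: nat
    using that(2,3)
  proof (induction n rule: less_induct)
    case (less n)
    show ?case
    proof (cases "n = 1")
      case True then show ?thesis using less x by simp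
    next
      case False
      \<comment> \<open>Half of \<open>n\<close>, rounded up: \<open>k + k \<ge> n\<close> keeps the
        square of \<open>x [^] k\<close> in \<open>I\<close>, and \<open>n > 1\<close> makes
        \<open>k\<close> smaller than \<open>n\<close>.\<close>
      define k where "k = (n + 1) div 2"
      have k: "k < n" "k \<ge> 1" "k + k \<ge> n" using False less.prems by (auto simp: k_def)
      have "x [^] k \<otimes> x [^] k = x [^] n \<otimes> x [^] (k + k - n)" using x k by (simp add: nat_pow_mult)
      then have "x [^] k \<otimes> x [^] k \<in> I" using less.prems x ideal.I_r_closed[OF I] by simp
      then have "x [^] k \<in> I" by (rule sq[OF nat_pow_closed[OF x]])
      then show ?thesis using less.IH k by simp
    qed
  qed
  then have "radical R I \<subseteq> I" by (auto simp: radical_def)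
  then show ?thesis using radical_is_ideal(2)[OF I] I by (auto simp: radical_ideal_def)
qed

lemma radical_radical_ideal:
  assumes "ideal I R" shows "radical_ideal R (radical R I)"
proof (rule radical_idealI_square[OF radical_is_ideal(1)[OF assms]])
  fix x assume x: "x \<in> carrier R" "x \<otimes> x \<in> radical R I"
  then obtain n where n: "n \<ge> 1" "(x \<otimes> x) [^] (n::nat) \<in> I" by (auto simp: radical_def)
  have "(x \<otimes> x) [^] n = x [^] (n + n)" using x by (simp add: nat_pow_distrib nat_pow_mult)
  then show "x \<in> radical R I" using x n by (auto simp: radical_def intro!: exI[of _ "n + n"])
qed

lemma radical_subset:
  assumes "radical_ideal R J" "I \<subseteq> J" shows "radical R I \<subseteq> J"
  using radical_idealD[OF assms(1)] assms(2) by (auto simp: radical_def)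

lemma prime_radical_ideal:
  assumes "primeideal P R" shows "radical_ideal R P"
  using radical_idealI_square[OF primeideal.axioms(1)[OF assms]] primeideal.I_prime[OF assms] by auto

end

context domain
begin

text \<open>Writing \<open>N\<close> for a factor of \<open>J\<close> occurring twice, \<open>J = N\<^sup>2C\<close> gives \<open>(NC)\<^sup>2 \<subseteq> J\<close>, so
  \<open>NC \<subseteq> J = N(NC)\<close>.\<close>

lemma invertible_radical_squarefree:
  assumes inv: "invertible_ideal R J" and rad: "radical_ideal R J"
    and N: "ideal N R" and C: "ideal C R" and J: "J = N \<cdot> (N \<cdot> C)"
  shows "N = carrier R"
proof -
  have NC: "ideal (N \<cdot> C) R" by (rule ideal_prod_is_ideal[OF N C])
  have NNC: "ideal (N \<cdot> (N \<cdot> C)) R" by (rule ideal_prod_is_ideal[OF N NC])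
  have "N \<cdot> C \<subseteq> J"
  proof
    fix x assume x: "x \<in> N \<cdot> C"
    have "x \<in> N" using x ideal_prod_inter[OF N C] by auto
    then have "x \<otimes> x \<in> J" unfolding J using x by (rule ideal_prod.prod)
    then show "x \<in> J" using radical_ideal_sq[OF rad] x NC ideal_subset_carrier by auto
  qed
  then have eq: "N \<cdot> C = N \<cdot> (N \<cdot> C)" using J ideal_prod_inter[OF N NC] by auto
  have invNC: "invertible_ideal R (N \<cdot> C)" using invertible_prodD(2)[OF N NC] inv J by simp
  have "(N \<cdot> C) \<cdot> carrier R = (N \<cdot> C) \<cdot> N"
    using eq ideal_prod_carrier(1)[OF NC] ideal_prod_commute[OF NC N] by simp
  then show ?thesis using invertible_cancel[OF invNC oneideal N] by simp
qed

end

subsection \<open>Domains whose ideals are products of radical ideals\<close>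

context cring
begin

text \<open>The contraction to \<open>R\<close> of the extension of \<open>I\<close> to the localization at \<open>P\<close>.\<close>

definition saturation :: "'a set \<Rightarrow> 'a set \<Rightarrow> 'a set" where
  "saturation P I = {x \<in> carrier R. \<exists>s\<in>carrier R - P. s \<otimes> x \<in> I}"

lemma saturationI: "x \<in> carrier R \<Longrightarrow> s \<in> carrier R - P \<Longrightarrow> s \<otimes> x \<in> I \<Longrightarrow> x \<in> saturation P I"
  by (auto simp: saturation_def)

lemma saturationE:
  assumes "x \<in> saturation P I"
  obtains s where "x \<in> carrier R" "s \<in> carrier R - P" "s \<otimes> x \<in> I"
  using assms by (auto simp: saturation_def)

lemma saturation_mono: "I \<subseteq> J \<Longrightarrow> saturation P I \<subseteq> saturation P J"
  by (auto simp: saturation_def)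

lemma subset_saturation:
  assumes "primeideal P R" "ideal I R" shows "I \<subseteq> saturation P I"
proof
  fix x assume x: "x \<in> I"
  then have "x \<in> carrier R" using ideal_subset_carrier[OF assms(2)] by auto
  then show "x \<in> saturation P I" using x prime_one_notin[OF assms(1)] by (intro saturationI[of x \<one>]) auto
qed

lemma saturation_ideal:
  assumes P: "primeideal P R" and I: "ideal I R" shows "ideal (saturation P I) R"
proof (rule idealI_cring)
  show "saturation P I \<subseteq> carrier R" by (auto simp: saturation_def)
  show "\<zero> \<in> saturation P I" using subset_saturation[OF P I] ideal_zero_mem[OF I] by auto
next
  fix x y assume "x \<in> saturation P I" "y \<in> saturation P I"
  then obtain s s' where x: "x \<in> carrier R" "s \<in> carrier R - P" "s \<otimes> x \<in> I"
    and y: "y \<in> carrier R" "s' \<in> carrier R - P" "s' \<otimes> y \<in> I"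
    by (auto elim!: saturationE)
  have "(s \<otimes> s') \<otimes> (x \<oplus> y) = s' \<otimes> (s \<otimes> x) \<oplus> s \<otimes> (s' \<otimes> y)"
    using x y by (simp add: r_distr m_ac)
  moreover have "s' \<otimes> (s \<otimes> x) \<in> I" "s \<otimes> (s' \<otimes> y) \<in> I"
    using x y ideal.I_l_closed[OF I] by auto
  ultimately have "(s \<otimes> s') \<otimes> (x \<oplus> y) \<in> I" using ideal_add_mem[OF I] by simp
  then show "x \<oplus> y \<in> saturation P I"
    using x y prime_mult_notin[OF P x(2) y(2)] by (intro saturationI[of _ "s \<otimes> s'"]) auto
next
  fix r x assume r: "r \<in> carrier R" and "x \<in> saturation P I"
  then obtain s where x: "x \<in> carrier R" "s \<in> carrier R - P" "s \<otimes> x \<in> I"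
    by (auto elim!: saturationE)
  have "s \<otimes> (r \<otimes> x) = r \<otimes> (s \<otimes> x)" using r x by (simp add: m_ac)
  also have "\<dots> \<in> I" by (rule ideal.I_l_closed[OF I x(3) r])
  finally show "r \<otimes> x \<in> saturation P I" using r x by (intro saturationI[of _ s]) auto
qed

lemma saturation_saturation:
  assumes P: "primeideal P R" and "x \<in> carrier R" "s \<in> carrier R - P" "s \<otimes> x \<in> saturation P I"
  shows "x \<in> saturation P I"
proof -
  obtain s' where s': "s' \<in> carrier R - P" "s' \<otimes> (s \<otimes> x) \<in> I"
    using assms(4) by (auto elim!: saturationE)
  then have "(s' \<otimes> s) \<otimes> x \<in> I" using assms by (simp add: m_assoc)
  then show ?thesis using prime_mult_notin[OF P s'(1) assms(3)] assms(2) by (intro saturationI)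
qed

lemma ideal_list_prod_subset:
  assumes "\<forall>J\<in>set Js. ideal J R" "K \<in> set Js"
  shows "ideal_list_prod R Js \<subseteq> K"
proof -
  obtain B where "ideal B R" "ideal_list_prod R Js = K \<cdot> B"
    using ideal_list_prod_factor[OF assms] by auto
  then show ?thesis using ideal_prod_inter[of K B] assms by auto
qed

lemma proper_list_prod:
  assumes "\<forall>J\<in>set Js. ideal J R \<and> J \<noteq> carrier R" "Js \<noteq> []"
  shows "ideal_list_prod R Js \<noteq> carrier R"
proof -
  obtain K where K: "K \<in> set Js" using assms(2) by (cases Js) auto
  have "ideal_list_prod R Js \<subseteq> K" using ideal_list_prod_subset[OF _ K] assms(1) by simp
  moreover have "K \<subseteq> carrier R" "K \<noteq> carrier R" using assms(1) K ideal_subset_carrier[of K] by auto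
  ultimately show ?thesis by auto
qed

text \<open>Two factors inside \<open>P\<close> would place the product in
  \<open>P \<cdot> P\<close>, against the choice of \<open>t\<close>. So a single factor
  \<open>K\<close> lies in \<open>P\<close>; the others contain elements outside \<open>P\<close>,
  and these multiply to the \<open>s\<close> that moves \<open>K\<close> into the product.\<close>

lemma list_prod_single_factor:
  assumes P: "primeideal P R"
    and "\<forall>J\<in>set Js. ideal J R" "ideal_list_prod R Js \<subseteq> P"
    and "t \<in> ideal_list_prod R Js" "t \<notin> saturation P (P \<cdot> P)"
  shows "\<exists>K\<in>set Js. K \<subseteq> P \<and> (\<exists>s\<in>carrier R - P. \<forall>x\<in>K. s \<otimes> x \<in> ideal_list_prod R Js)"
  using assms(2-)
proof (induction Js)
  case Nil
  then show ?case using prime_one_notin[OF P] by auto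
next
  case (Cons K Js)
  let ?J = "ideal_list_prod R Js"
  have K: "ideal K R" and J: "ideal ?J R" using Cons.prems ideal_list_prod_ideal[of Js] by auto
  have PP: "ideal (P \<cdot> P) R" using ideal_prod_is_ideal primeideal.axioms(1)[OF P] by auto
  show ?case
  proof (cases "K \<subseteq> P")
    case True
    have "\<not> ?J \<subseteq> P"
    proof
      assume "?J \<subseteq> P"
      then have "K \<cdot> ?J \<subseteq> P \<cdot> P" using True by (intro ideal_prod_mono)
      then show False using Cons.prems(3,4) subset_saturation[OF P PP] by auto
    qed
    then obtain s where s: "s \<in> ?J" "s \<notin> P" by auto
    then have sc: "s \<in> carrier R" using ideal_subset_carrier[OF J] by auto
    have "s \<otimes> x \<in> K \<cdot> ?J" if x: "x \<in> K" for x
    proof -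
      have "x \<otimes> s \<in> K \<cdot> ?J" using x s(1) by (rule ideal_prod.prod)
      moreover have "x \<in> carrier R" using x ideal_subset_carrier[OF K] by auto
      ultimately show ?thesis using sc by (simp add: m_comm)
    qed
    then show ?thesis using True s sc by auto
  next
    case False
    then obtain k where k: "k \<in> K" "k \<notin> P" by auto
    then have kc: "k \<in> carrier R" using ideal_subset_carrier[OF K] by auto
    have "?J \<subseteq> P" using primeideal_divides_ideal_prod[OF P K J] Cons.prems(2) False by auto
    moreover have "t \<in> ?J" using ideal_prod_inter[OF K J] Cons.prems(3) by auto
    ultimately obtain K' s where K': "K' \<in> set Js" "K' \<subseteq> P" "s \<in> carrier R - P" "\<forall>x\<in>K'. s \<otimes> x \<in> ?J"
      using Cons.IH Cons.prems(1,4) by auto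
    have "(k \<otimes> s) \<otimes> x \<in> K \<cdot> ?J" if x: "x \<in> K'" for x
    proof -
      have "x \<in> carrier R" using x K'(1) Cons.prems(1) ideal_subset_carrier by auto
      then have "(k \<otimes> s) \<otimes> x = k \<otimes> (s \<otimes> x)" using kc K'(3) by (simp add: m_assoc)
      also have "\<dots> \<in> K \<cdot> ?J" using k(1) K'(4) x by (intro ideal_prod.prod) auto
      finally show ?thesis .
    qed
    moreover have "k \<otimes> s \<in> carrier R - P" using prime_mult_notin[OF P _ K'(3), of k] k kc by auto
    ultimately show ?thesis using K'(1,2) by (intro bexI[of _ K'] conjI bexI[of _ "k \<otimes> s"]) auto
  qed
qed

text \<open>Locally at \<open>P\<close> the ideal \<open>K\<close> has \<open>P\<close> as its only
  prime above, hence as its radical; being radical, it becomes equal to \<open>P\<close>.\<close>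

lemma minimal_prime_radical:
  assumes K: "radical_ideal R K" and P: "minimal_prime K P" and p: "p \<in> P"
  shows "p \<in> saturation P K"
proof -
  note KI = radical_ideal_ideal[OF K]
  have pc: "p \<in> carrier R" using p ideal_subset_carrier primeideal.axioms(1) minimal_primeD(1)[OF P] by auto
  obtain s n where s: "s \<in> carrier R - P" "s \<otimes> p [^] (n::nat) \<in> K"
    by (rule minimal_prime_power[OF KI P p])
  \<comment> \<open>The exponent \<open>Suc n\<close> leaves the cofactor
    \<open>s [^] n \<otimes> p\<close>, which makes sense for \<open>n = 0\<close> as well.\<close>
  have "(s \<otimes> p) [^] Suc n = (s [^] n \<otimes> p) \<otimes> (s \<otimes> p [^] n)"
    using s(1) pc by (simp add: nat_pow_distrib m_ac)
  also have "\<dots> \<in> K" by (rule ideal.I_l_closed[OF KI s(2)]) (use s(1) pc in auto)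
  finally have "s \<otimes> p \<in> K" by (rule radical_idealD[OF K, rotated]) (use s(1) pc in simp)
  then show ?thesis using s(1) pc by (intro saturationI)
qed

text \<open>If \<open>P\<close> is locally idempotent, multiplying ideals that contain
  \<open>P\<close> locally does not lose this containment: products of two elements of
  \<open>P\<close> are reached factor by factor, and locally they already generate
  \<open>P\<close>.\<close>

lemma saturation_list_prod:
  assumes P: "primeideal P R" and PP: "P \<subseteq> saturation P (P \<cdot> P)"
    and "\<forall>J\<in>set Js. ideal J R \<and> P \<subseteq> saturation P J"
  shows "P \<subseteq> saturation P (ideal_list_prod R Js)"
  using assms(3)
proof (induction Js)
  case Nil
  then show ?case
    using subset_saturation[OF P oneideal] ideal_subset_carrier[OF primeideal.axioms(1)[OF P]] by auto
next
  case (Cons K Js)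
  let ?J = "ideal_list_prod R Js"
  have K: "ideal K R" and J: "ideal ?J R" using Cons.prems ideal_list_prod_ideal[of Js] by auto
  have KJ: "ideal (K \<cdot> ?J) R" by (rule ideal_prod_is_ideal[OF K J])
  have "P \<cdot> P \<subseteq> saturation P (K \<cdot> ?J)"
  proof (rule ideal_prod_subset[OF saturation_ideal[OF P KJ]])
    fix p q assume "p \<in> P" "q \<in> P"
    then have "p \<in> saturation P K" "q \<in> saturation P ?J" using Cons by auto
    then obtain s s' where s: "p \<in> carrier R" "s \<in> carrier R - P" "s \<otimes> p \<in> K"
       "q \<in> carrier R" "s' \<in> carrier R - P" "s' \<otimes> q \<in> ?J" by (auto elim!: saturationE)
    have "(s \<otimes> s') \<otimes> (p \<otimes> q) = (s \<otimes> p) \<otimes> (s' \<otimes> q)" using s by (simp add: m_ac)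
    also have "\<dots> \<in> K \<cdot> ?J" using s by (intro ideal_prod.prod)
    finally show "p \<otimes> q \<in> saturation P (K \<cdot> ?J)"
      using s prime_mult_notin[OF P s(2,5)] by (intro saturationI[of _ "s \<otimes> s'"]) auto
  qed
  then have sub: "saturation P (P \<cdot> P) \<subseteq> saturation P (saturation P (K \<cdot> ?J))" by (rule saturation_mono)
  show ?case
  proof
    fix p assume "p \<in> P"
    then have "p \<in> saturation P (saturation P (K \<cdot> ?J))" using PP sub by auto
    then obtain s where "p \<in> carrier R" "s \<in> carrier R - P" "s \<otimes> p \<in> saturation P (K \<cdot> ?J)"
      by (rule saturationE)
    then show "p \<in> saturation P (ideal_list_prod R (K # Js))"
      using saturation_saturation[OF P] by simp
  qed
qed

end

text \<open>A prime containing a principal ideal contains one of its factors, and a factor of an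
  invertible ideal is invertible. Stated for arbitrary domains because (3) also provides
  factorizations of principal ideals.\<close>

lemma (in domain) invertible_radical_factor:
  assumes P: "primeideal P R" and y: "y \<in> P" "y \<noteq> \<zero>"
    and Js: "\<forall>J\<in>set Js. radical_ideal R J" "ideal_list_prod R Js = PIdl y"
  shows "\<exists>K. invertible_ideal R K \<and> radical_ideal R K \<and> y \<in> K \<and> K \<subseteq> P"
proof -
  note PI = primeideal.axioms(1)[OF P]
  have yc: "y \<in> carrier R" using y ideal_subset_carrier[OF PI] by auto
  have sub: "PIdl y \<subseteq> P" by (rule cgenideal_minimal[OF PI y(1)])
  have JI: "\<forall>J\<in>set Js. ideal J R" using Js(1) radical_ideal_ideal by auto
  obtain K where K: "K \<in> set Js" "K \<subseteq> P" using prime_list_prod_subset[OF P JI] Js(2) sub by auto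
  obtain B where B: "ideal B R" "PIdl y = K \<cdot> B"
    using ideal_list_prod_factor[OF JI K(1)] Js(2) by auto
  have "invertible_ideal R K"
    using invertible_prodD(1)[OF _ B(1), of K] invertible_PIdl[OF yc y(2)] B(2) JI K(1) by auto
  moreover have "y \<in> K"
    using ideal_list_prod_subset[OF JI K(1)] Js(2) cgenideal_self[OF yc] by auto
  ultimately show ?thesis using Js(1) K by auto
qed

section \<open>Condition (1) makes nonzero primes maximal\<close>

locale radical_factorization_domain = domain R for R (structure) +
  assumes factorization: "ideal I R \<Longrightarrow> I \<noteq> carrier R \<Longrightarrow>
    \<exists>Js. (\<forall>J\<in>set Js. radical_ideal R J) \<and> I = ideal_list_prod R Js"
begin

lemma factorization_in_prime:
  assumes "primeideal P R" "ideal I R" "I \<subseteq> P"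
  obtains Js where "\<forall>J\<in>set Js. radical_ideal R J" "\<forall>J\<in>set Js. ideal J R" "ideal_list_prod R Js = I"
proof -
  have "I \<noteq> carrier R" using assms(3) prime_one_notin[OF assms(1)] by auto
  then obtain Js where Js: "\<forall>J\<in>set Js. radical_ideal R J" "I = ideal_list_prod R Js"
    using factorization[OF assms(2)] by auto
  moreover have "\<forall>J\<in>set Js. ideal J R" using Js(1) radical_ideal_ideal by auto
  ultimately show ?thesis by (intro that) auto
qed

text \<open>After localizing at \<open>P\<close>, the ideal \<open>(y\<^sup>2, t)\<close> does not lie in \<open>P\<^sup>2\<close>, so only one factor of
  its factorization is proper: it is itself radical, hence contains \<open>y\<close>.\<close>

lemma local_generator:
  assumes P: "primeideal P R" and t: "t \<in> P" "t \<notin> saturation P (P \<cdot> P)" and y: "y \<in> P"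
  shows "\<exists>s\<in>carrier R - P. \<exists>c\<in>carrier R. s \<otimes> y = c \<otimes> t"
proof -
  note PI = primeideal.axioms(1)[OF P]
  have c: "t \<in> carrier R" "y \<in> carrier R" using t y ideal_subset_carrier[OF PI] by auto
  define I where "I = PIdl (y \<otimes> y) <+> PIdl t"
  have J: "ideal (PIdl (y \<otimes> y)) R" using c by (intro cgenideal_ideal) auto
  note add = add_PIdl_mem[OF J c(1), folded I_def]
  have "y \<otimes> y \<in> P" by (rule ideal.I_l_closed[OF PI y c(2)])
  then have sub: "I \<subseteq> P" using t ideal_add_mem[OF PI] cgenideal_minimal[OF PI]
    by (auto simp: I_def add_ideal_mem_iff subset_iff)
  have yI: "y \<otimes> y \<in> I" using add(2) cgenideal_self[of "y \<otimes> y"] c by auto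
  obtain Js where Js: "\<forall>J\<in>set Js. radical_ideal R J" "\<forall>J\<in>set Js. ideal J R" "ideal_list_prod R Js = I"
    by (rule factorization_in_prime[OF P add(1) sub])
  obtain K s where K: "K \<in> set Js" "s \<in> carrier R - P" "\<forall>x\<in>K. s \<otimes> x \<in> I"
    using list_prod_single_factor[OF P Js(2), of t] Js(3) sub add(3) t(2) by auto
  have "y \<otimes> y \<in> K" using ideal_list_prod_subset[OF Js(2) K(1)] Js(3) yI by auto
  moreover have "radical_ideal R K" using Js(1) K(1) by auto
  ultimately have "y \<in> K" using radical_ideal_sq[of K y] c(2) by simp
  then have "s \<otimes> y \<in> I" using K by auto
  then obtain u v where uv: "u \<in> PIdl (y \<otimes> y)" "v \<in> PIdl t" "s \<otimes> y = u \<oplus> v"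
    by (auto simp: I_def add_ideal_mem_iff)
  then obtain r d where r: "r \<in> carrier R" "u = r \<otimes> (y \<otimes> y)" "d \<in> carrier R" "v = d \<otimes> t"
    by (auto simp: PIdl_mem_iff)
  \<comment> \<open>The relation \<open>s \<otimes> y = r \<otimes> (y \<otimes> y) \<oplus> d
    \<otimes> t\<close> is solved for \<open>y\<close>: the coefficient
    \<open>s \<ominus> r \<otimes> y\<close> stays outside \<open>P\<close> because \<open>y\<close>
    lies in \<open>P\<close>.\<close>
  have "(s \<ominus> r \<otimes> y) \<otimes> y = s \<otimes> y \<ominus> r \<otimes> (y \<otimes> y)"
    using K(2) r c by (simp add: a_minus_def l_distr l_minus m_assoc)
  also have "\<dots> = d \<otimes> t" unfolding uv(3) r
    using r c by (simp add: a_minus_def a_comm[of "r \<otimes> (y \<otimes> y)" "d \<otimes> t"] a_assoc r_neg)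
  finally have eq: "(s \<ominus> r \<otimes> y) \<otimes> y = d \<otimes> t" .
  have "s \<ominus> r \<otimes> y \<notin> P"
  proof
    assume "s \<ominus> r \<otimes> y \<in> P"
    then have "(s \<ominus> r \<otimes> y) \<oplus> r \<otimes> y \<in> P"
      using ideal.I_l_closed[OF PI y r(1)] ideal_add_mem[OF PI] by simp
    moreover have "(s \<ominus> r \<otimes> y) \<oplus> r \<otimes> y = s"
      using K(2) r c by (simp add: a_minus_def a_assoc l_neg)
    ultimately show False using K(2) by simp
  qed
  then show ?thesis using eq r K(2) c by (intro bexI[of _ "s \<ominus> r \<otimes> y"] bexI[of _ d]) auto
qed

lemma invertible_radical_below:
  assumes P: "primeideal P R" and y: "y \<in> P" "y \<noteq> \<zero>"
  shows "\<exists>K. invertible_ideal R K \<and> radical_ideal R K \<and> y \<in> K \<and> K \<subseteq> P"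
proof -
  note PI = primeideal.axioms(1)[OF P]
  have yc: "y \<in> carrier R" using y ideal_subset_carrier[OF PI] by auto
  obtain Js where "\<forall>J\<in>set Js. radical_ideal R J" "ideal_list_prod R Js = PIdl y"
    by (rule factorization_in_prime[OF P cgenideal_ideal[OF yc] cgenideal_minimal[OF PI y(1)]])
  then show ?thesis by (rule invertible_radical_factor[OF P y])
qed

lemma invertible_local_generator_nonzero:
  assumes K: "invertible_ideal R K" and P: "primeideal P R" and r: "r \<in> carrier R - P"
    and gen: "\<forall>x\<in>K. \<exists>c\<in>carrier R. r \<otimes> x = c \<otimes> z"
  shows "z \<noteq> \<zero>"
proof
  assume "z = \<zero>"
  obtain x where x: "x \<in> K" "x \<noteq> \<zero>" using invertible_nonzero[OF K] by auto
  then have xc: "x \<in> carrier R" using ideal_subset_carrier invertible_ideal_ideal[OF K] by auto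
  have "r \<otimes> x = \<zero>" using gen x \<open>z = \<zero>\<close> by auto
  then have "r = \<zero>" using r xc x(2) integral by auto
  then show False using r ideal_zero_mem[OF primeideal.axioms(1)[OF P]] by auto
qed

text \<open>Locally \<open>P\<close> is generated by \<open>t\<close>, and an invertible radical
  \<open>K \<subseteq> Q\<close> by some \<open>z\<close>. As \<open>t\<close> is not in the prime
  \<open>Q\<close>, one has \<open>z = w t\<close> with \<open>w \<in> Q\<close>, and
  \<open>t\<close> divides \<open>w\<close> again. So \<open>w^2\<close> is a multiple of
  \<open>w t\<close>, that is of \<open>z\<close>, and \<open>w\<close> lies in the radical ideal
  \<open>K\<close>. Now \<open>w = c z = c w t\<close>, which makes \<open>t\<close> a local
  unit.\<close>

lemma no_prime_below:
  assumes P: "primeideal P R" and t: "t \<in> P" "t \<notin> saturation P (P \<cdot> P)"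
    and Q: "primeideal Q R" "Q \<subseteq> P" "Q \<noteq> P"
  shows "Q = {\<zero>}"
proof (rule ccontr)
  assume "Q \<noteq> {\<zero>}"
  note PI = primeideal.axioms(1)[OF P] and QI = primeideal.axioms(1)[OF Q(1)]
  have Pc: "x \<in> carrier R" if "x \<in> P" for x using that ideal_subset_carrier[OF PI] by auto
  have cm: "s \<in> carrier R" if "s \<in> carrier R - X" for s X using that by auto
  obtain y where y: "y \<in> Q" "y \<noteq> \<zero>" using \<open>Q \<noteq> {\<zero>}\<close> ideal_zero_mem[OF QI] by auto
  obtain K where K: "invertible_ideal R K" "radical_ideal R K" "K \<subseteq> Q"
    using invertible_radical_below[OF Q(1) y] by auto
  note KI = radical_ideal_ideal[OF K(2)]
  obtain z r where z: "z \<in> K" and r: "r \<in> carrier R - P" and gen: "\<forall>x\<in>K. \<exists>c\<in>carrier R. r \<otimes> x = c \<otimes> z"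
    using invertible_locally_principal[OF K(1) P] by auto
  have z0: "z \<noteq> \<zero>" by (rule invertible_local_generator_nonzero[OF K(1) P r gen])
  have zQ: "z \<in> Q" and zP: "z \<in> P" using z K(3) Q(2) by auto
  note zc = Pc[OF zP] and tc = Pc[OF t(1)]
  have tQ: "t \<notin> Q"
  proof
    assume tQ: "t \<in> Q"
    have "P \<subseteq> Q"
    proof
      fix p assume p: "p \<in> P"
      obtain s c where s: "s \<in> carrier R - P" "c \<in> carrier R" "s \<otimes> p = c \<otimes> t"
        using local_generator[OF P t p] by auto
      then have "s \<otimes> p \<in> Q" using ideal.I_l_closed[OF QI tQ s(2)] by simp
      then show "p \<in> Q" using primeideal.I_prime[OF Q(1) cm[OF s(1)] Pc[OF p]] s(1) Q(2) by auto
    qed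
    then show False using Q by auto
  qed
  obtain s w where s: "s \<in> carrier R - P" "w \<in> carrier R" "s \<otimes> z = w \<otimes> t"
    using local_generator[OF P t zP] by auto
  have "w \<otimes> t \<in> Q" using ideal.I_l_closed[OF QI zQ cm[OF s(1)]] s(3) by simp
  then have wQ: "w \<in> Q" using primeideal.I_prime[OF Q(1) s(2) tc] tQ by auto
  then have wP: "w \<in> P" using Q(2) by auto
  obtain s' w' where s': "s' \<in> carrier R - P" "w' \<in> carrier R" "s' \<otimes> w = w' \<otimes> t"
    using local_generator[OF P t wP] by auto
  note cc = cm[OF s(1)] cm[OF s'(1)] cm[OF r] s(2) s'(2) tc zc
  have "(s' \<otimes> w) \<otimes> (s' \<otimes> w) = (s' \<otimes> w) \<otimes> (w' \<otimes> t)" using s'(3) by simp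
  also have "\<dots> = (s' \<otimes> w') \<otimes> (w \<otimes> t)" using cc by (simp add: m_ac)
  also have "\<dots> = (s' \<otimes> w' \<otimes> s) \<otimes> z" using s(3)[symmetric] cc by (simp add: m_ac)
  also have "\<dots> \<in> K" using cc by (intro ideal.I_l_closed[OF KI z]) auto
  finally have "s' \<otimes> w \<in> K" using radical_ideal_sq[OF K(2), of "s' \<otimes> w"] cc by simp
  then obtain c where c: "c \<in> carrier R" "r \<otimes> (s' \<otimes> w) = c \<otimes> z" using gen by auto
  have "w \<otimes> (r \<otimes> s' \<otimes> s) = s \<otimes> (r \<otimes> (s' \<otimes> w))" using cc by (simp add: m_ac)
  also have "\<dots> = c \<otimes> (s \<otimes> z)" unfolding c(2) using c(1) cc by (simp add: m_ac)
  also have "\<dots> = w \<otimes> (c \<otimes> t)" unfolding s(3) using c(1) cc by (simp add: m_ac)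
  finally have eq: "w \<otimes> (r \<otimes> s' \<otimes> s) = w \<otimes> (c \<otimes> t)" .
  have "w \<noteq> \<zero>"
  proof
    assume "w = \<zero>"
    then have "s \<otimes> z = \<zero>" using s(3) tc by simp
    then have "s = \<zero>" using integral[of s z] cc z0 by auto
    then show False using s(1) ideal_zero_mem[OF PI] by auto
  qed
  then have "r \<otimes> s' \<otimes> s = c \<otimes> t" using eq m_lcancel c(1) cc by simp
  also have "\<dots> \<in> P" by (rule ideal.I_l_closed[OF PI t(1) c(1)])
  finally show False using prime_mult_notin[OF P prime_mult_notin[OF P r s'(1)] s(1)] by auto
qed

lemma nonzero_prime_maximal:
  assumes P: "primeideal P R" "P \<noteq> {\<zero>}"
  shows "maximalideal P R"
proof -
  note PI = primeideal.axioms(1)[OF P(1)]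
  have "P \<noteq> carrier R" using prime_one_notin[OF P(1)] by auto
  then obtain M where M: "maximalideal M R" "P \<subseteq> M" by (rule maximalideal_above[OF PI])
  note MP = maximalideal_prime[OF M(1)]
  have "P = M"
  proof (rule ccontr)
    assume "P \<noteq> M"
    then obtain a where a: "a \<in> M" "a \<notin> P" using M by auto
    have ac: "a \<in> carrier R" using a ideal_subset_carrier[OF primeideal.axioms(1)[OF MP]] by auto
    note Pa = add_PIdl_mem[OF PI ac]
    have PaM: "P <+> PIdl a \<subseteq> X" if "ideal X R" "P \<subseteq> X" "a \<in> X" for X
    proof
      fix x assume "x \<in> P <+> PIdl a"
      then obtain i j where ij: "i \<in> P" "j \<in> PIdl a" "x = i \<oplus> j" by (auto simp: add_ideal_mem_iff)
      then have "i \<in> X" "j \<in> X" using cgenideal_minimal[OF that(1,3)] that(2) by auto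
      then show "x \<in> X" using ideal_add_mem[OF that(1)] ij(3) by simp
    qed
    have "P <+> PIdl a \<subseteq> M" using PaM[OF primeideal.axioms(1)[OF MP] M(2) a(1)] by auto
    then obtain N where N: "minimal_prime (P <+> PIdl a) N" by (rule minimal_prime_below[OF MP])
    note NP = minimal_primeD(1)[OF N]
    note NI = primeideal.axioms(1)[OF NP]
    have PN: "P \<subseteq> N" "a \<in> N" using minimal_primeD(2)[OF N] Pa by auto
    have "P \<noteq> N" using PN a(2) by auto
    \<comment> \<open>Otherwise \<open>N\<close> would have a local generator, and no nonzero prime
      such as \<open>P\<close> could lie strictly below it.\<close>
    then have idem: "N \<subseteq> saturation N (N \<cdot> N)" using no_prime_below[OF NP _ _ P(1) PN(1)] P(2) by auto
    have aac: "a \<otimes> a \<in> carrier R" using ac by simp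
    let ?I = "P <+> PIdl (a \<otimes> a)"
    note I = add_PIdl_mem[OF PI aac]
    have "?I \<subseteq> P <+> PIdl a"
    proof
      fix x assume "x \<in> ?I"
      then obtain i c where ij: "i \<in> P" "c \<in> carrier R" "x = i \<oplus> c \<otimes> (a \<otimes> a)"
        by (auto simp: add_ideal_mem_iff PIdl_mem_iff)
      then have "c \<otimes> (a \<otimes> a) \<in> PIdl a"
        using ac PIdl_mem_iff[of _ a] by (auto simp: m_assoc[symmetric] intro!: bexI[of _ "c \<otimes> a"])
      then show "x \<in> P <+> PIdl a" using ij add_ideal_mem_iff by auto
    qed
    then have IN: "?I \<subseteq> N" using minimal_primeD(2)[OF N] by auto
    obtain Js where Js: "\<forall>J\<in>set Js. radical_ideal R J" "\<forall>J\<in>set Js. ideal J R" "ideal_list_prod R Js = ?I"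
      by (rule factorization_in_prime[OF NP I(1) IN])
    \<comment> \<open>A factor inside \<open>N\<close> contains \<open>P\<close> and, being radical,
      \<open>a\<close>; hence \<open>N\<close> is minimal over it and locally equal to it. A factor
      not inside \<open>N\<close> is locally the unit ideal.\<close>
    have "N \<subseteq> saturation N K" if K: "K \<in> set Js" for K
    proof (cases "K \<subseteq> N")
      case True
      have KI: "ideal K R" "radical_ideal R K" using Js(1,2) K by auto
      have sub: "?I \<subseteq> K" using ideal_list_prod_subset[OF Js(2) K] Js(3) by auto
      have "a \<in> K" using radical_ideal_sq[OF KI(2) ac] sub I(3) by auto
      moreover have "P \<subseteq> K" using sub I(2) by auto
      ultimately have PK: "P <+> PIdl a \<subseteq> K" using PaM KI(1) by auto
      have "minimal_prime K N" unfolding minimal_prime_def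
      proof (intro conjI allI impI NP True)
        fix X assume "primeideal X R \<and> K \<subseteq> X \<and> X \<subseteq> N"
        then show "X = N" using PK by (intro minimal_primeD(3)[OF N]) auto
      qed
      then show ?thesis using minimal_prime_radical[OF KI(2)] by auto
    next
      case False
      then obtain k where k: "k \<in> K" "k \<notin> N" by auto
      have KI: "ideal K R" using Js(2) K by auto
      have kc: "k \<in> carrier R" using k ideal_subset_carrier[OF KI] by auto
      show ?thesis
      proof
        fix x assume x: "x \<in> N"
        have xc: "x \<in> carrier R" using x ideal_subset_carrier[OF NI] by auto
        have "k \<otimes> x \<in> K" by (rule ideal.I_r_closed[OF KI k(1) xc])
        then show "x \<in> saturation N K" using k kc xc by (intro saturationI[of x k]) auto
      qed
    qed
    then have "N \<subseteq> saturation N ?I" using saturation_list_prod[OF NP idem, of Js] Js(2,3) by auto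
    then have "a \<in> saturation N ?I" using PN by auto
    then obtain s where s: "s \<in> carrier R - N" "s \<otimes> a \<in> ?I" by (auto elim!: saturationE)
    then obtain q c where q: "q \<in> P" "c \<in> carrier R" "s \<otimes> a = q \<oplus> c \<otimes> (a \<otimes> a)"
      by (auto simp: add_ideal_mem_iff PIdl_mem_iff)
    have qc: "q \<in> carrier R" "s \<in> carrier R" using q s ideal_subset_carrier[OF PI] by auto
    \<comment> \<open>Solving \<open>s \<otimes> a = q \<oplus> c \<otimes> (a \<otimes> a)\<close>
      gives \<open>(s \<ominus> c \<otimes> a) \<otimes> a \<in> P\<close>. Since \<open>a\<close>
      is in \<open>N\<close> but not in \<open>P\<close>, this forces \<open>s\<close> into
      \<open>N\<close>.\<close>
    have "(s \<ominus> c \<otimes> a) \<otimes> a = s \<otimes> a \<ominus> c \<otimes> (a \<otimes> a)"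
      using qc q(2) ac by (simp add: a_minus_def l_distr l_minus m_assoc)
    also have "\<dots> = q" unfolding q(3) using qc q(2) ac by (simp add: a_minus_def a_assoc r_neg)
    finally have "(s \<ominus> c \<otimes> a) \<otimes> a \<in> P" using q by simp
    then have "s \<ominus> c \<otimes> a \<in> P" using primeideal.I_prime[OF P(1), of "s \<ominus> c \<otimes> a" a] a(2) qc q(2) ac by auto
    then have "(s \<ominus> c \<otimes> a) \<oplus> c \<otimes> a \<in> N"
      using PN(1) ideal.I_l_closed[OF NI PN(2) q(2)] ideal_add_mem[OF NI] by auto
    moreover have "(s \<ominus> c \<otimes> a) \<oplus> c \<otimes> a = s"
      using qc q(2) ac by (simp add: a_minus_def a_assoc l_neg)
    ultimately show False using s by simp
  qed
  then show ?thesis using M by simp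
qed

end

subsection \<open>Orders of ideals at maximal ideals\<close>

context cring
begin

lemma ideal_nonzero_iff: "ideal I R \<Longrightarrow> I \<noteq> {\<zero>} \<longleftrightarrow> (\<exists>x\<in>I. x \<noteq> \<zero>)"
  using ideal_zero_mem by auto

text \<open>The multipliers carrying \<open>x\<close> into \<open>I\<close> form an ideal; by
  \<open>loc\<close> no maximal ideal contains it, so it contains \<open>\<one>\<close>.\<close>

lemma local_global_mem:
  assumes I: "ideal I R" and x: "x \<in> carrier R"
    and loc: "\<And>M. maximalideal M R \<Longrightarrow> \<exists>s\<in>carrier R - M. s \<otimes> x \<in> I"
  shows "x \<in> I"
proof -
  define A where "A = {r \<in> carrier R. r \<otimes> x \<in> I}"
  have A: "ideal A R"
  proof (rule idealI_cring)
    show "A \<subseteq> carrier R" "\<zero> \<in> A" using ideal_zero_mem[OF I] x by (auto simp: A_def)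
    show "a \<oplus> b \<in> A" if "a \<in> A" "b \<in> A" for a b
      using that x ideal_add_mem[OF I] by (simp add: A_def l_distr)
    show "r \<otimes> a \<in> A" if "r \<in> carrier R" "a \<in> A" for r a
      using that x ideal.I_l_closed[OF I] by (simp add: A_def m_assoc)
  qed
  have "A = carrier R"
  proof (rule ccontr)
    assume "A \<noteq> carrier R"
    then obtain M where M: "maximalideal M R" "A \<subseteq> M" by (rule maximalideal_above[OF A])
    then show False using loc[OF M(1)] by (auto simp: A_def)
  qed
  then have "\<one> \<in> A" by simp
  then show ?thesis using x by (simp add: A_def)
qed

lemma maximal_comaximal:
  assumes M: "maximalideal M R" and a: "a \<in> carrier R - M"
  shows "\<exists>m\<in>M. \<exists>c\<in>carrier R. \<one> = m \<oplus> c \<otimes> a"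
proof -
  note MI = maximalideal.axioms(1)[OF M]
  note K = add_PIdl_mem[OF MI, of a]
  have "M <+> PIdl a = M \<or> M <+> PIdl a = carrier R"
    using maximalideal.I_maximal[OF M K(1,2)] a ideal_subset_carrier[OF K(1)] by simp
  then have "\<one> \<in> M <+> PIdl a" using K(3) a by auto
  then obtain m j where "m \<in> M" "j \<in> PIdl a" "\<one> = m \<oplus> j" using add_ideal_mem_iff by auto
  then show ?thesis using PIdl_mem_iff by auto
qed

text \<open>The condition \<open>mult\<close> says that enlarging a multiplier does no harm, so the
  product of finitely many individual multipliers serves all of \<open>S\<close> at once.\<close>

lemma common_multiplier:
  assumes P: "primeideal P R" and "finite S" "\<And>a. a \<in> S \<Longrightarrow> \<exists>s\<in>carrier R - P. Q s a"
    and mult: "\<And>s s' a. a \<in> S \<Longrightarrow> s \<in> carrier R \<Longrightarrow> s' \<in> carrier R \<Longrightarrow> Q s a \<Longrightarrow> Q (s' \<otimes> s) a"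
  shows "\<exists>s\<in>carrier R - P. \<forall>a\<in>S. Q s a"
  using assms(2-)
proof (induction S)
  case empty
  then show ?case using prime_one_notin[OF P] by auto
next
  case (insert a S)
  then obtain s where s: "s \<in> carrier R - P" "\<forall>b\<in>S. Q s b" by auto
  obtain s' where s': "s' \<in> carrier R - P" "Q s' a" using insert.prems(1)[of a] by auto
  have "Q (s' \<otimes> s) b" if "b \<in> S" for b using insert.prems(2)[of b s s'] s s' that by auto
  moreover have "Q (s' \<otimes> s) a" using insert.prems(2)[of a s' s] s s' by (simp add: m_comm)
  ultimately show ?case using prime_mult_notin[OF P s'(1) s(1)] by (intro bexI[of _ "s' \<otimes> s"]) auto
qed

end

text \<open>Condition (4) for domains that are not fields. Excluding fields ensures that no maximal
  ideal is zero, so that a uniformizer exists at each of them.\<close>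

locale one_dim_radical_domain = domain R for R (structure) +
  assumes prime_maximal: "primeideal P R \<Longrightarrow> P \<noteq> {\<zero>} \<Longrightarrow> maximalideal P R"
    and invertible_radical: "primeideal P R \<Longrightarrow> P \<noteq> {\<zero>} \<Longrightarrow>
      \<exists>J. J \<subseteq> P \<and> invertible_ideal R J \<and> radical_ideal R J"
    and not_field: "\<not> field R"
begin

lemma max_prime: "maximalideal M R \<Longrightarrow> primeideal M R"
  by (rule maximalideal_prime)

lemma max_ideal: "maximalideal M R \<Longrightarrow> ideal M R"
  by (rule maximalideal.axioms(1))

lemma max_car: "maximalideal M R \<Longrightarrow> x \<in> M \<Longrightarrow> x \<in> carrier R"
  using ideal_subset_carrier[OF max_ideal] by auto

lemma max_nonzero: "maximalideal M R \<Longrightarrow> M \<noteq> {\<zero>}"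
  using zeromaximalideal_eq_field not_field by auto

lemma minimal_prime_max:
  assumes M: "maximalideal M R" and I: "ideal I R" "I \<noteq> {\<zero>}" "I \<subseteq> M"
  shows "minimal_prime I M"
  unfolding minimal_prime_def
proof (intro conjI allI impI max_prime[OF M] I(3))
  fix Q assume Q: "primeideal Q R \<and> I \<subseteq> Q \<and> Q \<subseteq> M"
  have "Q \<noteq> {\<zero>}" using I Q ideal_nonzero_iff[OF I(1)] by auto
  then have "maximalideal Q R" using prime_maximal Q by auto
  then show "Q = M"
    using maximalideal.I_maximal[OF _ max_ideal[OF M], of Q] Q maximalideal.I_notcarr[OF M]
      ideal_subset_carrier[OF max_ideal[OF M]] by auto
qed

text \<open>An element of \<open>M\<close> generating it after localization. In dimension one this
  makes the localization a discrete valuation ring, although no such ring is formed.\<close>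

definition uniformizer :: "'a set \<Rightarrow> 'a" where
  "uniformizer M = (SOME t. t \<in> M \<and> (\<forall>p\<in>M. \<exists>s\<in>carrier R - M. \<exists>c\<in>carrier R. s \<otimes> p = c \<otimes> t))"

text \<open>The candidate is the local generator \<open>z\<close> of an invertible radical ideal
  \<open>J \<subseteq> M\<close>. Since nonzero primes are maximal, \<open>M\<close> is minimal over
  \<open>J\<close>, so \<open>J\<close> agrees with \<open>M\<close> locally.\<close>

lemma uniformizer:
  assumes M: "maximalideal M R"
  shows "uniformizer M \<in> M" "\<And>p. p \<in> M \<Longrightarrow> \<exists>s\<in>carrier R - M. \<exists>c\<in>carrier R. s \<otimes> p = c \<otimes> uniformizer M"
    "uniformizer M \<in> carrier R" "uniformizer M \<noteq> \<zero>"
proof -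
  note P = max_prime[OF M]
  obtain J where J: "J \<subseteq> M" "invertible_ideal R J" "radical_ideal R J"
    using invertible_radical[OF P max_nonzero[OF M]] by auto
  note JI = radical_ideal_ideal[OF J(3)]
  have "J \<noteq> {\<zero>}" using invertible_nonzero[OF J(2)] by auto
  then have min: "minimal_prime J M" using minimal_prime_max[OF M JI] J(1) by auto
  obtain z r where z: "z \<in> J" and r: "r \<in> carrier R - M"
    and gen: "\<forall>x\<in>J. \<exists>c\<in>carrier R. r \<otimes> x = c \<otimes> z"
    using invertible_locally_principal[OF J(2) P] by auto
  have "\<exists>s\<in>carrier R - M. \<exists>c\<in>carrier R. s \<otimes> p = c \<otimes> z" if p: "p \<in> M" for p
  proof -
    obtain s where s: "s \<in> carrier R - M" "s \<otimes> p \<in> J"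
      using minimal_prime_radical[OF J(3) min p] by (rule saturationE)
    then obtain c where c: "c \<in> carrier R" "r \<otimes> (s \<otimes> p) = c \<otimes> z" using gen by auto
    have "(r \<otimes> s) \<otimes> p = c \<otimes> z" using c(2) r s max_car[OF M p] by (simp add: m_assoc)
    then show ?thesis using prime_mult_notin[OF P r s(1)] c(1) by auto
  qed
  then have "\<exists>t. t \<in> M \<and> (\<forall>p\<in>M. \<exists>s\<in>carrier R - M. \<exists>c\<in>carrier R. s \<otimes> p = c \<otimes> t)"
    using z J(1) by auto
  then have unif: "uniformizer M \<in> M \<and>
      (\<forall>p\<in>M. \<exists>s\<in>carrier R - M. \<exists>c\<in>carrier R. s \<otimes> p = c \<otimes> uniformizer M)"
    unfolding uniformizer_def by (rule someI_ex)
  show gen: "\<exists>s\<in>carrier R - M. \<exists>c\<in>carrier R. s \<otimes> p = c \<otimes> uniformizer M" if "p \<in> M" for p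
    using unif that by simp
  show "uniformizer M \<in> M" using unif by simp
  then show "uniformizer M \<in> carrier R" by (rule max_car[OF M])
  show "uniformizer M \<noteq> \<zero>"
  proof
    assume 0: "uniformizer M = \<zero>"
    obtain p where p: "p \<in> M" "p \<noteq> \<zero>" using max_nonzero[OF M] ideal_nonzero_iff[OF max_ideal[OF M]] by auto
    then obtain s where s: "s \<in> carrier R - M" "s \<otimes> p = \<zero>" using gen[OF p(1)] 0 by auto
    then have "s = \<zero>" using integral[of s p] p max_car[OF M p(1)] by auto
    then show False using s(1) ideal_zero_mem[OF max_ideal[OF M]] by auto
  qed
qed

lemma uniformizer_power_nonzero:
  assumes M: "maximalideal M R" shows "uniformizer M [^] (n::nat) \<noteq> \<zero>"
  using uniformizer(3,4)[OF M] by (induction n) (auto simp: integral_iff)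

lemma carrier_nonzero: "carrier R \<noteq> {\<zero>}"
proof
  assume "carrier R = {\<zero>}"
  then have "\<one> \<in> {\<zero>}" using one_closed by metis
  then show False by simp
qed

text \<open>The normal form in a discrete valuation ring, a unit times a power of the uniformizer.
  Divisions of \<open>y\<close> by \<open>?t\<close> stop because minimality of \<open>M\<close>
  over \<open>PIdl y\<close> makes some power of \<open>?t\<close> a local multiple of
  \<open>y\<close>.\<close>

lemma element_decomposition:
  assumes M: "maximalideal M R" and y: "y \<in> carrier R" "y \<noteq> \<zero>"
  shows "\<exists>n. \<exists>s\<in>carrier R - M. \<exists>u\<in>carrier R - M. s \<otimes> y = u \<otimes> uniformizer M [^] (n::nat)"
proof -
  let ?t = "uniformizer M"
  note P = max_prime[OF M] and t = uniformizer[OF M]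
  \<comment> \<open>The relation \<open>s \<otimes> ?t [^] k = c \<otimes> y\<close> bounds the
    number of divisions: replacing \<open>y\<close> by its quotient \<open>c1\<close> lowers
    \<open>k\<close> by one, and at \<open>k = 0\<close> the element is outside
    \<open>M\<close>.\<close>
  have dec: "\<exists>n. \<exists>s\<in>carrier R - M. \<exists>u\<in>carrier R - M. s \<otimes> y = u \<otimes> ?t [^] (n::nat)"
    if "y \<in> carrier R" "s \<in> carrier R - M" "c \<in> carrier R" "s \<otimes> ?t [^] (k::nat) = c \<otimes> y" for k s c y
    using that
  proof (induction k arbitrary: s c y)
    case 0
    have "y \<notin> M"
    proof
      assume "y \<in> M"
      then have "c \<otimes> y \<in> M" using 0 ideal.I_l_closed[OF max_ideal[OF M]] by auto
      then show False using 0 by auto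
    qed
    then show ?case using 0 prime_one_notin[OF P]
      by (intro exI[of _ "0::nat"] bexI[of _ \<one>] bexI[of _ y]) auto
  next
    case (Suc k)
    show ?case
    proof (cases "y \<in> M")
      case False
      then show ?thesis using Suc.prems(1) prime_one_notin[OF P]
        by (intro exI[of _ "0::nat"] bexI[of _ \<one>] bexI[of _ y]) auto
    next
      case True
      then obtain s1 c1 where s1: "s1 \<in> carrier R - M" "c1 \<in> carrier R" "s1 \<otimes> y = c1 \<otimes> ?t"
        using t(2)[OF True] by auto
      have car: "s1 \<in> carrier R" "s \<in> carrier R" "?t [^] k \<in> carrier R" using s1 Suc.prems t(3) by auto
      have "?t \<otimes> ((s1 \<otimes> s) \<otimes> ?t [^] k) = s1 \<otimes> (s \<otimes> ?t [^] Suc k)"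
        using car t(3) by (simp add: m_ac)
      also have "\<dots> = c \<otimes> (s1 \<otimes> y)" using Suc.prems car by (simp add: m_lcomm)
      also have "\<dots> = ?t \<otimes> (c \<otimes> c1)" unfolding s1(3) using Suc.prems s1(2) t(3) by (simp add: m_ac)
      finally have "(s1 \<otimes> s) \<otimes> ?t [^] k = c \<otimes> c1"
        using m_lcancel[OF t(4,3)] car Suc.prems s1(2) by simp
      then obtain n s2 u where u: "s2 \<in> carrier R - M" "u \<in> carrier R - M" "s2 \<otimes> c1 = u \<otimes> ?t [^] (n::nat)"
        using Suc.IH[OF s1(2) prime_mult_notin[OF P s1(1) Suc.prems(2)] Suc.prems(3)] by auto
      have "(s2 \<otimes> s1) \<otimes> y = s2 \<otimes> (s1 \<otimes> y)" using u car Suc.prems(1) by (simp add: m_assoc)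
      also have "\<dots> = (s2 \<otimes> c1) \<otimes> ?t" unfolding s1(3) using u(1) s1(2) t(3) by (simp add: m_assoc)
      also have "\<dots> = u \<otimes> ?t [^] Suc n" unfolding u(3) using u(2) t(3) by (simp add: m_assoc)
      finally show ?thesis using prime_mult_notin[OF P u(1) s1(1)] u(2)
        by (intro exI[of _ "Suc n"] bexI[of _ "s2 \<otimes> s1"] bexI[of _ u]) auto
    qed
  qed
  show ?thesis
  proof (cases "y \<in> M")
    case False
    then show ?thesis using y prime_one_notin[OF P]
      by (intro exI[of _ "0::nat"] bexI[of _ \<one>] bexI[of _ y]) auto
  next
    case True
    have "PIdl y \<noteq> {\<zero>}" using cgenideal_self[OF y(1)] y(2) by auto
    then have min: "minimal_prime (PIdl y) M"
      using minimal_prime_max[OF M cgenideal_ideal[OF y(1)]] cgenideal_minimal[OF max_ideal[OF M] True] by auto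
    obtain s k where s: "s \<in> carrier R - M" "s \<otimes> ?t [^] (k::nat) \<in> PIdl y"
      by (rule minimal_prime_power[OF cgenideal_ideal[OF y(1)] min t(1)])
    then obtain c where "c \<in> carrier R" "s \<otimes> ?t [^] k = c \<otimes> y" using PIdl_mem_iff by auto
    then show ?thesis using dec[OF y(1) s(1)] by auto
  qed
qed

text \<open>The exponent for which \<open>I\<close> is locally generated by that power of the
  uniformizer. For the zero ideal no exponent qualifies and the value is unspecified; hence the
  assumptions \<open>I \<noteq> {\<zero>}\<close> wherever a witness is drawn from the
  minimum.\<close>

definition ord :: "'a set \<Rightarrow> 'a set \<Rightarrow> nat" where
  "ord M I = (LEAST n. \<exists>s\<in>carrier R - M. s \<otimes> uniformizer M [^] n \<in> I)"

lemma ord_le: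
  "s \<in> carrier R - M \<Longrightarrow> s \<otimes> uniformizer M [^] n \<in> I \<Longrightarrow> ord M I \<le> n"
  unfolding ord_def by (rule Least_le) auto

lemma ord_witness:
  assumes M: "maximalideal M R" and I: "ideal I R" "I \<noteq> {\<zero>}"
  shows "\<exists>s\<in>carrier R - M. s \<otimes> uniformizer M [^] ord M I \<in> I"
proof -
  obtain y where y: "y \<in> I" "y \<noteq> \<zero>" using I ideal_nonzero_iff by auto
  then have yc: "y \<in> carrier R" using ideal_subset_carrier[OF I(1)] by auto
  obtain n s u where u: "s \<in> carrier R - M" "u \<in> carrier R - M" "s \<otimes> y = u \<otimes> uniformizer M [^] (n::nat)"
    using element_decomposition[OF M yc y(2)] by auto
  have "s \<otimes> y \<in> I" using u(1) by (intro ideal.I_l_closed[OF I(1) y(1)]) auto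
  then have "\<exists>n. \<exists>s\<in>carrier R - M. s \<otimes> uniformizer M [^] (n::nat) \<in> I" using u by auto
  then show ?thesis unfolding ord_def by (rule LeastI_ex)
qed

lemma ord_divides:
  assumes M: "maximalideal M R" and I: "ideal I R" "x \<in> I"
  shows "\<exists>s\<in>carrier R - M. \<exists>c\<in>carrier R. s \<otimes> x = c \<otimes> uniformizer M [^] ord M I"
proof (cases "x = \<zero>")
  case True
  then show ?thesis using prime_one_notin[OF max_prime[OF M]] uniformizer(3)[OF M]
    by (intro bexI[of _ \<one>] bexI[of _ \<zero>]) auto
next
  case False
  have xc: "x \<in> carrier R" using I ideal_subset_carrier by auto
  note t = uniformizer(3)[OF M]
  obtain n s u where u: "s \<in> carrier R - M" "u \<in> carrier R - M" "s \<otimes> x = u \<otimes> uniformizer M [^] (n::nat)"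
    using element_decomposition[OF M xc False] by auto
  have "s \<otimes> x \<in> I" using u(1) by (intro ideal.I_l_closed[OF I]) auto
  \<comment> \<open>The normal form of \<open>x\<close> shows that its exponent \<open>n\<close> is
    among those competing in the minimum.\<close>
  then have "ord M I \<le> n" using u by (intro ord_le[of u]) auto
  then have "uniformizer M [^] n = uniformizer M [^] (n - ord M I) \<otimes> uniformizer M [^] ord M I"
    using t by (simp add: nat_pow_mult)
  then have "s \<otimes> x = (u \<otimes> uniformizer M [^] (n - ord M I)) \<otimes> uniformizer M [^] ord M I"
    using u t by (simp add: m_assoc)
  then show ?thesis using u t by (intro bexI[of _ s] bexI[of _ "u \<otimes> uniformizer M [^] (n - ord M I)"]) auto
qed

lemma uniformizer_power_dvd:
  assumes M: "maximalideal M R" and s: "s \<in> carrier R - M" and c: "c \<in> carrier R"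
    and eq: "s \<otimes> uniformizer M [^] (m::nat) = c \<otimes> uniformizer M [^] (n::nat)"
  shows "n \<le> m"
proof (rule ccontr)
  assume "\<not> n \<le> m"
  let ?t = "uniformizer M"
  note t = uniformizer[OF M]
  have "?t [^] m \<noteq> \<zero>" by (rule uniformizer_power_nonzero[OF M])
  \<comment> \<open>One factor \<open>?t\<close> is split off so that cancelling
    \<open>?t [^] m\<close> exhibits \<open>s\<close> as a multiple of \<open>?t\<close>, hence as
    an element of \<open>M\<close>.\<close>
  have n: "n = m + (n - m - 1) + 1" using \<open>\<not> n \<le> m\<close> by simp
  have "?t [^] n = ?t [^] m \<otimes> (?t [^] (n - m - 1) \<otimes> ?t)"
    by (subst n) (use t(3) in \<open>simp add: nat_pow_mult[symmetric] m_assoc\<close>)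
  then have "?t [^] m \<otimes> s = ?t [^] m \<otimes> ((c \<otimes> ?t [^] (n - m - 1)) \<otimes> ?t)"
    using eq s c t(3) by (simp add: m_ac)
  then have "s = (c \<otimes> ?t [^] (n - m - 1)) \<otimes> ?t"
    using m_lcancel[OF \<open>?t [^] m \<noteq> \<zero>\<close>] s c t(3) by simp
  also have "\<dots> \<in> M" using c t(3) by (intro ideal.I_l_closed[OF max_ideal[OF M] t(1)]) auto
  finally show False using s by simp
qed

lemma ord_mono:
  assumes M: "maximalideal M R" and I: "ideal I R" "I \<noteq> {\<zero>}" "I \<subseteq> J"
  shows "ord M J \<le> ord M I"
  using ord_witness[OF M I(1,2)] I(3) by (auto intro: ord_le)

text \<open>Containment can be tested at each maximal ideal, and there both ideals are generated by
  powers of the uniformizer, so that only exponents matter.\<close>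

lemma ideal_subset_iff_ord:
  assumes I: "ideal I R" "I \<noteq> {\<zero>}" and J: "ideal J R" "J \<noteq> {\<zero>}"
  shows "I \<subseteq> J \<longleftrightarrow> (\<forall>M. maximalideal M R \<longrightarrow> ord M J \<le> ord M I)"
proof
  assume "I \<subseteq> J" then show "\<forall>M. maximalideal M R \<longrightarrow> ord M J \<le> ord M I" using ord_mono I by simp
next
  assume le: "\<forall>M. maximalideal M R \<longrightarrow> ord M J \<le> ord M I"
  show "I \<subseteq> J"
  proof
    fix x assume x: "x \<in> I"
    have xc: "x \<in> carrier R" using x ideal_subset_carrier[OF I(1)] by auto
    show "x \<in> J"
    proof (rule local_global_mem[OF J(1) xc])
      fix M assume M: "maximalideal M R"
      let ?t = "uniformizer M"
      note t = uniformizer(3)[OF M]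
      obtain s c where s: "s \<in> carrier R - M" "c \<in> carrier R" "s \<otimes> x = c \<otimes> ?t [^] ord M I"
        using ord_divides[OF M I(1) x] by auto
      obtain s' where s': "s' \<in> carrier R - M" "s' \<otimes> ?t [^] ord M J \<in> J" using ord_witness[OF M J] by auto
      have "?t [^] ord M I = ?t [^] (ord M I - ord M J) \<otimes> ?t [^] ord M J"
        using le M t by (simp add: nat_pow_mult)
      then have "(s' \<otimes> s) \<otimes> x = (c \<otimes> ?t [^] (ord M I - ord M J)) \<otimes> (s' \<otimes> ?t [^] ord M J)"
        using s s' t xc by (simp add: m_ac)
      also have "\<dots> \<in> J" by (rule ideal.I_l_closed[OF J(1) s'(2)]) (use s t in auto)
      finally show "\<exists>s\<in>carrier R - M. s \<otimes> x \<in> J"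
        using prime_mult_notin[OF max_prime[OF M] s'(1) s(1)] by auto
    qed
  qed
qed

lemma ideal_eqI_ord:
  assumes "ideal I R" "I \<noteq> {\<zero>}" "ideal J R" "J \<noteq> {\<zero>}"
    and "\<And>M. maximalideal M R \<Longrightarrow> ord M I = ord M J"
  shows "I = J"
  using ideal_subset_iff_ord[OF assms(1-4)] ideal_subset_iff_ord[OF assms(3,4,1,2)] assms(5) by auto

lemma ideal_prod_nonzero:
  assumes I: "ideal I R" "I \<noteq> {\<zero>}" and J: "ideal J R" "J \<noteq> {\<zero>}"
  shows "I \<cdot> J \<noteq> {\<zero>}"
proof -
  obtain x y where xy: "x \<in> I" "x \<noteq> \<zero>" "y \<in> J" "y \<noteq> \<zero>"
    using I J ideal_nonzero_iff by auto
  moreover have "x \<in> carrier R" "y \<in> carrier R"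
    using xy ideal_subset_carrier[OF I(1)] ideal_subset_carrier[OF J(1)] by auto
  ultimately have "x \<otimes> y \<noteq> \<zero>" using integral[of x y] by auto
  moreover have "x \<otimes> y \<in> I \<cdot> J" using xy by (intro ideal_prod.prod)
  ultimately show ?thesis by auto
qed

lemma ord_prod:
  assumes M: "maximalideal M R" and I: "ideal I R" "I \<noteq> {\<zero>}" and J: "ideal J R" "J \<noteq> {\<zero>}"
  shows "ord M (I \<cdot> J) = ord M I + ord M J"
proof (rule antisym)
  let ?t = "uniformizer M" and ?m = "ord M I" and ?n = "ord M J"
  note t = uniformizer(3)[OF M] and P = max_prime[OF M]
  obtain s where s: "s \<in> carrier R - M" "s \<otimes> ?t [^] ?m \<in> I" using ord_witness[OF M I] by auto
  obtain s' where s': "s' \<in> carrier R - M" "s' \<otimes> ?t [^] ?n \<in> J" using ord_witness[OF M J] by auto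
  have "(s \<otimes> s') \<otimes> ?t [^] (?m + ?n) = (s \<otimes> ?t [^] ?m) \<otimes> (s' \<otimes> ?t [^] ?n)"
    using s s' t by (simp add: nat_pow_mult[symmetric] m_ac)
  also have "\<dots> \<in> I \<cdot> J" using s s' by (intro ideal_prod.prod)
  finally show "ord M (I \<cdot> J) \<le> ?m + ?n" using prime_mult_notin[OF P s(1) s'(1)] by (intro ord_le)
  note IJ = ideal_prod_is_ideal[OF I(1) J(1)]
  have tc: "?t [^] (?m + ?n) \<in> carrier R" using t by simp
  \<comment> \<open>Elements of \<open>I \<cdot> J\<close> are sums of products, each with its own
    multiplier. Landing in a saturation, which is an ideal, reduces the claim to single
    products.\<close>
  have "I \<cdot> J \<subseteq> saturation M (PIdl (?t [^] (?m + ?n)))"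
  proof (rule ideal_prod_subset[OF saturation_ideal[OF P cgenideal_ideal[OF tc]]])
    fix x y assume xy: "x \<in> I" "y \<in> J"
    obtain s c where s: "s \<in> carrier R - M" "c \<in> carrier R" "s \<otimes> x = c \<otimes> ?t [^] ?m"
      using ord_divides[OF M I(1) xy(1)] by auto
    obtain s' c' where s': "s' \<in> carrier R - M" "c' \<in> carrier R" "s' \<otimes> y = c' \<otimes> ?t [^] ?n"
      using ord_divides[OF M J(1) xy(2)] by auto
    have xc: "x \<in> carrier R" "y \<in> carrier R"
      using xy ideal_subset_carrier[OF I(1)] ideal_subset_carrier[OF J(1)] by auto
    have "(s \<otimes> s') \<otimes> (x \<otimes> y) = (s \<otimes> x) \<otimes> (s' \<otimes> y)" using s(1) s'(1) xc by (simp add: m_ac)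
    also have "\<dots> = (c \<otimes> c') \<otimes> ?t [^] (?m + ?n)"
      unfolding s(3) s'(3) using s(2) s'(2) t by (simp add: nat_pow_mult[symmetric] m_ac)
    also have "\<dots> \<in> PIdl (?t [^] (?m + ?n))" using s(2) s'(2) PIdl_mem_iff by auto
    finally show "x \<otimes> y \<in> saturation M (PIdl (?t [^] (?m + ?n)))"
      using prime_mult_notin[OF P s(1) s'(1)] xc by (intro saturationI) auto
  qed
  moreover obtain u where u: "u \<in> carrier R - M" "u \<otimes> ?t [^] ord M (I \<cdot> J) \<in> I \<cdot> J"
    using ord_witness[OF M IJ ideal_prod_nonzero[OF I J]] by auto
  ultimately obtain v where v: "v \<in> carrier R - M"
    "v \<otimes> (u \<otimes> ?t [^] ord M (I \<cdot> J)) \<in> PIdl (?t [^] (?m + ?n))"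
    by (auto elim!: saturationE)
  then obtain c where c: "c \<in> carrier R" "v \<otimes> (u \<otimes> ?t [^] ord M (I \<cdot> J)) = c \<otimes> ?t [^] (?m + ?n)"
    using PIdl_mem_iff by auto
  have "(v \<otimes> u) \<otimes> ?t [^] ord M (I \<cdot> J) = c \<otimes> ?t [^] (?m + ?n)"
    using c(2) u(1) v(1) t by (simp add: m_assoc)
  then show "?m + ?n \<le> ord M (I \<cdot> J)"
    using uniformizer_power_dvd[OF M prime_mult_notin[OF P v(1) u(1)] c(1)] by simp
qed

lemma ord_eq_0_iff:
  assumes M: "maximalideal M R" and I: "ideal I R" "I \<noteq> {\<zero>}"
  shows "ord M I = 0 \<longleftrightarrow> \<not> I \<subseteq> M"
proof
  assume "ord M I = 0"
  then obtain s where "s \<in> carrier R - M" "s \<otimes> uniformizer M [^] (0::nat) \<in> I"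
    using ord_witness[OF M I] by auto
  then show "\<not> I \<subseteq> M" by auto
next
  assume "\<not> I \<subseteq> M"
  then obtain s where s: "s \<in> I" "s \<notin> M" by auto
  then have "s \<in> carrier R" using ideal_subset_carrier[OF I(1)] by auto
  then have "ord M I \<le> 0" using s by (intro ord_le[of s]) auto
  then show "ord M I = 0" by simp
qed

text \<open>From \<open>s \<otimes> ?t [^] n \<in> I\<close> the power \<open>Suc n\<close> of
  \<open>s \<otimes> ?t\<close> lies in \<open>I\<close>; a radical \<open>I\<close> therefore
  contains \<open>s \<otimes> ?t\<close> itself.\<close>

lemma ord_radical_le_1:
  assumes M: "maximalideal M R" and I: "radical_ideal R I" "I \<noteq> {\<zero>}"
  shows "ord M I \<le> 1"
proof -
  let ?t = "uniformizer M"
  note t = uniformizer(3)[OF M] and II = radical_ideal_ideal[OF I(1)]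
  obtain s where s: "s \<in> carrier R - M" "s \<otimes> ?t [^] ord M I \<in> I" using ord_witness[OF M II I(2)] by auto
  have "(s \<otimes> ?t) [^] Suc (ord M I) = (s [^] ord M I \<otimes> ?t) \<otimes> (s \<otimes> ?t [^] ord M I)"
    using s(1) t by (simp add: nat_pow_distrib m_ac)
  also have "\<dots> \<in> I" by (rule ideal.I_l_closed[OF II s(2)]) (use s(1) t in auto)
  finally have "s \<otimes> ?t \<in> I" by (rule radical_idealD[OF I(1), rotated]) (use s(1) t in simp)
  then show ?thesis using s(1) t by (intro ord_le[of s]) auto
qed

lemma ord_radical_ideal:
  assumes M: "maximalideal M R" and I: "radical_ideal R I" "I \<noteq> {\<zero>}"
  shows "ord M I = (if I \<subseteq> M then 1 else 0)"
  using ord_eq_0_iff[OF M radical_ideal_ideal[OF I(1)] I(2)] ord_radical_le_1[OF M I] by auto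

text \<open>Serves to reduce semicontinuity for arbitrary ideals to principal ones: the witness
  \<open>s \<otimes> ?t [^] ord M I\<close> already has the least order possible in
  \<open>I\<close>.\<close>

lemma ord_attained:
  assumes M: "maximalideal M R" and I: "ideal I R" "I \<noteq> {\<zero>}"
  shows "\<exists>x\<in>I. x \<noteq> \<zero> \<and> ord M (PIdl x) = ord M I"
proof -
  let ?t = "uniformizer M"
  note t = uniformizer[OF M]
  obtain s where s: "s \<in> carrier R - M" "s \<otimes> ?t [^] ord M I \<in> I" using ord_witness[OF M I] by auto
  let ?x = "s \<otimes> ?t [^] ord M I"
  have "?t [^] ord M I \<noteq> \<zero>" by (rule uniformizer_power_nonzero[OF M])
  moreover have "s \<noteq> \<zero>" using s(1) ideal_zero_mem[OF max_ideal[OF M]] by auto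
  ultimately have x0: "?x \<noteq> \<zero>" using s(1) t(3) by (simp add: integral_iff)
  have xc: "?x \<in> carrier R" using s(1) t(3) by simp
  have "ord M (PIdl ?x) \<le> ord M I" using s(1) cgenideal_self[OF xc] by (rule ord_le)
  moreover have "PIdl ?x \<noteq> {\<zero>}" using x0 cgenideal_self[OF xc] by auto
  then have "ord M I \<le> ord M (PIdl ?x)"
    using cgenideal_minimal[OF I(1) s(2)] by (intro ord_mono[OF M cgenideal_ideal[OF xc]])
  ultimately show ?thesis using s(2) x0 by (intro bexI[of _ ?x]) auto
qed

lemma ideal_list_prod_nonzero:
  "\<forall>J\<in>set Js. ideal J R \<and> J \<noteq> {\<zero>} \<Longrightarrow> ideal_list_prod R Js \<noteq> {\<zero>}"
proof (induction Js)
  case Nil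
  show ?case using carrier_nonzero by simp
qed (use ideal_prod_nonzero ideal_list_prod_ideal in auto)

lemma ord_carrier: "maximalideal M R \<Longrightarrow> ord M (carrier R) = 0"
  using ord_eq_0_iff[OF _ oneideal carrier_nonzero, of M] prime_one_notin[OF max_prime, of M] by auto

lemma ord_list_prod:
  assumes M: "maximalideal M R"
  shows "\<forall>J\<in>set Js. ideal J R \<and> J \<noteq> {\<zero>} \<Longrightarrow> ord M (ideal_list_prod R Js) = (\<Sum>J\<leftarrow>Js. ord M J)"
proof (induction Js)
  case Nil
  then show ?case using ord_carrier[OF M] by simp
next
  case (Cons J Js)
  then show ?case using ord_prod[OF M, of J "ideal_list_prod R Js"] ideal_list_prod_nonzero[of Js]
      ideal_list_prod_ideal[of Js] by simp
qed

end

subsection \<open>The inverse topology\<close>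

context cring
begin

text \<open>Needed to turn \<open>\<one> \<in> genideal R S\<close> into a finite subcover. The
  union of the ideals generated by finite subsets of \<open>S\<close> is an ideal containing
  \<open>S\<close>.\<close>

lemma genideal_finite_support:
  assumes "S \<subseteq> carrier R" "x \<in> genideal R S"
  shows "\<exists>F. finite F \<and> F \<subseteq> S \<and> x \<in> genideal R F"
proof -
  define A where "A = {x. \<exists>F. finite F \<and> F \<subseteq> S \<and> x \<in> genideal R F}"
  have Fc: "F \<subseteq> carrier R" if "F \<subseteq> S" for F using that assms(1) by auto
  have mono: "genideal R F \<subseteq> genideal R G" if "F \<subseteq> G" "G \<subseteq> S" for F G
    using genideal_minimal[OF genideal_ideal[of G]] genideal_self[of G] that Fc[of G] by auto
  have "ideal A R"
  proof (rule idealI_cring)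
    show "A \<subseteq> carrier R"
      using ideal_subset_carrier[OF genideal_ideal[OF Fc]] by (auto simp: A_def)
    have "\<zero> \<in> genideal R {}" by (rule ideal_zero_mem[OF genideal_ideal]) simp
    then show "\<zero> \<in> A" unfolding A_def by (intro CollectI exI[of _ "{}"]) simp
  next
    fix x y assume "x \<in> A" "y \<in> A"
    then obtain F G where F: "finite F" "F \<subseteq> S" "x \<in> genideal R F"
      and G: "finite G" "G \<subseteq> S" "y \<in> genideal R G" by (auto simp: A_def)
    have FG: "F \<union> G \<subseteq> S" using F G by simp
    have "x \<oplus> y \<in> genideal R (F \<union> G)"
      using mono[of F "F \<union> G"] mono[of G "F \<union> G"] F G FG
      by (intro ideal_add_mem[OF genideal_ideal[OF Fc[OF FG]]]) auto
    then show "x \<oplus> y \<in> A" unfolding A_def using F G by (intro CollectI exI[of _ "F \<union> G"]) simp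
  next
    fix r x assume r: "r \<in> carrier R" and "x \<in> A"
    then obtain F where F: "finite F" "F \<subseteq> S" "x \<in> genideal R F" by (auto simp: A_def)
    then have "r \<otimes> x \<in> genideal R F" using ideal.I_l_closed[OF genideal_ideal[OF Fc[OF F(2)]]] r by simp
    then show "r \<otimes> x \<in> A" unfolding A_def using F by (intro CollectI exI[of _ F]) simp
  qed
  moreover have "S \<subseteq> A"
  proof
    fix a assume a: "a \<in> S"
    then have "a \<in> genideal R {a}" using assms(1) by (intro genideal_self') auto
    then show "a \<in> A" unfolding A_def using a by (intro CollectI exI[of _ "{a}"]) simp
  qed
  ultimately have "genideal R S \<subseteq> A" by (rule genideal_minimal)
  then show ?thesis using assms(2) by (auto simp: A_def)
qed

lemma genideal_subset_iff: "S \<subseteq> carrier R \<Longrightarrow> ideal M R \<Longrightarrow> genideal R S \<subseteq> M \<longleftrightarrow> S \<subseteq> M"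
  using genideal_self genideal_minimal by blast

lemma openin_Max_inv_basic:
  assumes "finite S" "S \<subseteq> carrier R"
  shows "openin (Max_inv R) {M. maximalideal M R \<and> S \<subseteq> M}"
proof -
  have "{M. maximalideal M R \<and> S \<subseteq> M} = {M. maximalideal M R \<and> genideal R S \<subseteq> M}"
    using genideal_subset_iff[OF assms(2)] maximalideal.axioms(1) by auto
  moreover have "fg_ideal R (genideal R S)" using assms unfolding fg_ideal_def by auto
  ultimately show ?thesis unfolding openin_Max_inv by (intro union_of_inc) (auto simp: arbitrary_def)
qed

lemma openin_Max_inv_nbhd:
  assumes "openin (Max_inv R) U" "M \<in> U"
  shows "maximalideal M R" "\<exists>S. finite S \<and> S \<subseteq> M \<and> {N. maximalideal N R \<and> S \<subseteq> N} \<subseteq> U"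
proof -
  show max: "maximalideal M R" using openin_subset[OF assms(1)] assms(2) topspace_Max_inv by auto
  obtain V where V: "\<exists>I. fg_ideal R I \<and> V = {M. maximalideal M R \<and> I \<subseteq> M}" "M \<in> V" "V \<subseteq> U"
    using assms unfolding openin_Max_inv union_of_def by auto
  then obtain S where S: "finite S" "S \<subseteq> carrier R" "V = {M. maximalideal M R \<and> genideal R S \<subseteq> M}"
    unfolding fg_ideal_def by auto
  then have "V = {M. maximalideal M R \<and> S \<subseteq> M}"
    using genideal_subset_iff[OF S(2)] maximalideal.axioms(1) by auto
  then show "\<exists>S. finite S \<and> S \<subseteq> M \<and> {N. maximalideal N R \<and> S \<subseteq> N} \<subseteq> U" using S(1) V(2,3) by auto
qed

lemma openin_Max_invI:
  assumes "\<And>M. M \<in> U \<Longrightarrow> maximalideal M R \<and>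
    (\<exists>S. finite S \<and> S \<subseteq> M \<and> (\<forall>N. maximalideal N R \<and> S \<subseteq> N \<longrightarrow> N \<in> U))"
  shows "openin (Max_inv R) U"
proof (subst openin_subopen, rule ballI)
  fix M assume "M \<in> U"
  then obtain S where M: "maximalideal M R" and S: "finite S" "S \<subseteq> M" "\<forall>N. maximalideal N R \<and> S \<subseteq> N \<longrightarrow> N \<in> U"
    using assms[OF \<open>M \<in> U\<close>] by auto
  have "S \<subseteq> carrier R" using S(2) ideal_subset_carrier[OF maximalideal.axioms(1)[OF M]] by auto
  then show "\<exists>T. openin (Max_inv R) T \<and> M \<in> T \<and> T \<subseteq> U"
    using openin_Max_inv_basic[OF S(1)] M S by (intro exI[of _ "{M. maximalideal M R \<and> S \<subseteq> M}"]) auto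
qed

lemma distinct_maximal_separated:
  assumes M: "maximalideal M R" and N: "maximalideal N R" and "M \<noteq> N"
  shows "\<exists>m\<in>M. \<exists>n\<in>N. m \<oplus> n = \<one>"
proof -
  note MI = maximalideal.axioms(1)[OF M] and NI = maximalideal.axioms(1)[OF N]
  have "\<not> N \<subseteq> M"
    using maximalideal.I_maximal[OF N MI] maximalideal.I_notcarr[OF M] \<open>M \<noteq> N\<close>
      ideal_subset_carrier[OF MI] by auto
  then obtain a where a: "a \<in> N" "a \<in> carrier R - M" using ideal_subset_carrier[OF NI] by auto
  then obtain m c where "m \<in> M" "c \<in> carrier R" "\<one> = m \<oplus> c \<otimes> a" using maximal_comaximal[OF M a(2)] by auto
  then show ?thesis using ideal.I_l_closed[OF NI a(1)] by (intro bexI[of _ m] bexI[of _ "c \<otimes> a"]) auto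
qed

lemma maximal_one_notin: "maximalideal M R \<Longrightarrow> \<one> \<notin> M"
  using prime_one_notin[OF maximalideal_prime] by auto

text \<open>Distinct maximal ideals contain elements \<open>m\<close> and \<open>n\<close> with sum
  \<open>\<one>\<close>. No maximal ideal contains both, so the basic open sets of \<open>m\<close>
  and of \<open>n\<close> are disjoint.\<close>

lemma Hausdorff_Max_inv: "Hausdorff_space (Max_inv R)"
  unfolding Hausdorff_space_def topspace_Max_inv
proof (intro allI impI)
  fix M N assume "M \<in> {M. maximalideal M R} \<and> N \<in> {M. maximalideal M R} \<and> M \<noteq> N"
  then have MN: "maximalideal M R" "maximalideal N R" "M \<noteq> N" by auto
  then obtain m n where mn: "m \<in> M" "n \<in> N" "m \<oplus> n = \<one>" using distinct_maximal_separated by metis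
  have c: "m \<in> carrier R" "n \<in> carrier R"
    using mn MN ideal_subset_carrier[OF maximalideal.axioms(1)] by auto
  let ?U = "\<lambda>a. {M. maximalideal M R \<and> {a} \<subseteq> M}"
  have "\<not> (m \<in> L \<and> n \<in> L)" if "maximalideal L R" for L
    using ideal_add_mem[OF maximalideal.axioms(1)[OF that], of m n] mn(3) maximal_one_notin[OF that] by auto
  then have "disjnt (?U m) (?U n)" by (auto simp: disjnt_def)
  moreover have "openin (Max_inv R) (?U m)" "openin (Max_inv R) (?U n)"
    using openin_Max_inv_basic[of "{m}"] openin_Max_inv_basic[of "{n}"] c by simp_all
  ultimately show "\<exists>U V. openin (Max_inv R) U \<and> openin (Max_inv R) V \<and> M \<in> U \<and> N \<in> V \<and> disjnt U V"
    using mn MN by (intro exI[of _ "?U m"] exI[of _ "?U n"]) auto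
qed

end

text \<open>The positive level sets are closed, being compact in a Hausdorff space, and no point
  lies in all of them because values are finite. So finitely many of their complements cover the
  compact level set at 1. The bound makes the layer decomposition of \<open>f\<close>
  finite.\<close>

lemma U_carrier_bounded:
  assumes X: "Hausdorff_space X" and f: "f \<in> U_carrier X"
  shows "\<exists>n. \<forall>x\<in>topspace X. f x \<le> n"
proof -
  let ?K = "\<lambda>k. {x \<in> topspace X. k \<le> f x}"
  have K: "compactin X (?K k)" if "k \<ge> 1" for k using f that by (auto simp: U_carrier_def)
  have op: "openin X (topspace X - ?K (Suc k))" for k
    using compactin_imp_closedin[OF X K[of "Suc k"]] by (simp add: closedin_def)
  have "?K 1 \<subseteq> \<Union> (range (\<lambda>k. topspace X - ?K (Suc k)))"
  proof
    fix x assume "x \<in> ?K 1"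
    then have "x \<in> topspace X - ?K (Suc (f x))" by simp
    then show "x \<in> \<Union> (range (\<lambda>k. topspace X - ?K (Suc k)))" by blast
  qed
  then have "\<exists>F. finite F \<and> F \<subseteq> range (\<lambda>k. topspace X - ?K (Suc k)) \<and> ?K 1 \<subseteq> \<Union>F"
    using op by (intro compactinD[OF K]) auto
  then obtain F where F: "finite F" "F \<subseteq> range (\<lambda>k. topspace X - ?K (Suc k))" "?K 1 \<subseteq> \<Union>F"
    by auto
  obtain A where A: "finite A" "F = (\<lambda>k. topspace X - ?K (Suc k)) ` A"
    using finite_subset_image[OF F(1,2)] by auto
  \<comment> \<open>The inserted 0 keeps \<open>Max\<close> meaningful when \<open>A\<close> is
    empty.\<close>
  have "f x \<le> Max (insert 0 A)" if x: "x \<in> topspace X" for x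
  proof (cases "f x \<ge> 1")
    case True
    then have "x \<in> \<Union>F" using F(3) x by blast
    then obtain k where "k \<in> A" "\<not> Suc k \<le> f x" unfolding A(2) by blast
    then have "k \<in> A" "f x \<le> k" by auto
    then show ?thesis using A(1) by (meson Max_ge finite_insert insertI2 le_trans)
  qed auto
  then show ?thesis by auto
qed

section \<open>Semicontinuity of orders and kernels of compact sets\<close>

context one_dim_radical_domain
begin

text \<open>Over a nonzero \<open>x\<close> the inverse topology is no finer than the Zariski
  topology: since \<open>M\<close> is minimal over \<open>PIdl x\<close>, every basic neighbourhood
  of \<open>M\<close> contains all maximal ideals over \<open>x\<close> that omit a suitable
  \<open>s\<close> outside \<open>M\<close>. Compactness then follows because a unit ideal needs
  only finitely many generators.\<close>

lemma compactin_Max_inv_containing: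
  assumes x: "x \<in> carrier R" "x \<noteq> \<zero>"
  shows "compactin (Max_inv R) {M. maximalideal M R \<and> x \<in> M}"
  unfolding compactin_def
proof (intro conjI allI impI)
  show "{M. maximalideal M R \<and> x \<in> M} \<subseteq> topspace (Max_inv R)" by (auto simp: topspace_Max_inv)
  fix \<U> assume \<U>: "Ball \<U> (openin (Max_inv R)) \<and> {M. maximalideal M R \<and> x \<in> M} \<subseteq> \<Union>\<U>"
  have xI: "PIdl x \<noteq> {\<zero>}" using cgenideal_self[OF x(1)] x(2) by auto
  \<comment> \<open>\<open>E\<close> collects the elements \<open>s\<close> for which all maximal
    ideals over \<open>x\<close> omitting \<open>s\<close> belong to a single member of the
    cover.\<close>
  define E where "E = {s \<in> carrier R. \<exists>U\<in>\<U>. \<forall>N. maximalideal N R \<and> x \<in> N \<and> s \<notin> N \<longrightarrow> N \<in> U}"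
  have Ec: "insert x E \<subseteq> carrier R" using x by (auto simp: E_def)
  note GI = genideal_ideal[OF Ec]
  have "genideal R (insert x E) = carrier R"
  proof (rule ccontr)
    assume "genideal R (insert x E) \<noteq> carrier R"
    then obtain M where M: "maximalideal M R" "genideal R (insert x E) \<subseteq> M"
      by (rule maximalideal_above[OF GI])
    then have EM: "insert x E \<subseteq> M" using genideal_self[OF Ec] by auto
    then obtain U where U: "U \<in> \<U>" "M \<in> U" using M(1) \<U> by auto
    then obtain S where S: "finite S" "S \<subseteq> M" "{N. maximalideal N R \<and> S \<subseteq> N} \<subseteq> U"
      using openin_Max_inv_nbhd(2)[of U M] \<U> by auto
    have min: "minimal_prime (PIdl x) M"
      using minimal_prime_max[OF M(1) cgenideal_ideal[OF x(1)] xI] EM cgenideal_minimal[OF max_ideal[OF M(1)]] by auto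
    \<comment> \<open>Each \<open>a \<in> S\<close> is nilpotent modulo \<open>x\<close> locally at
      \<open>M\<close>; one \<open>s\<close> works for the whole finite set, and any maximal ideal
      over \<open>x\<close> omitting \<open>s\<close> then contains \<open>S\<close>.\<close>
    have "\<exists>s\<in>carrier R - M. \<forall>a\<in>S. \<exists>k. s \<otimes> a [^] (k::nat) \<in> PIdl x"
    proof (rule common_multiplier[OF max_prime[OF M(1)] S(1)])
      fix a assume a: "a \<in> S"
      obtain s k where "s \<in> carrier R - M" "s \<otimes> a [^] (k::nat) \<in> PIdl x"
        using a S(2) by (auto intro: minimal_prime_power[OF cgenideal_ideal[OF x(1)] min])
      then show "\<exists>s\<in>carrier R - M. \<exists>k. s \<otimes> a [^] (k::nat) \<in> PIdl x" by auto
      fix s s' assume s: "s \<in> carrier R" "s' \<in> carrier R" "\<exists>k. s \<otimes> a [^] (k::nat) \<in> PIdl x"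
      then obtain k where k: "s \<otimes> a [^] (k::nat) \<in> PIdl x" by auto
      have "a \<in> carrier R" using a S(2) max_car[OF M(1)] by auto
      then have "(s' \<otimes> s) \<otimes> a [^] k = s' \<otimes> (s \<otimes> a [^] k)" using s by (simp add: m_assoc)
      also have "\<dots> \<in> PIdl x" by (rule ideal.I_l_closed[OF cgenideal_ideal[OF x(1)] k s(2)])
      finally show "\<exists>k. (s' \<otimes> s) \<otimes> a [^] (k::nat) \<in> PIdl x" by auto
    qed
    then obtain s where s: "s \<in> carrier R - M" "\<forall>a\<in>S. \<exists>k. s \<otimes> a [^] (k::nat) \<in> PIdl x" by auto
    have "N \<in> U" if N: "maximalideal N R" "x \<in> N" "s \<notin> N" for N
    proof -
      have "a \<in> N" if a: "a \<in> S" for a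
      proof -
        obtain k where "s \<otimes> a [^] (k::nat) \<in> PIdl x" using s(2) a by auto
        then have k: "s \<otimes> a [^] k \<in> N" using cgenideal_minimal[OF max_ideal[OF N(1)] N(2)] by auto
        have ac: "a \<in> carrier R" using a S(2) max_car[OF M(1)] by auto
        then have "a [^] k \<in> N" using primeideal.I_prime[OF max_prime[OF N(1)] _ _ k] s(1) N(3) by auto
        then show "a \<in> N" by (rule prime_pow_mem[OF max_prime[OF N(1)] ac])
      qed
      then show ?thesis using S(3) N(1) by auto
    qed
    then have "s \<in> E" using s(1) U(1) by (auto simp: E_def)
    then show False using EM s(1) by auto
  qed
  then obtain F where F: "finite F" "F \<subseteq> insert x E" "\<one> \<in> genideal R F"
    using genideal_finite_support[OF Ec, of \<one>] by auto
  have "\<forall>s\<in>F - {x}. \<exists>U\<in>\<U>. \<forall>N. maximalideal N R \<and> x \<in> N \<and> s \<notin> N \<longrightarrow> N \<in> U"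
    using F(2) by (auto simp: E_def)
  then obtain u where u: "\<forall>s\<in>F - {x}. u s \<in> \<U> \<and> (\<forall>N. maximalideal N R \<and> x \<in> N \<and> s \<notin> N \<longrightarrow> N \<in> u s)"
    by metis
  \<comment> \<open>A maximal ideal over \<open>x\<close> cannot contain all of \<open>F\<close>, so
    one of the finitely many chosen members of the cover accounts for it.\<close>
  have "\<exists>s\<in>F - {x}. s \<notin> N" if N: "maximalideal N R" "x \<in> N" for N
  proof (rule ccontr)
    assume "\<not> ?thesis"
    then have "F \<subseteq> N" using N by auto
    then have "genideal R F \<subseteq> N" by (rule genideal_minimal[OF max_ideal[OF N(1)]])
    then show False using F(3) maximal_one_notin[OF N(1)] by auto
  qed
  then have "{M. maximalideal M R \<and> x \<in> M} \<subseteq> \<Union>(u ` (F - {x}))" using u by fastforce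
  then show "\<exists>\<F>. finite \<F> \<and> \<F> \<subseteq> \<U> \<and> {M. maximalideal M R \<and> x \<in> M} \<subseteq> \<Union>\<F>"
    using F(1) u by (intro exI[of _ "u ` (F - {x})"]) auto
qed

text \<open>Containing the finite generating set \<open>A\<close> of \<open>J\<close> forces
  \<open>ord N J = 1\<close>, so the single element \<open>z\<close> generates \<open>N\<close>
  locally at every nearby \<open>N\<close>. The relation
  \<open>w \<otimes> z [^] k \<in> PIdl x\<close> then transports the bound \<open>k\<close> from
  \<open>M\<close> to \<open>N\<close>, as long as \<open>r\<close> and \<open>w\<close> stay
  outside \<open>N\<close>.\<close>

lemma openin_ord_le_principal:
  assumes x: "x \<in> carrier R" "x \<noteq> \<zero>"
  shows "openin (Max_inv R) {M. maximalideal M R \<and> ord M (PIdl x) \<le> n}"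
proof (rule openin_Max_invI)
  fix M assume "M \<in> {M. maximalideal M R \<and> ord M (PIdl x) \<le> n}"
  then have M: "maximalideal M R" and n: "ord M (PIdl x) \<le> n" by auto
  define k where "k = ord M (PIdl x)"
  note xI = cgenideal_ideal[OF x(1)]
  have x0: "PIdl x \<noteq> {\<zero>}" using cgenideal_self[OF x(1)] x(2) by auto
  note P = max_prime[OF M]
  let ?t = "uniformizer M"
  note t = uniformizer[OF M]
  obtain J where J: "J \<subseteq> M" "invertible_ideal R J" "radical_ideal R J"
    using invertible_radical[OF P max_nonzero[OF M]] by auto
  note JI = radical_ideal_ideal[OF J(3)]
  have J0: "J \<noteq> {\<zero>}" using invertible_nonzero[OF J(2)] by auto
  obtain A where A: "finite A" "A \<subseteq> carrier R" "J = genideal R A"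
    using invertible_fg[OF J(2)] unfolding fg_ideal_def by auto
  obtain z r where z: "z \<in> J" and r: "r \<in> carrier R - M"
    and gen: "\<forall>x\<in>J. \<exists>c\<in>carrier R. r \<otimes> x = c \<otimes> z"
    using invertible_locally_principal[OF J(2) P] by auto
  have zM: "z \<in> M" using z J(1) by auto
  have zc: "z \<in> carrier R" by (rule max_car[OF M zM])
  obtain s where s: "s \<in> carrier R - M" "s \<otimes> ?t [^] k \<in> PIdl x"
    using ord_witness[OF M xI x0] by (auto simp: k_def)
  obtain s' c where s': "s' \<in> carrier R - M" "c \<in> carrier R" "s' \<otimes> z = c \<otimes> ?t"
    using t(2)[OF zM] by auto
  \<comment> \<open>\<open>w\<close> combines the multiplier witnessing the order at
    \<open>M\<close> with \<open>k\<close> copies of the one comparing \<open>z\<close> with the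
    uniformizer.\<close>
  define w where "w = s \<otimes> s' [^] k"
  have w: "w \<in> carrier R - M" unfolding w_def
    by (rule prime_mult_notin[OF P s(1) prime_pow_notin[OF P s'(1)]])
  have "w \<otimes> z [^] k = s \<otimes> (s' \<otimes> z) [^] k"
    unfolding w_def using s(1) s'(1) zc by (simp add: nat_pow_distrib m_assoc)
  also have "\<dots> = c [^] k \<otimes> (s \<otimes> ?t [^] k)"
    unfolding s'(3) using s(1) s'(2) t(3) by (simp add: nat_pow_distrib m_ac)
  also have "\<dots> \<in> PIdl x" by (rule ideal.I_l_closed[OF xI s(2)]) (use s'(2) in simp)
  finally have wz: "w \<otimes> z [^] k \<in> PIdl x" .
  \<comment> \<open>Avoiding \<open>r \<otimes> w\<close> is not a basic open condition in the
    inverse topology. Containing \<open>m\<close> is one, and it forces \<open>r \<otimes> w\<close>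
    to be avoided because \<open>\<one> = m \<oplus> d \<otimes> (r \<otimes> w)\<close>.\<close>
  obtain m d where m: "m \<in> M" "d \<in> carrier R" "\<one> = m \<oplus> d \<otimes> (r \<otimes> w)"
    using maximal_comaximal[OF M prime_mult_notin[OF P r w]] by auto
  have "ord N (PIdl x) \<le> n" if N: "maximalideal N R" "insert m A \<subseteq> N" for N
  proof -
    let ?u = "uniformizer N"
    note u = uniformizer(3)[OF N(1)] and NP = max_prime[OF N(1)] and NI = max_ideal[OF N(1)]
    have JN: "J \<subseteq> N" using A N genideal_minimal[OF NI] by auto
    have rwN: "r \<otimes> w \<notin> N"
    proof
      assume "r \<otimes> w \<in> N"
      then have "m \<oplus> d \<otimes> (r \<otimes> w) \<in> N"
        using N(2) by (intro ideal_add_mem[OF NI] ideal.I_l_closed[OF NI _ m(2)]) auto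
      then show False using m(3) maximal_one_notin[OF N(1)] by simp
    qed
    have rN: "r \<in> carrier R - N"
      using rwN r w ideal.I_r_closed[OF NI, of r w] by auto
    have wN: "w \<in> carrier R - N"
      using rwN r w ideal.I_l_closed[OF NI, of w r] by auto
    have "ord N J = 1" using ord_radical_ideal[OF N(1) J(3) J0] JN by simp
    then obtain v where v: "v \<in> carrier R - N" "v \<otimes> ?u [^] (1::nat) \<in> J"
      using ord_witness[OF N(1) JI J0] by auto
    then obtain e where e: "e \<in> carrier R" "r \<otimes> (v \<otimes> ?u [^] (1::nat)) = e \<otimes> z" using gen by auto
    have rv: "(r \<otimes> v) \<otimes> ?u = e \<otimes> z" using e(2) r v(1) u by (simp add: m_assoc)
    have "(w \<otimes> (r \<otimes> v) [^] k) \<otimes> ?u [^] k = w \<otimes> ((r \<otimes> v) \<otimes> ?u) [^] k"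
      using w r v(1) u by (simp add: nat_pow_distrib m_assoc)
    also have "\<dots> = e [^] k \<otimes> (w \<otimes> z [^] k)"
      unfolding rv using w e(1) zc by (simp add: nat_pow_distrib m_ac)
    also have "\<dots> \<in> PIdl x" by (rule ideal.I_l_closed[OF xI wz]) (use e(1) in simp)
    finally have "ord N (PIdl x) \<le> k"
      using prime_mult_notin[OF NP wN prime_pow_notin[OF NP prime_mult_notin[OF NP rN v(1)]]]
      by (intro ord_le)
    then show ?thesis using n by (simp add: k_def)
  qed
  moreover have "A \<subseteq> M" using A J(1) genideal_self[OF A(2)] by auto
  ultimately show "maximalideal M R \<and> (\<exists>S. finite S \<and> S \<subseteq> M \<and>
      (\<forall>N. maximalideal N R \<and> S \<subseteq> N \<longrightarrow> N \<in> {M. maximalideal M R \<and> ord M (PIdl x) \<le> n}))"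
    using A(1) m(1) M by (intro conjI exI[of _ "insert m A"]) auto
qed

lemma ord_le_principal:
  assumes M: "maximalideal M R" and I: "ideal I R" and x: "x \<in> I" "x \<noteq> \<zero>"
  shows "ord M I \<le> ord M (PIdl x)"
proof -
  have xc: "x \<in> carrier R" using x ideal_subset_carrier[OF I] by auto
  have "PIdl x \<noteq> {\<zero>}" using cgenideal_self[OF xc] x(2) by auto
  then show ?thesis using ord_mono[OF M cgenideal_ideal[OF xc]] cgenideal_minimal[OF I x(1)] by auto
qed

lemma openin_ord_le:
  assumes I: "ideal I R" "I \<noteq> {\<zero>}"
  shows "openin (Max_inv R) {M. maximalideal M R \<and> ord M I \<le> n}"
proof -
  have Ic: "x \<in> carrier R" if "x \<in> I" for x using that ideal_subset_carrier[OF I(1)] by auto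
  have "{M. maximalideal M R \<and> ord M I \<le> n} =
    (\<Union>x\<in>I - {\<zero>}. {M. maximalideal M R \<and> ord M (PIdl x) \<le> n})"
  proof (intro equalityI subsetI)
    fix M assume "M \<in> {M. maximalideal M R \<and> ord M I \<le> n}"
    then show "M \<in> (\<Union>x\<in>I - {\<zero>}. {M. maximalideal M R \<and> ord M (PIdl x) \<le> n})"
      using ord_attained[OF _ I, of M] by force
  next
    fix M assume "M \<in> (\<Union>x\<in>I - {\<zero>}. {M. maximalideal M R \<and> ord M (PIdl x) \<le> n})"
    then obtain x where "x \<in> I" "x \<noteq> \<zero>" "maximalideal M R" "ord M (PIdl x) \<le> n" by auto
    then show "M \<in> {M. maximalideal M R \<and> ord M I \<le> n}" using ord_le_principal[of M I x] I(1) by auto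
  qed
  moreover have "openin (Max_inv R) (\<Union>x\<in>I - {\<zero>}. {M. maximalideal M R \<and> ord M (PIdl x) \<le> n})"
    using Ic by (intro openin_Union) (auto intro!: openin_ord_le_principal)
  ultimately show ?thesis by simp
qed

text \<open>A closed subset of the compact set of maximal ideals containing one nonzero element of
  \<open>I\<close>: where the order is positive, all of \<open>I\<close> lies in
  \<open>M\<close>.\<close>

lemma compactin_ord_ge:
  assumes I: "ideal I R" "I \<noteq> {\<zero>}" and k: "k \<ge> 1"
  shows "compactin (Max_inv R) {M. maximalideal M R \<and> k \<le> ord M I}"
proof -
  obtain x where x: "x \<in> I" "x \<noteq> \<zero>" using I ideal_nonzero_iff by auto
  have xc: "x \<in> carrier R" using x ideal_subset_carrier[OF I(1)] by auto
  have "{M. maximalideal M R \<and> k \<le> ord M I} = topspace (Max_inv R) - {M. maximalideal M R \<and> ord M I \<le> k - 1}"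
    using k by (auto simp: topspace_Max_inv)
  then have "closedin (Max_inv R) {M. maximalideal M R \<and> k \<le> ord M I}"
    using openin_ord_le[OF I] by auto
  moreover have "{M. maximalideal M R \<and> k \<le> ord M I} \<subseteq> {M. maximalideal M R \<and> x \<in> M}"
    using ord_eq_0_iff[OF _ I] k x(1) by fastforce
  ultimately show ?thesis
    using closed_compactin[OF compactin_Max_inv_containing[OF xc x(2)]] by auto
qed

lemma ord_U_carrier:
  assumes I: "ideal I R" "I \<noteq> {\<zero>}"
  shows "(\<lambda>M\<in>topspace (Max_inv R). ord M I) \<in> U_carrier (Max_inv R)"
proof -
  have "{M \<in> topspace (Max_inv R). k \<le> (\<lambda>M\<in>topspace (Max_inv R). ord M I) M} =
      {M. maximalideal M R \<and> k \<le> ord M I}" for k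
    by (auto simp: topspace_Max_inv)
  then show ?thesis using compactin_ord_ge[OF I] by (simp add: U_carrier_def)
qed

text \<open>The intersection of the family, taken inside \<open>carrier R\<close> so that the empty
  family gives the unit ideal.\<close>

definition kernel :: "'a set set \<Rightarrow> 'a set" where
  "kernel \<K> = {x \<in> carrier R. \<forall>M\<in>\<K>. x \<in> M}"

lemma kernel_radical:
  assumes "\<And>M. M \<in> \<K> \<Longrightarrow> maximalideal M R"
  shows "radical_ideal R (kernel \<K>)"
proof (rule radical_idealI_square)
  note MI = max_ideal[OF assms]
  show "ideal (kernel \<K>) R"
    using ideal_zero_mem[OF MI] ideal_add_mem[OF MI] ideal.I_l_closed[OF MI]
    by (intro idealI_cring) (auto simp: kernel_def)
  show "x \<in> kernel \<K>" if "x \<in> carrier R" "x \<otimes> x \<in> kernel \<K>" for x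
    using that primeideal.I_prime[OF max_prime[OF assms]] by (auto simp: kernel_def)
qed

text \<open>By compactness finitely many elements of \<open>T\<close> suffice to have one in every
  member of \<open>\<K>\<close>; their product lies in all members at once. Applied with
  \<open>T\<close> the nonzero elements and with \<open>T\<close> the complement of a maximal
  ideal.\<close>

lemma kernel_meets_multiplicative_set:
  assumes \<K>: "compactin (Max_inv R) \<K>"
    and T: "\<one> \<in> T" "T \<subseteq> carrier R" "\<And>a b. a \<in> T \<Longrightarrow> b \<in> T \<Longrightarrow> a \<otimes> b \<in> T"
    and meets: "\<And>M. M \<in> \<K> \<Longrightarrow> \<exists>a\<in>T. a \<in> M"
  shows "\<exists>a\<in>T. a \<in> kernel \<K>"
proof -
  define V where "V a = {M. maximalideal M R \<and> a \<in> M}" for a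
  have "openin (Max_inv R) (V a)" if "a \<in> T" for a
    using openin_Max_inv_basic[of "{a}"] that T(2) by (auto simp: V_def)
  moreover have "\<K> \<subseteq> \<Union>(V ` T)"
  proof
    fix M assume M: "M \<in> \<K>"
    then have "maximalideal M R" using compactin_subset_topspace[OF \<K>] topspace_Max_inv by auto
    then show "M \<in> \<Union>(V ` T)" using meets[OF M] by (auto simp: V_def)
  qed
  ultimately have "\<exists>\<F>. finite \<F> \<and> \<F> \<subseteq> V ` T \<and> \<K> \<subseteq> \<Union>\<F>"
    by (intro compactinD[OF \<K>]) auto
  then obtain \<F> where \<F>: "finite \<F>" "\<F> \<subseteq> V ` T" "\<K> \<subseteq> \<Union>\<F>" by auto
  then obtain F where F: "finite F" "F \<subseteq> T" "\<F> = V ` F" using finite_subset_image[OF \<F>(1,2)] by auto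
  have "\<exists>a\<in>T. \<forall>M\<in>\<Union>(V ` F). a \<in> M"
    using F(1,2)
  proof (induction F)
    case empty
    then show ?case using T(1) by auto
  next
    case (insert b F)
    then obtain a where a: "a \<in> T" "\<forall>M\<in>\<Union>(V ` F). a \<in> M" by auto
    have b: "b \<in> T" using insert.prems by simp
    have c: "a \<in> carrier R" "b \<in> carrier R" using a b T(2) by auto
    have "a \<otimes> b \<in> M" if M: "M \<in> \<Union>(V ` insert b F)" for M
    proof -
      have "maximalideal M R" using M by (auto simp: V_def)
      note MI = max_ideal[OF this]
      show ?thesis
      proof (cases "M \<in> V b")
        case True
        then show ?thesis using ideal.I_l_closed[OF MI _ c(1), of b] by (simp add: V_def)
      next
        case False
        then have "a \<in> M" using a(2) M by auto
        then show ?thesis using ideal.I_r_closed[OF MI _ c(2)] by simp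
      qed
    qed
    then show ?case using T(3)[OF a(1) b] by auto
  qed
  then obtain a where "a \<in> T" "\<forall>M\<in>\<K>. a \<in> M" using \<F>(3) F(3) by auto
  then show ?thesis using T(2) by (auto simp: kernel_def)
qed

lemma kernel_nonzero:
  assumes \<K>: "compactin (Max_inv R) \<K>"
  shows "kernel \<K> \<noteq> {\<zero>}"
proof -
  have "\<exists>a\<in>carrier R - {\<zero>}. a \<in> kernel \<K>"
  proof (rule kernel_meets_multiplicative_set[OF \<K>])
    show "a \<otimes> b \<in> carrier R - {\<zero>}" if "a \<in> carrier R - {\<zero>}" "b \<in> carrier R - {\<zero>}" for a b
      using that integral[of a b] by auto
    fix M assume "M \<in> \<K>"
    then have M: "maximalideal M R" using compactin_subset_topspace[OF \<K>] topspace_Max_inv by auto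
    obtain a where a: "a \<in> M" "a \<noteq> \<zero>" using max_nonzero[OF M] ideal_nonzero_iff[OF max_ideal[OF M]] by auto
    then show "\<exists>a\<in>carrier R - {\<zero>}. a \<in> M" using max_car[OF M] by auto
  qed auto
  then show ?thesis by auto
qed

text \<open>For \<open>N\<close> outside \<open>\<K>\<close>, comaximality gives each member of
  \<open>\<K>\<close> an element outside \<open>N\<close>, and these merge into one element of the
  kernel outside \<open>N\<close>. So a compact set is recovered from its kernel.\<close>

lemma kernel_subset_iff:
  assumes \<K>: "compactin (Max_inv R) \<K>" and N: "maximalideal N R"
  shows "kernel \<K> \<subseteq> N \<longleftrightarrow> N \<in> \<K>"
proof
  show "kernel \<K> \<subseteq> N" if "N \<in> \<K>" using that by (auto simp: kernel_def)
  show "N \<in> \<K>" if sub: "kernel \<K> \<subseteq> N"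
  proof (rule ccontr)
    assume NK: "N \<notin> \<K>"
    have "\<exists>a\<in>carrier R - N. a \<in> kernel \<K>"
    proof (rule kernel_meets_multiplicative_set[OF \<K>])
      show "\<one> \<in> carrier R - N" using maximal_one_notin[OF N] by auto
      show "a \<otimes> b \<in> carrier R - N" if "a \<in> carrier R - N" "b \<in> carrier R - N" for a b
        using prime_mult_notin[OF max_prime[OF N] that] .
      fix M assume MK: "M \<in> \<K>"
      then have M: "maximalideal M R" using compactin_subset_topspace[OF \<K>] topspace_Max_inv by auto
      obtain a b where a: "a \<in> M" "b \<in> N" "a \<oplus> b = \<one>"
        using distinct_maximal_separated[OF M N] NK MK by auto
      then have "a \<notin> N" using ideal_add_mem[OF max_ideal[OF N], of a b] maximal_one_notin[OF N] by auto
      then show "\<exists>a\<in>carrier R - N. a \<in> M" using a(1) max_car[OF M a(1)] by auto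
    qed auto
    then show False using sub by auto
  qed
qed

end

subsection \<open>Consequences for the lattice of ideals\<close>

lemma sum_list_threshold:
  "(\<Sum>k\<leftarrow>[1..<Suc n]. if k \<le> m then 1 else 0) = min m n"
  by (induction n) auto

context one_dim_radical_domain
begin

text \<open>Serves both the existence of radical chains and the surjectivity of the lattice map.
  Level sets shrink as \<open>k\<close> grows, so their kernels increase; the kernel at level
  \<open>k\<close> has order 1 exactly where \<open>f\<close> reaches \<open>k\<close>.\<close>

lemma chain_with_orders:
  assumes f: "f \<in> U_carrier (Max_inv R)"
  shows "\<exists>Js. (\<forall>J\<in>set Js. radical_ideal R J \<and> J \<noteq> {\<zero>}) \<and> sorted_wrt (\<subseteq>) Js \<and>
    (\<forall>M. maximalideal M R \<longrightarrow> ord M (ideal_list_prod R Js) = f M)"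
proof -
  let ?X = "Max_inv R"
  obtain n where n: "\<forall>M\<in>topspace ?X. f M \<le> n" using U_carrier_bounded[OF Hausdorff_Max_inv f] by auto
  define K where "K k = {M \<in> topspace ?X. k \<le> f M}" for k
  have K: "compactin ?X (K k)" if "k \<ge> 1" for k using f that by (auto simp: U_carrier_def K_def)
  have Kmax: "maximalideal M R" if "M \<in> K k" for M k using that by (auto simp: K_def topspace_Max_inv)
  define Js where "Js = map (\<lambda>k. kernel (K k)) [1..<Suc n]"
  have rad: "radical_ideal R (kernel (K k))" for k by (rule kernel_radical[OF Kmax])
  have Js: "\<forall>J\<in>set Js. radical_ideal R J \<and> J \<noteq> {\<zero>}"
    using rad kernel_nonzero[OF K] by (auto simp: Js_def)
  have "sorted_wrt (\<lambda>i j. kernel (K i) \<subseteq> kernel (K j)) [1..<Suc n]"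
    by (rule sorted_wrt_mono_rel[OF _ sorted_wrt_upt]) (auto simp: kernel_def K_def)
  then have "sorted_wrt (\<subseteq>) Js" by (simp add: Js_def sorted_wrt_map del: upt_Suc)
  moreover have "ord M (ideal_list_prod R Js) = f M" if M: "maximalideal M R" for M
  proof -
    have MX: "M \<in> topspace ?X" using M by (simp add: topspace_Max_inv)
    have ordk: "ord M (kernel (K k)) = (if k \<le> f M then 1 else 0)" if "k \<ge> 1" for k
      using ord_radical_ideal[OF M rad kernel_nonzero[OF K[OF that]]] kernel_subset_iff[OF K[OF that] M] MX
      by (simp add: K_def)
    have "ord M (ideal_list_prod R Js) = (\<Sum>J\<leftarrow>Js. ord M J)"
      using Js radical_ideal_ideal by (intro ord_list_prod[OF M]) auto
    also have "\<dots> = (\<Sum>k\<leftarrow>[1..<Suc n]. ord M (kernel (K k)))" by (simp add: Js_def comp_def del: upt_Suc)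
    also have "\<dots> = (\<Sum>k\<leftarrow>[1..<Suc n]. if k \<le> f M then 1 else 0)"
      by (rule arg_cong[where f = sum_list], rule map_cong) (auto simp: ordk)
    also have "\<dots> = min (f M) n" by (rule sum_list_threshold)
    also have "\<dots> = f M" using n MX by simp
    finally show ?thesis .
  qed
  ultimately show ?thesis using Js by auto
qed

text \<open>Levels above all values of \<open>f\<close> have empty level sets and contribute the
  unit ideal to the chain; discarding such factors yields a chain of proper ideals.\<close>

lemma ideal_list_prod_filter_proper:
  "\<forall>J\<in>set Js. ideal J R \<Longrightarrow>
    ideal_list_prod R (filter (\<lambda>J. J \<noteq> carrier R) Js) = ideal_list_prod R Js"
  using ideal_list_prod_ideal by (induction Js) (auto simp: ideal_prod_carrier)

lemma proper_radical_chain_exists: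
  assumes I: "ideal I R" "I \<noteq> {\<zero>}"
  shows "\<exists>Js. (\<forall>J\<in>set Js. radical_ideal R J \<and> J \<noteq> carrier R) \<and> sorted_wrt (\<subseteq>) Js \<and>
    I = ideal_list_prod R Js"
proof -
  obtain Js where Js: "\<forall>J\<in>set Js. radical_ideal R J \<and> J \<noteq> {\<zero>}" "sorted_wrt (\<subseteq>) Js"
    "\<forall>M. maximalideal M R \<longrightarrow>
       ord M (ideal_list_prod R Js) = (\<lambda>M\<in>topspace (Max_inv R). ord M I) M"
    using chain_with_orders[OF ord_U_carrier[OF I]] by auto
  have JI: "\<forall>J\<in>set Js. ideal J R" using Js(1) radical_ideal_ideal by auto
  have "I = ideal_list_prod R Js"
    using Js JI ideal_list_prod_nonzero ideal_list_prod_ideal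
    by (intro ideal_eqI_ord[OF I]) (auto simp: topspace_Max_inv)
  then have "I = ideal_list_prod R (filter (\<lambda>J. J \<noteq> carrier R) Js)"
    using ideal_list_prod_filter_proper[OF JI] by simp
  then show ?thesis using Js(1,2) sorted_wrt_filter
    by (intro exI[of _ "filter (\<lambda>J. J \<noteq> carrier R) Js"]) auto
qed

lemma ideal_list_prod_nonzero_factors:
  assumes "\<forall>J\<in>set Js. ideal J R" "ideal_list_prod R Js \<noteq> {\<zero>}" "J \<in> set Js"
  shows "J \<noteq> {\<zero>}"
proof
  assume "J = {\<zero>}"
  then have "ideal_list_prod R Js \<subseteq> {\<zero>}" using ideal_list_prod_subset[OF assms(1,3)] by simp
  then show False using assms(2) ideal_zero_mem[OF ideal_list_prod_ideal[OF assms(1)]] by auto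
qed

text \<open>The first member of a chain is the radical of the product.\<close>

lemma radical_chain_head:
  assumes Js: "\<forall>J\<in>set (K # Js). radical_ideal R J" "sorted_wrt (\<subseteq>) (K # Js)"
    and nz: "ideal_list_prod R (K # Js) \<noteq> {\<zero>}" and M: "maximalideal M R"
  shows "ord M K = (if ideal_list_prod R (K # Js) \<subseteq> M then 1 else 0)"
proof -
  have JI: "\<forall>J\<in>set (K # Js). ideal J R" using Js(1) radical_ideal_ideal by auto
  have "K \<noteq> {\<zero>}" using ideal_list_prod_nonzero_factors[OF JI nz] by simp
  moreover have "ideal_list_prod R (K # Js) \<subseteq> M \<longleftrightarrow> K \<subseteq> M"
  proof
    assume "ideal_list_prod R (K # Js) \<subseteq> M"
    then obtain J where "J \<in> set (K # Js)" "J \<subseteq> M"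
      using prime_list_prod_subset[OF max_prime[OF M] JI] by auto
    then show "K \<subseteq> M" using Js(2) by auto
  next
    assume "K \<subseteq> M" then show "ideal_list_prod R (K # Js) \<subseteq> M"
      using ideal_list_prod_subset[OF JI, of K] by auto
  qed
  ultimately show ?thesis using ord_radical_ideal[OF M, of K] Js(1) by simp
qed

text \<open>The head of a chain is determined by the product, and its order cancels in the sums,
  leaving equal products of the tails. A nonempty product of proper ideals is proper, so both lists
  end together.\<close>

lemma proper_radical_chain_unique:
  assumes "\<forall>J\<in>set Js. radical_ideal R J \<and> J \<noteq> carrier R" "sorted_wrt (\<subseteq>) Js"
    and "\<forall>J\<in>set Ks. radical_ideal R J \<and> J \<noteq> carrier R" "sorted_wrt (\<subseteq>) Ks"
    and "ideal_list_prod R Js = ideal_list_prod R Ks" "ideal_list_prod R Js \<noteq> {\<zero>}"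
  shows "Js = Ks"
  using assms
proof (induction Js arbitrary: Ks)
  case Nil
  have "Ks = []"
  proof (rule ccontr)
    assume "Ks \<noteq> []"
    then show False using proper_list_prod[of Ks] Nil radical_ideal_ideal by auto
  qed
  then show ?case by simp
next
  case (Cons J Js)
  have proper: "ideal_list_prod R (J # Js) \<noteq> carrier R"
    using Cons.prems(1) radical_ideal_ideal by (intro proper_list_prod) auto
  obtain K Ks' where Ks: "Ks = K # Ks'" using proper Cons.prems(5) by (cases Ks) auto
  note prems = Cons.prems[unfolded Ks]
  have rJ: "\<forall>J\<in>set (J # Js). radical_ideal R J" and rK: "\<forall>J\<in>set (K # Ks'). radical_ideal R J"
    using prems(1,3) by auto
  have JI: "\<forall>J\<in>set (J # Js). ideal J R" and KI: "\<forall>J\<in>set (K # Ks'). ideal J R"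
    using rJ rK radical_ideal_ideal by auto
  have nzK: "ideal_list_prod R (K # Ks') \<noteq> {\<zero>}" using prems(5,6) by simp
  note J0 = ideal_list_prod_nonzero_factors[OF JI prems(6)]
  note K0 = ideal_list_prod_nonzero_factors[OF KI nzK]
  have "J = K"
    using radical_chain_head[OF rJ prems(2,6)] radical_chain_head[OF rK prems(4) nzK] prems(5) J0 K0 JI KI
    by (intro ideal_eqI_ord) auto
  moreover have "ideal_list_prod R Js = ideal_list_prod R Ks'"
  proof (rule ideal_eqI_ord)
    show "ideal (ideal_list_prod R Js) R" "ideal (ideal_list_prod R Ks') R"
      using JI KI by (auto intro: ideal_list_prod_ideal)
    show "ideal_list_prod R Js \<noteq> {\<zero>}" "ideal_list_prod R Ks' \<noteq> {\<zero>}"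
      using JI KI J0 K0 ideal_list_prod_nonzero[of Js] ideal_list_prod_nonzero[of Ks'] by auto
    fix M assume M: "maximalideal M R"
    have "(\<Sum>J\<leftarrow>J # Js. ord M J) = (\<Sum>J\<leftarrow>K # Ks'. ord M J)"
      using ord_list_prod[OF M, of "J # Js"] ord_list_prod[OF M, of "K # Ks'"] JI KI J0 K0 prems(5) by auto
    then have "(\<Sum>J\<leftarrow>Js. ord M J) = (\<Sum>J\<leftarrow>Ks'. ord M J)" using \<open>J = K\<close> by simp
    then show "ord M (ideal_list_prod R Js) = ord M (ideal_list_prod R Ks')"
      using ord_list_prod[OF M, of Js] ord_list_prod[OF M, of Ks'] JI KI J0 K0 by auto
  qed
  moreover have "ideal_list_prod R Js \<noteq> {\<zero>}" using ideal_list_prod_nonzero[of Js] JI J0 by auto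
  ultimately show ?case using Cons.IH[of Ks'] prems Ks by auto
qed

text \<open>With \<open>B\<close> the colon ideal of \<open>PIdl y\<close> by \<open>I\<close>, the
  equation \<open>I \<cdot> B = PIdl y\<close> can be checked through orders at each
  \<open>M\<close>, where a finitely generated \<open>I\<close> is generated by one \<open>w\<close>
  up to a common multiplier.\<close>

lemma fg_invertible:
  assumes fg: "fg_ideal R I" and I0: "I \<noteq> {\<zero>}"
  shows "invertible_ideal R I"
proof -
  obtain S where S: "finite S" "S \<subseteq> carrier R" "I = genideal R S" using fg by (auto simp: fg_ideal_def)
  have I: "ideal I R" using S genideal_ideal by simp
  have Ic: "x \<in> carrier R" if "x \<in> I" for x using that ideal_subset_carrier[OF I] by auto
  obtain y where y: "y \<in> I" "y \<noteq> \<zero>" using I I0 ideal_nonzero_iff by auto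
  note yc = Ic[OF y(1)]
  note yI = cgenideal_ideal[OF yc]
  define B where "B = {b \<in> carrier R. \<forall>x\<in>I. b \<otimes> x \<in> PIdl y}"
  have B: "ideal B R"
  proof (rule idealI_cring)
    show "B \<subseteq> carrier R" "\<zero> \<in> B" using ideal_zero_mem[OF yI] Ic by (auto simp: B_def)
    show "a \<oplus> b \<in> B" if "a \<in> B" "b \<in> B" for a b
      using that Ic ideal_add_mem[OF yI] by (simp add: B_def l_distr)
    show "r \<otimes> a \<in> B" if "r \<in> carrier R" "a \<in> B" for r a
      using that Ic ideal.I_l_closed[OF yI] by (simp add: B_def m_assoc)
  qed
  have "y \<otimes> x \<in> PIdl y" if "x \<in> I" for x
    using ideal.I_r_closed[OF yI cgenideal_self[OF yc] Ic[OF that]] .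
  then have "y \<in> B" using yc by (auto simp: B_def)
  then have B0: "B \<noteq> {\<zero>}" using y(2) by auto
  have y0: "PIdl y \<noteq> {\<zero>}" using cgenideal_self[OF yc] y(2) by auto
  have IB: "ideal (I \<cdot> B) R" "I \<cdot> B \<noteq> {\<zero>}"
    using ideal_prod_is_ideal[OF I B] ideal_prod_nonzero[OF I I0 B B0] .
  have "I \<cdot> B \<subseteq> PIdl y"
  proof (rule ideal_prod_subset[OF yI])
    fix i b assume "i \<in> I" "b \<in> B"
    then show "i \<otimes> b \<in> PIdl y" using Ic[of i] by (auto simp: B_def m_comm)
  qed
  moreover have "PIdl y \<subseteq> I \<cdot> B"
  proof (subst ideal_subset_iff_ord[OF yI y0 IB], intro allI impI)
    fix M assume M: "maximalideal M R"
    note P = max_prime[OF M] and t = uniformizer(3)[OF M]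
    let ?t = "uniformizer M"
    obtain s0 where s0: "s0 \<in> carrier R - M" "s0 \<otimes> ?t [^] ord M I \<in> I" using ord_witness[OF M I I0] by auto
    define w where "w = s0 \<otimes> ?t [^] ord M I"
    have wI: "w \<in> I" and wc: "w \<in> carrier R" using s0 t by (auto simp: w_def)
    \<comment> \<open>Finite generation enters here: one \<open>s\<close> carries all generators,
      and hence all of \<open>I\<close>, into the multiples of \<open>w\<close>.\<close>
    have "\<exists>s\<in>carrier R - M. \<forall>a\<in>S. \<exists>c\<in>carrier R. s \<otimes> a = c \<otimes> w"
    proof (rule common_multiplier[OF P S(1)])
      fix a assume a: "a \<in> S"
      then have ac: "a \<in> carrier R" and aI: "a \<in> I" using S genideal_self by auto
      obtain s c where s: "s \<in> carrier R - M" "c \<in> carrier R" "s \<otimes> a = c \<otimes> ?t [^] ord M I"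
        using ord_divides[OF M I aI] by auto
      have "(s0 \<otimes> s) \<otimes> a = s0 \<otimes> (s \<otimes> a)" using s(1) s0(1) ac by (simp add: m_assoc)
      also have "\<dots> = c \<otimes> w" unfolding s(3) w_def using s(2) s0(1) t by (simp add: m_lcomm)
      finally show "\<exists>s\<in>carrier R - M. \<exists>c\<in>carrier R. s \<otimes> a = c \<otimes> w"
        using prime_mult_notin[OF P s0(1) s(1)] s(2) by (intro bexI[of _ "s0 \<otimes> s"] bexI[of _ c]) auto
      fix s s' assume ss: "s \<in> carrier R" "s' \<in> carrier R" "\<exists>c\<in>carrier R. s \<otimes> a = c \<otimes> w"
      then obtain c where c: "c \<in> carrier R" "s \<otimes> a = c \<otimes> w" by auto
      have "(s' \<otimes> s) \<otimes> a = s' \<otimes> (s \<otimes> a)" using ss(1,2) ac by (simp add: m_assoc)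
      also have "\<dots> = (s' \<otimes> c) \<otimes> w" unfolding c(2) using ss(2) c(1) wc by (simp add: m_assoc)
      finally show "\<exists>c\<in>carrier R. (s' \<otimes> s) \<otimes> a = c \<otimes> w"
        using ss(2) c(1) by (intro bexI[of _ "s' \<otimes> c"]) auto
    qed
    then obtain s where s: "s \<in> carrier R - M" "\<forall>a\<in>S. \<exists>c\<in>carrier R. s \<otimes> a = c \<otimes> w" by auto
    have sc: "s \<in> carrier R" using s by simp
    define A where "A = {x \<in> carrier R. s \<otimes> x \<in> PIdl w}"
    note wPI = cgenideal_ideal[OF wc]
    have A: "ideal A R"
    proof (rule idealI_cring)
      show "A \<subseteq> carrier R" "\<zero> \<in> A" using ideal_zero_mem[OF wPI] sc by (auto simp: A_def)
      show "a \<oplus> b \<in> A" if "a \<in> A" "b \<in> A" for a b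
        using that sc ideal_add_mem[OF wPI] by (simp add: A_def r_distr)
      show "r \<otimes> a \<in> A" if "r \<in> carrier R" "a \<in> A" for r a
        using that sc ideal.I_l_closed[OF wPI] m_lcomm[of s r a] by (simp add: A_def)
    qed
    have "S \<subseteq> A" using s(2) S(2) PIdl_mem_iff by (auto simp: A_def)
    then have IA: "I \<subseteq> A" unfolding S(3) by (rule genideal_minimal[OF A])
    have gen: "\<exists>c\<in>carrier R. s \<otimes> x = c \<otimes> w" if "x \<in> I" for x
      using that IA PIdl_mem_iff by (auto simp: A_def)
    obtain c where c: "c \<in> carrier R" "s \<otimes> y = c \<otimes> w" using gen[OF y(1)] by auto
    \<comment> \<open>If \<open>s \<otimes> y = c \<otimes> w\<close> and
      \<open>s \<otimes> x = d \<otimes> w\<close>, then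
      \<open>c \<otimes> s \<otimes> x = d \<otimes> s \<otimes> y\<close>; so
      \<open>c \<otimes> s\<close> plays the role of \<open>y\<close> divided by
      \<open>w\<close>.\<close>
    have "c \<otimes> s \<in> B" unfolding B_def
    proof (intro CollectI conjI ballI)
      show "c \<otimes> s \<in> carrier R" using c sc by simp
      fix x assume x: "x \<in> I"
      obtain d where d: "d \<in> carrier R" "s \<otimes> x = d \<otimes> w" using gen[OF x] by auto
      have "(c \<otimes> s) \<otimes> x = c \<otimes> (s \<otimes> x)" using c(1) sc Ic[OF x] by (simp add: m_assoc)
      also have "\<dots> = d \<otimes> (c \<otimes> w)" unfolding d(2) using c(1) d(1) wc by (simp add: m_lcomm)
      also have "\<dots> = (d \<otimes> s) \<otimes> y" unfolding c(2)[symmetric] using d(1) sc yc by (simp add: m_assoc)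
      finally show "(c \<otimes> s) \<otimes> x \<in> PIdl y" using d(1) sc PIdl_mem_iff by auto
    qed
    then have "w \<otimes> (c \<otimes> s) \<in> I \<cdot> B" using wI by (intro ideal_prod.prod)
    moreover have "w \<otimes> (c \<otimes> s) = s \<otimes> (c \<otimes> w)" using wc c(1) sc by (simp add: m_ac)
    ultimately have ssy: "s \<otimes> (s \<otimes> y) \<in> I \<cdot> B" using c(2) by simp
    obtain v where v: "v \<in> carrier R - M" "v \<otimes> ?t [^] ord M (PIdl y) \<in> PIdl y"
      using ord_witness[OF M yI y0] by auto
    then obtain d where d: "d \<in> carrier R" "v \<otimes> ?t [^] ord M (PIdl y) = d \<otimes> y" using PIdl_mem_iff by auto
    have "((s \<otimes> s) \<otimes> v) \<otimes> ?t [^] ord M (PIdl y) = (s \<otimes> s) \<otimes> (v \<otimes> ?t [^] ord M (PIdl y))"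
      using sc v(1) t by (simp add: m_assoc)
    also have "\<dots> = d \<otimes> (s \<otimes> (s \<otimes> y))" unfolding d(2) using sc d(1) yc by (simp add: m_ac)
    also have "\<dots> \<in> I \<cdot> B" by (rule ideal.I_l_closed[OF IB(1) ssy d(1)])
    finally show "ord M (I \<cdot> B) \<le> ord M (PIdl y)"
      using prime_mult_notin[OF P prime_mult_notin[OF P s(1) s(1)] v(1)] by (intro ord_le)
  qed
  ultimately have "I \<cdot> B = PIdl y" by auto
  then show ?thesis by (rule invertible_idealI[OF I B yc y(2)])
qed

lemma radical_subset_maximal_iff:
  assumes "maximalideal M R" "ideal I R"
  shows "radical R I \<subseteq> M \<longleftrightarrow> I \<subseteq> M"
  using radical_subset[OF prime_radical_ideal[OF max_prime[OF assms(1)]], of I] radical_is_ideal(2)[OF assms(2)]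
  by auto

text \<open>At each \<open>M\<close> over \<open>I\<close> some element of the radical has order at
  most 1, and it keeps this on a neighbourhood. By compactness finitely many such elements suffice.
  Adjoined to the generators of \<open>I\<close>, they give an ideal with the orders of the radical
  everywhere, since at the other maximal ideals both orders are 0.\<close>

lemma fg_radical:
  assumes fg: "fg_ideal R I" and I0: "I \<noteq> {\<zero>}"
  shows "fg_ideal R (radical R I)"
proof -
  obtain S where S: "finite S" "S \<subseteq> carrier R" "I = genideal R S" using fg by (auto simp: fg_ideal_def)
  have I: "ideal I R" using S genideal_ideal by simp
  let ?Q = "radical R I"
  note Q = radical_is_ideal(1)[OF I] and Qrad = radical_radical_ideal[OF I]
  have Q0: "?Q \<noteq> {\<zero>}" using radical_is_ideal(2)[OF I] I0 ideal_nonzero_iff[OF I] by auto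
  have Qc: "x \<in> carrier R" if "x \<in> ?Q" for x using that ideal_subset_carrier[OF Q] by auto
  define V where "V x = {M. maximalideal M R \<and> ord M (PIdl x) \<le> 1}" for x
  let ?K = "{M. maximalideal M R \<and> 1 \<le> ord M I}"
  have "?K \<subseteq> \<Union>(V ` (?Q - {\<zero>}))"
  proof
    fix M assume "M \<in> ?K"
    then have M: "maximalideal M R" by simp
    obtain x where x: "x \<in> ?Q" "x \<noteq> \<zero>" "ord M (PIdl x) = ord M ?Q" using ord_attained[OF M Q Q0] by auto
    then have "ord M (PIdl x) \<le> 1" using ord_radical_le_1[OF M Qrad Q0] by simp
    then have "M \<in> V x" using M by (simp add: V_def)
    then show "M \<in> \<Union>(V ` (?Q - {\<zero>}))" using x(1,2) by blast
  qed
  moreover have "openin (Max_inv R) U" if "U \<in> V ` (?Q - {\<zero>})" for U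
    using that openin_ord_le_principal[of _ 1] Qc by (auto simp: V_def)
  ultimately have "\<exists>\<F>. finite \<F> \<and> \<F> \<subseteq> V ` (?Q - {\<zero>}) \<and> ?K \<subseteq> \<Union>\<F>"
    by (intro compactinD[OF compactin_ord_ge[OF I I0]]) auto
  then obtain \<F> where \<F>: "finite \<F>" "\<F> \<subseteq> V ` (?Q - {\<zero>})" "?K \<subseteq> \<Union>\<F>" by auto
  obtain F where F: "finite F" "F \<subseteq> ?Q - {\<zero>}" "\<F> = V ` F" using finite_subset_image[OF \<F>(1,2)] by auto
  let ?S = "S \<union> F"
  have Sc: "?S \<subseteq> carrier R" using S(2) F(2) Qc by auto
  have SQ: "?S \<subseteq> ?Q" using genideal_self[OF S(2)] S(3) radical_is_ideal(2)[OF I] F(2) by auto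
  define J where "J = genideal R ?S"
  have J: "ideal J R" unfolding J_def by (rule genideal_ideal[OF Sc])
  have SJ: "?S \<subseteq> J" unfolding J_def by (rule genideal_self[OF Sc])
  have JQ: "J \<subseteq> ?Q" unfolding J_def by (rule genideal_minimal[OF Q SQ])
  have IJ: "I \<subseteq> J" using SJ genideal_minimal[OF J, of S] S(3) by auto
  have J0: "J \<noteq> {\<zero>}" using IJ I0 ideal_nonzero_iff[OF I] by auto
  have "?Q \<subseteq> J"
  proof (subst ideal_subset_iff_ord[OF Q Q0 J J0], intro allI impI)
    fix M assume M: "maximalideal M R"
    show "ord M J \<le> ord M ?Q"
    proof (cases "I \<subseteq> M")
      case False
      then have "ord M J = 0" using IJ ord_eq_0_iff[OF M J J0] by auto
      then show ?thesis by simp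
    next
      case True
      then have "M \<in> ?K" using M ord_eq_0_iff[OF M I I0] by auto
      then obtain x where x: "x \<in> F" "ord M (PIdl x) \<le> 1" using \<F>(3) F(3) by (auto simp: V_def)
      have "ord M J \<le> ord M (PIdl x)"
        using x(1) SJ F(2) by (intro ord_le_principal[OF M J]) auto
      moreover have "ord M ?Q = 1"
        using ord_radical_ideal[OF M Qrad Q0] radical_subset_maximal_iff[OF M I] True by simp
      ultimately show ?thesis using x(2) by simp
    qed
  qed
  then have "?Q = J" using JQ by auto
  then show ?thesis unfolding fg_ideal_def J_def using S(1) F(1) Sc by (intro exI[of _ ?S]) auto
qed

section \<open>The order function as a lattice isomorphism\<close>

lemma topspace_Max_inv_nonempty: "\<exists>M. M \<in> topspace (Max_inv R)"
proof -
  obtain M where "maximalideal M R"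
    using maximalideal_above[OF zeroideal] carrier_nonzero by metis
  then show ?thesis by (auto simp: topspace_Max_inv)
qed

lemma ideal_lattice_iso: "mult_lattice_iso (ideal_lattice R) (Ub (Max_inv R)) \<noteq> {}"
proof -
  let ?X = "topspace (Max_inv R)" and ?L = "ideal_lattice R" and ?U = "Ub (Max_inv R)"
  \<comment> \<open>The zero ideal has no order and goes to the bottom element.\<close>
  define h where "h I = (if I = {\<zero>} then (\<lambda>M\<in>?X. \<infinity>) else (\<lambda>M\<in>?X. enat (ord M I)))" for I
  have h0: "h {\<zero>} = (\<lambda>M\<in>?X. \<infinity>)" by (simp add: h_def)
  have h1: "h I = (\<lambda>M\<in>?X. enat (ord M I))" if "I \<noteq> {\<zero>}" for I using that by (simp add: h_def)
  have max: "maximalideal M R" if "M \<in> ?X" for M using that by (simp add: topspace_Max_inv)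
  have cl: "h I \<in> carrier ?U" if I: "ideal I R" for I
  proof (cases "I = {\<zero>}")
    case False
    have "h I = (\<lambda>x\<in>?X. enat ((\<lambda>M\<in>?X. ord M I) x))" using h1[OF False] by auto
    then have "h I \<in> (\<lambda>f. \<lambda>x\<in>?X. enat (f x)) ` U_carrier (Max_inv R)"
      using ord_U_carrier[OF I False] by (rule image_eqI)
    then show ?thesis by (simp add: Ub_def)
  qed (simp add: h0 Ub_def)
  have mult: "h (I \<cdot> J) = (\<lambda>x\<in>?X. h I x + h J x)" if I: "ideal I R" and J: "ideal J R" for I J
  proof (cases "I = {\<zero>} \<or> J = {\<zero>}")
    case True
    then have "I \<cdot> J = {\<zero>}"
      using ideal_prod_zero[OF I] ideal_prod_zero[OF J] ideal_prod_commute[OF I J] by auto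
    then show ?thesis using True by (auto simp: h0 fun_eq_iff)
  next
    case False
    then show ?thesis using ideal_prod_nonzero[OF I _ J] ord_prod[OF max I _ J] by (auto simp: h1 fun_eq_iff)
  qed
  have le: "I \<subseteq> J \<longleftrightarrow> (\<forall>x\<in>?X. h J x \<le> h I x)" if I: "ideal I R" and J: "ideal J R" for I J
  proof -
    consider "I = {\<zero>}" | "I \<noteq> {\<zero>}" "J = {\<zero>}" | "I \<noteq> {\<zero>}" "J \<noteq> {\<zero>}" by auto
    then show ?thesis
    proof cases
      case 1
      then show ?thesis using ideal_zero_mem[OF J] by (auto simp: h0)
    next
      case 2
      then have "\<not> I \<subseteq> J" using ideal_zero_mem[OF I] by auto
      \<comment> \<open>A maximal ideal must exist for the infinite value to exceed a finite one
        somewhere.\<close>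
      then show ?thesis using 2 topspace_Max_inv_nonempty by (auto simp: h0 h1)
    next
      case 3
      then show ?thesis using ideal_subset_iff_ord[OF I _ J] by (auto simp: h1 topspace_Max_inv)
    qed
  qed
  have one: "h (carrier R) = (\<lambda>x\<in>?X. 0)"
    using ord_carrier[OF max] by (auto simp: h1[OF carrier_nonzero] fun_eq_iff zero_enat_def)
  have inj: "inj_on h {I. ideal I R}"
  proof (rule inj_onI)
    fix I J assume "I \<in> {I. ideal I R}" "J \<in> {I. ideal I R}" "h I = h J"
    then show "I = J" using le[of I J] le[of J I] by auto
  qed
  have surj: "g \<in> h ` {I. ideal I R}" if g: "g \<in> carrier ?U" for g
  proof -
    consider "g = (\<lambda>x\<in>?X. \<infinity>)" | f where "f \<in> U_carrier (Max_inv R)" "g = (\<lambda>x\<in>?X. enat (f x))"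
      using g by (auto simp: Ub_def)
    then show ?thesis
    proof cases
      case 1
      then show ?thesis using zeroideal by (intro image_eqI[of _ _ "{\<zero>}"]) (auto simp: h0)
    next
      case 2
      \<comment> \<open>Surjectivity on finite functions comes from the chain construction: its
        product is a nonzero ideal with the prescribed orders.\<close>
      obtain Js where Js: "\<forall>J\<in>set Js. radical_ideal R J \<and> J \<noteq> {\<zero>}"
        "\<forall>M. maximalideal M R \<longrightarrow> ord M (ideal_list_prod R Js) = f M"
        using chain_with_orders[OF 2(1)] by auto
      have JI: "\<forall>J\<in>set Js. ideal J R \<and> J \<noteq> {\<zero>}" using Js(1) radical_ideal_ideal by auto
      have "h (ideal_list_prod R Js) = g"
        using Js(2) max by (auto simp: h1[OF ideal_list_prod_nonzero[OF JI]] 2(2) fun_eq_iff)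
      moreover have "ideal (ideal_list_prod R Js) R" using JI by (intro ideal_list_prod_ideal) auto
      ultimately show ?thesis by auto
    qed
  qed
  have "bij_betw h (carrier ?L) (carrier ?U)"
    unfolding bij_betw_def using inj cl surj by (auto simp: ideal_lattice_def)
  moreover have "h \<in> hom ?L ?U"
    using cl mult by (auto simp: hom_def ideal_lattice_def Ub_def)
  ultimately have "h \<in> mult_lattice_iso ?L ?U"
    using one le by (auto simp: mult_lattice_iso_def iso_def ideal_lattice_def Ub_def)
  then show ?thesis by auto
qed

end

subsection \<open>The equivalences\<close>

text \<open>Among the positive levels of the characteristic function only level 1 can be nonempty,
  and there it gives the level set of \<open>f\<close> at \<open>k\<close>.\<close>

lemma U_carrier_threshold:
  assumes f: "f \<in> U_carrier X" and k: "k \<ge> 1"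
  shows "(\<lambda>x\<in>topspace X. if k \<le> f x then 1 else 0) \<in> U_carrier X"
proof -
  have "{x \<in> topspace X. j \<le> (\<lambda>x\<in>topspace X. if k \<le> f x then 1 else 0) x} =
      (if j = 1 then {x \<in> topspace X. k \<le> f x} else {})" if "j \<ge> 1" for j :: nat
    using that by auto
  then show ?thesis using f k by (auto simp: U_carrier_def)
qed

section \<open>Krull dimension, and the consequences of (5) and (6)\<close>

context domain
begin

lemma krull_dim_le_1_iff:
  "krull_dim R \<le> 1 \<longleftrightarrow> (\<forall>P. primeideal P R \<and> P \<noteq> {\<zero>} \<longrightarrow> maximalideal P R)"
proof
  assume dim: "krull_dim R \<le> 1"
  show "\<forall>P. primeideal P R \<and> P \<noteq> {\<zero>} \<longrightarrow> maximalideal P R"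
  proof (intro allI impI, elim conjE)
    fix P assume P: "primeideal P R" "P \<noteq> {\<zero>}"
    note PI = primeideal.axioms(1)[OF P(1)]
    have "P \<noteq> carrier R" using prime_one_notin[OF P(1)] by auto
    then obtain M where M: "maximalideal M R" "P \<subseteq> M" by (rule maximalideal_above[OF PI])
    have "P = M"
    proof (rule ccontr)
      assume "P \<noteq> M"
      \<comment> \<open>The chain \<open>{\<zero>} \<subset> P \<subset> M\<close> has length 2 and
        contradicts the bound on the dimension.\<close>
      define C where "C i = (if i = 0 then {\<zero>} else if i = 1 then P else M)" for i :: nat
      have "\<forall>i\<le>2. primeideal (C i) R"
        using zeroprimeideal P(1) maximalideal_prime[OF M(1)] by (auto simp: C_def)
      moreover have "{\<zero>} \<subset> P" "P \<subset> M" using P(2) M(2) \<open>P \<noteq> M\<close> ideal_zero_mem[OF PI] by auto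
      then have "\<forall>i<2. C i \<subset> C (Suc i)" by (auto simp: C_def less_2_cases_iff)
      ultimately have "enat 2 \<le> krull_dim R"
        unfolding krull_dim_def by (intro Sup_upper) auto
      then have "enat 2 \<le> 1" using dim by (rule order_trans)
      then show False by (simp add: one_enat_def)
    qed
    then show "maximalideal P R" using M by simp
  qed
next
  assume max: "\<forall>P. primeideal P R \<and> P \<noteq> {\<zero>} \<longrightarrow> maximalideal P R"
  show "krull_dim R \<le> 1" unfolding krull_dim_def
  proof (rule Sup_least)
    fix e assume "e \<in> {enat n | n. \<exists>P :: nat \<Rightarrow> 'a set.
       (\<forall>i \<le> n. primeideal (P i) R) \<and> (\<forall>i < n. P i \<subset> P (Suc i))}"
    then obtain n and C :: "nat \<Rightarrow> 'a set" where e: "e = enat n"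
      and C: "\<forall>i\<le>n. primeideal (C i) R" "\<forall>i<n. C i \<subset> C (Suc i)" by auto
    have "n \<le> 1"
    proof (rule ccontr)
      assume "\<not> n \<le> 1"
      then have C2: "primeideal (C 0) R" "primeideal (C 1) R" "primeideal (C 2) R" "C 0 \<subset> C 1" "C 1 \<subset> C 2"
        using C by (auto simp: numeral_2_eq_2)
      \<comment> \<open>\<open>C 1\<close> is nonzero since it strictly contains \<open>C 0\<close>;
        being maximal, it leaves no room for the prime \<open>C 2\<close>.\<close>
      have "C 1 \<noteq> {\<zero>}" using C2(4) ideal_zero_mem[OF primeideal.axioms(1)[OF C2(1)]] by auto
      then have "maximalideal (C 1) R" using max C2(2) by simp
      then have "C 2 = C 1 \<or> C 2 = carrier R"
        using C2(5) primeideal.axioms(1)[OF C2(3)] ideal_subset_carrier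
        by (intro maximalideal.I_maximal) auto
      then show False using C2(5) primeideal.I_notcarr[OF C2(3)] by auto
    qed
    then show "e \<le> 1" by (simp add: e one_enat_def)
  qed
qed

lemma fg_PIdl: "x \<in> carrier R \<Longrightarrow> fg_ideal R (PIdl x)"
  unfolding fg_ideal_def using cgenideal_eq_genideal by (intro exI[of _ "{x}"]) auto

lemma fg_add:
  assumes "fg_ideal R I" "fg_ideal R J" shows "fg_ideal R (I <+> J)"
proof -
  obtain S T where S: "finite S" "S \<subseteq> carrier R" "I = genideal R S"
    and T: "finite T" "T \<subseteq> carrier R" "J = genideal R T"
    using assms unfolding fg_ideal_def by auto
  have c: "S \<union> T \<subseteq> carrier R" using S T by simp
  have I: "ideal I R" and J: "ideal J R" using S T genideal_ideal by auto
  have "I <+> J = genideal R (S \<union> T)"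
  proof
    have "S \<subseteq> genideal R (S \<union> T)" "T \<subseteq> genideal R (S \<union> T)" using genideal_self[OF c] by auto
    then have "I \<subseteq> genideal R (S \<union> T)" "J \<subseteq> genideal R (S \<union> T)"
      unfolding S(3) T(3) by (auto simp only: genideal_minimal[OF genideal_ideal[OF c]])
    then show "I <+> J \<subseteq> genideal R (S \<union> T)"
      using ideal_add_mem[OF genideal_ideal[OF c]] by (auto simp: add_ideal_mem_iff subset_iff)
    have "S \<union> T \<subseteq> I <+> J"
      using add_ideal_subset[OF I J] genideal_self[OF S(2)] genideal_self[OF T(2)] S(3) T(3) by auto
    then show "genideal R (S \<union> T) \<subseteq> I <+> J" by (rule genideal_minimal[OF add_ideals[OF I J]])
  qed
  then show ?thesis unfolding fg_ideal_def using S T c by (intro exI[of _ "S \<union> T"]) auto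
qed

text \<open>If \<open>P \<subset> M\<close> with \<open>y \<in> P\<close> and \<open>a \<in> M - P\<close>, write \<open>\<surd>(y) = KB\<close> with \<open>K = \<surd>(y, a)\<close>. Then
  \<open>L = \<surd>(K + B)\<close> is an invertible ideal inside \<open>M\<close> whose square divides the radical ideal \<open>\<surd>(y)\<close>.\<close>

lemma radical_invertible_imp_prime_maximal:
  assumes inv: "\<And>I. fg_ideal R I \<Longrightarrow> I \<noteq> {\<zero>} \<Longrightarrow> invertible_ideal R (radical R I)"
    and P: "primeideal P R" "P \<noteq> {\<zero>}"
  shows "maximalideal P R" "\<exists>J. J \<subseteq> P \<and> invertible_ideal R J \<and> radical_ideal R J"
proof -
  note PI = primeideal.axioms(1)[OF P(1)]
  obtain y where y: "y \<in> P" "y \<noteq> \<zero>" using P(2) ideal_zero_mem[OF PI] by auto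
  have yc: "y \<in> carrier R" using y ideal_subset_carrier[OF PI] by auto
  note yI = cgenideal_ideal[OF yc]
  define J where "J = radical R (PIdl y)"
  have y0: "PIdl y \<noteq> {\<zero>}" using cgenideal_self[OF yc] y(2) by auto
  have J: "invertible_ideal R J" "radical_ideal R J"
    unfolding J_def using inv[OF fg_PIdl[OF yc] y0] radical_radical_ideal[OF yI] by auto
  have JP: "J \<subseteq> P" unfolding J_def
    by (rule radical_subset[OF prime_radical_ideal[OF P(1)] cgenideal_minimal[OF PI y(1)]])
  show "\<exists>J. J \<subseteq> P \<and> invertible_ideal R J \<and> radical_ideal R J" using J JP by auto
  have "P \<noteq> carrier R" using prime_one_notin[OF P(1)] by auto
  then obtain M where M: "maximalideal M R" "P \<subseteq> M" by (rule maximalideal_above[OF PI])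
  note MI = maximalideal.axioms(1)[OF M(1)] and MP = maximalideal_prime[OF M(1)]
  have "P = M"
  proof (rule ccontr)
    assume "P \<noteq> M"
    then obtain a where a: "a \<in> M" "a \<notin> P" using M(2) by auto
    have ac: "a \<in> carrier R" using a ideal_subset_carrier[OF MI] by auto
    define A where "A = PIdl y <+> PIdl a"
    note A = add_PIdl_mem[OF yI ac, folded A_def]
    have yA: "y \<in> A" using A(2) cgenideal_self[OF yc] by auto
    have A0: "A \<noteq> {\<zero>}" using yA y(2) by auto
    have Afg: "fg_ideal R A" unfolding A_def by (rule fg_add[OF fg_PIdl[OF yc] fg_PIdl[OF ac]])
    define K where "K = radical R A"
    have K: "invertible_ideal R K" unfolding K_def by (rule inv[OF Afg A0])
    note Krad = radical_radical_ideal[OF A(1), folded K_def] and AK = radical_is_ideal(2)[OF A(1), folded K_def]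
    note KI = invertible_ideal_ideal[OF K]
    have "PIdl y \<subseteq> K" by (rule cgenideal_minimal[OF KI]) (use yA AK in auto)
    then have "J \<subseteq> K" unfolding J_def by (rule radical_subset[OF Krad])
    then obtain B where B: "ideal B R" "J = K \<cdot> B"
      using invertible_divides[OF K radical_ideal_ideal[OF J(2)]] by auto
    have invB: "invertible_ideal R B" using invertible_prodD(2)[OF KI B(1)] J(1) B(2) by simp
    \<comment> \<open>\<open>a \<in> K\<close> keeps \<open>K\<close> out of \<open>P\<close>, so
      the prime \<open>P\<close> contains \<open>B\<close>; hence both factors of \<open>J\<close>
      lie in \<open>M\<close>, which makes \<open>L\<close> proper.\<close>
    have "\<not> K \<subseteq> P" using a(2) A(3) AK by auto
    then have BP: "B \<subseteq> P" using primeideal_divides_ideal_prod[OF P(1) KI B(1)] JP B(2) by auto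
    have "A \<subseteq> M"
    proof
      fix x assume "x \<in> A"
      then obtain i j where ij: "i \<in> PIdl y" "j \<in> PIdl a" "x = i \<oplus> j" by (auto simp: A_def add_ideal_mem_iff)
      have "y \<in> M" using y(1) M(2) by auto
      then have "i \<in> M" "j \<in> M" using cgenideal_minimal[OF MI] ij(1,2) a(1) by auto
      then show "x \<in> M" using ideal_add_mem[OF MI] ij(3) by simp
    qed
    then have KM: "K \<subseteq> M" unfolding K_def by (rule radical_subset[OF prime_radical_ideal[OF MP]])
    define D where "D = K <+> B"
    have D: "ideal D R" "K \<subseteq> D" "B \<subseteq> D"
      unfolding D_def using add_ideals[OF KI B(1)] add_ideal_subset[OF KI B(1)] by auto
    have Dfg: "fg_ideal R D" unfolding D_def by (rule fg_add[OF invertible_fg[OF K] invertible_fg[OF invB]])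
    have D0: "D \<noteq> {\<zero>}" using D(2) AK yA y(2) by auto
    have DM: "D \<subseteq> M" unfolding D_def
      using KM BP M(2) ideal_add_mem[OF MI] by (auto simp: add_ideal_mem_iff subset_iff)
    define L where "L = radical R D"
    have L: "invertible_ideal R L" unfolding L_def by (rule inv[OF Dfg D0])
    note LI = invertible_ideal_ideal[OF L]
    have DL: "D \<subseteq> L" unfolding L_def by (rule radical_is_ideal(2)[OF D(1)])
    have LM: "L \<subseteq> M" unfolding L_def by (rule radical_subset[OF prime_radical_ideal[OF MP] DM])
    obtain K' where K': "ideal K' R" "K = L \<cdot> K'" using invertible_divides[OF L KI] D(2) DL by auto
    obtain B' where B': "ideal B' R" "B = L \<cdot> B'" using invertible_divides[OF L B(1)] D(3) DL by auto
    have KB': "ideal (K' \<cdot> B') R" by (rule ideal_prod_is_ideal[OF K'(1) B'(1)])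
    have LB': "ideal (L \<cdot> B') R" by (rule ideal_prod_is_ideal[OF LI B'(1)])
    have "J = L \<cdot> (K' \<cdot> (L \<cdot> B'))"
      unfolding B(2) K'(2) B'(2) by (rule ideal_prod_assoc[OF LI K'(1) LB'])
    also have "K' \<cdot> (L \<cdot> B') = (K' \<cdot> L) \<cdot> B'" using ideal_prod_assoc[OF K'(1) LI B'(1)] by simp
    also have "K' \<cdot> L = L \<cdot> K'" by (rule ideal_prod_commute[OF K'(1) LI])
    also have "(L \<cdot> K') \<cdot> B' = L \<cdot> (K' \<cdot> B')" by (rule ideal_prod_assoc[OF LI K'(1) B'(1)])
    finally have "L = carrier R" by (rule invertible_radical_squarefree[OF J LI KB'])
    then show False using LM maximal_one_notin[OF M(1)] by auto
  qed
  then show "maximalideal P R" using M by simp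
qed

lemma zero_radical: "radical_ideal R {\<zero>}"
  by (rule prime_radical_ideal[OF zeroprimeideal])

text \<open>The level sets of the finite function \<open>h I\<close> give characteristic functions,
  whose preimages \<open>A k\<close> multiply to \<open>I\<close>. They are radical because a
  function with values 0 and 1 that is at most twice an \<open>enat\<close>-valued function is at
  most that function itself.\<close>

lemma lattice_iso_imp_radical_factorization:
  assumes h: "h \<in> mult_lattice_iso (ideal_lattice R) (Ub (Max_inv R))" and I: "ideal I R"
  shows "\<exists>Js. (\<forall>J\<in>set Js. radical_ideal R J) \<and> I = ideal_list_prod R Js"
proof (cases "I = {\<zero>}")
  case True
  have "I = ideal_list_prod R [{\<zero>}]" using True zeroideal ideal_prod_carrier(1) by simp
  then show ?thesis using zero_radical by (intro exI[of _ "[{\<zero>}]"]) simp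
next
  case False
  let ?X = "topspace (Max_inv R)" and ?U = "Ub (Max_inv R)"
  have hmult: "h (A \<cdot> B) = (\<lambda>x\<in>?X. h A x + h B x)" if "ideal A R" "ideal B R" for A B
    using h that by (auto simp: mult_lattice_iso_def iso_def hom_def ideal_lattice_def Ub_def)
  have hone: "h (carrier R) = (\<lambda>x\<in>?X. 0)"
    using h by (auto simp: mult_lattice_iso_def ideal_lattice_def Ub_def)
  have hle: "A \<subseteq> B \<longleftrightarrow> (\<forall>x\<in>?X. h B x \<le> h A x)" if "ideal A R" "ideal B R" for A B
    using h that by (simp add: mult_lattice_iso_def ideal_lattice_def Ub_def)
  have bij: "bij_betw h {A. ideal A R} (carrier ?U)"
    using h by (simp add: mult_lattice_iso_def iso_def ideal_lattice_def)
  have hcar: "h A \<in> carrier ?U" if "ideal A R" for A using bij that by (auto simp: bij_betw_def)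
  have hinj: "A = B" if "h A = h B" "ideal A R" "ideal B R" for A B
    using bij that by (auto simp: bij_betw_def inj_on_def)
  have hsurj: "\<exists>A. ideal A R \<and> h A = g" if "g \<in> carrier ?U" for g
  proof -
    have "g \<in> h ` {A. ideal A R}" using bij that by (simp add: bij_betw_def)
    then show ?thesis by auto
  qed
  \<comment> \<open>An order isomorphism matches the bottom elements, so the function of a nonzero
    \<open>I\<close> comes from \<open>U_carrier\<close>.\<close>
  have "(\<lambda>x\<in>?X. \<infinity>) \<in> carrier ?U" by (simp add: Ub_def)
  then obtain Z where Z: "ideal Z R" "h Z = (\<lambda>x\<in>?X. \<infinity>)" using hsurj by auto
  have "Z \<subseteq> {\<zero>}" using hle[OF Z(1) zeroideal] Z(2) by simp
  then have "Z = {\<zero>}" using ideal_zero_mem[OF Z(1)] by auto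
  then have "h I \<noteq> (\<lambda>x\<in>?X. \<infinity>)" using hinj[of I Z] Z I False by auto
  then obtain f where f: "f \<in> U_carrier (Max_inv R)" "h I = (\<lambda>x\<in>?X. enat (f x))"
    using hcar[OF I] by (auto simp: Ub_def)
  obtain n where n: "\<forall>x\<in>?X. f x \<le> n" using U_carrier_bounded[OF Hausdorff_Max_inv f(1)] by auto
  define g where "g k = (\<lambda>x\<in>?X. enat (if k \<le> f x then 1 else 0))" for k
  \<comment> \<open>At level 0 the function \<open>g k\<close> is constantly 1, and its support need
    not be compact; the guard \<open>k \<ge> 1\<close> still lets \<open>A\<close> be chosen as a
    total function.\<close>
  have "\<exists>A. k \<ge> 1 \<longrightarrow> ideal A R \<and> h A = g k" for k
  proof (cases "k \<ge> 1")
    case True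
    have "g k = (\<lambda>x\<in>?X. enat ((\<lambda>x\<in>?X. if k \<le> f x then 1 else 0) x))" by (auto simp: g_def)
    then have "g k \<in> (\<lambda>f. \<lambda>x\<in>?X. enat (f x)) ` U_carrier (Max_inv R)"
      using U_carrier_threshold[OF f(1) True] by (rule image_eqI)
    then have "g k \<in> carrier ?U" by (simp add: Ub_def)
    then show ?thesis using hsurj by auto
  qed auto
  then obtain A where A: "\<And>k. k \<ge> 1 \<Longrightarrow> ideal (A k) R \<and> h (A k) = g k" by metis
  have rad: "radical_ideal R (A k)" if k: "k \<ge> 1" for k
  proof (rule radical_idealI_square)
    show AI: "ideal (A k) R" using A[OF k] by simp
    fix x assume x: "x \<in> carrier R" "x \<otimes> x \<in> A k"
    note xI = cgenideal_ideal[OF x(1)]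
    have "(PIdl x) \<cdot> (PIdl x) \<subseteq> A k"
    proof (rule ideal_prod_subset[OF AI])
      fix i j assume "i \<in> PIdl x" "j \<in> PIdl x"
      then obtain c d where cd: "c \<in> carrier R" "d \<in> carrier R" "i = c \<otimes> x" "j = d \<otimes> x"
        by (auto simp: PIdl_mem_iff)
      have "i \<otimes> j = (c \<otimes> d) \<otimes> (x \<otimes> x)" using cd x(1) by (simp add: m_ac)
      then show "i \<otimes> j \<in> A k" using ideal.I_l_closed[OF AI x(2), of "c \<otimes> d"] cd(1,2) by simp
    qed
    \<comment> \<open>With the order reversed by \<open>h\<close>, membership of
      \<open>x \<otimes> x\<close> in \<open>A k\<close> says that \<open>h (A k)\<close> is at most
      twice \<open>h (PIdl x)\<close>.\<close>
    then have le: "\<forall>u\<in>?X. h (A k) u \<le> h (PIdl x) u + h (PIdl x) u"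
      using hle[OF ideal_prod_is_ideal[OF xI xI] AI] hmult[OF xI xI] by simp
    have "h (A k) u \<le> h (PIdl x) u" if u: "u \<in> ?X" for u
    proof (cases "k \<le> f u")
      case True
      then have "h (A k) u = 1" using A[OF k] u by (simp add: g_def one_enat_def)
      then have "h (PIdl x) u \<noteq> 0" using le u by auto
      then show ?thesis using \<open>h (A k) u = 1\<close> by (simp add: ileI1 one_eSuc)
    next
      case False
      then show ?thesis using A[OF k] u by (simp add: g_def zero_enat_def[symmetric])
    qed
    then have "PIdl x \<subseteq> A k" using hle[OF xI AI] by simp
    then show "x \<in> A k" using cgenideal_self[OF x(1)] by auto
  qed
  have hprod: "h (ideal_list_prod R Js) = (\<lambda>x\<in>?X. \<Sum>J\<leftarrow>Js. h J x)"
    if "\<forall>J\<in>set Js. ideal J R" for Js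
    using that
  proof (induction Js)
    case Nil
    then show ?case using hone by simp
  next
    case (Cons J Js)
    then show ?case using hmult[of J "ideal_list_prod R Js"] ideal_list_prod_ideal[of Js] by (auto simp: fun_eq_iff)
  qed
  define Js where "Js = map A [1..<Suc n]"
  have Js: "\<forall>J\<in>set Js. radical_ideal R J" using rad by (auto simp: Js_def)
  then have JI: "\<forall>J\<in>set Js. ideal J R" using radical_ideal_ideal by auto
  have enat_sum: "(\<Sum>k\<leftarrow>ks. enat (q k)) = enat (\<Sum>k\<leftarrow>ks. q k)" for ks :: "nat list" and q
    by (induction ks) (auto simp: zero_enat_def)
  have "(\<Sum>J\<leftarrow>Js. h J x) = enat (f x)" if x: "x \<in> ?X" for x
  proof -
    have "(\<Sum>J\<leftarrow>Js. h J x) = (\<Sum>k\<leftarrow>[1..<Suc n]. h (A k) x)" by (simp add: Js_def comp_def del: upt_Suc)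
    also have "\<dots> = (\<Sum>k\<leftarrow>[1..<Suc n]. enat (if k \<le> f x then 1 else 0))"
      using A x by (intro arg_cong[where f = sum_list] map_cong) (auto simp: g_def)
    also have "\<dots> = enat (\<Sum>k\<leftarrow>[1..<Suc n]. if k \<le> f x then 1 else 0)" by (rule enat_sum)
    also have "\<dots> = enat (f x)" unfolding sum_list_threshold using n x by simp
    finally show ?thesis .
  qed
  then have "h (ideal_list_prod R Js) = h I" unfolding hprod[OF JI] f(2) by (auto simp: fun_eq_iff)
  then have "I = ideal_list_prod R Js" using hinj[of "ideal_list_prod R Js" I] ideal_list_prod_ideal[OF JI] I by simp
  then show ?thesis using Js by auto
qed

end

lemma (in field) ideal_cases:
  assumes "ideal I R" shows "I = {\<zero>} \<or> I = carrier R"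
  using assms all_ideals by auto

lemma (in field) radical_carrier: "radical R (carrier R) = carrier R"
  by (auto simp: radical_def intro!: exI[of _ "1::nat"])

lemma (in domain) invertible_carrier: "invertible_ideal R (carrier R)"
  using invertible_PIdl[of \<one>] genideal_one cgenideal_eq_genideal[of \<one>] by simp

lemma (in domain) zero_list_prod: "{\<zero>} = ideal_list_prod R [{\<zero>}]"
  using zeroideal ideal_prod_carrier(1) by simp

lemma (in domain) fg_zero_radical: "fg_ideal R (radical R {\<zero>})"
  using zero_radical genideal_zero unfolding radical_ideal_def fg_ideal_def
  by (intro exI[of _ "{\<zero>}"]) simp

lemma (in field) proper_radical_chain_ex1:
  assumes "ideal I R" "I \<noteq> {\<zero>}"
  shows "\<exists>!Js. (\<forall>J\<in>set Js. radical_ideal R J \<and> J \<noteq> carrier R) \<and> sorted_wrt (\<subseteq>) Js \<and>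
    I = ideal_list_prod R Js"
proof (rule ex1I[of _ "[]"])
  have I: "I = carrier R" using ideal_cases assms by auto
  then show "(\<forall>J\<in>set []. radical_ideal R J \<and> J \<noteq> carrier R) \<and> sorted_wrt (\<subseteq>) [] \<and>
    I = ideal_list_prod R []" by simp
  fix Js assume Js: "(\<forall>J\<in>set Js. radical_ideal R J \<and> J \<noteq> carrier R) \<and> sorted_wrt (\<subseteq>) Js \<and>
    I = ideal_list_prod R Js"
  then have "\<forall>J\<in>set Js. ideal J R \<and> J \<noteq> carrier R" using radical_ideal_ideal by auto
  then show "Js = []" using proper_list_prod[of Js] Js I by auto
qed

theorem corollary7p7:
  fixes R :: "('a, 'm) ring_scheme" (structure)
  assumes "domain R"
  shows
    "let
      C1 = (\<forall>I. ideal I R \<and> I \<noteq> carrier R \<longrightarrow>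
              (\<exists>Js. (\<forall>J \<in> set Js. radical_ideal R J) \<and> I = ideal_list_prod R Js));
      C2 = ((\<forall>I. ideal I R \<longrightarrow>
              (\<exists>Js. (\<forall>J \<in> set Js. radical_ideal R J) \<and> sorted_wrt (\<subseteq>) Js \<and>
                    I = ideal_list_prod R Js)) \<and>
            (\<forall>I. ideal I R \<and> I \<noteq> {\<zero>} \<longrightarrow>
              (\<exists>!Js. (\<forall>J \<in> set Js. radical_ideal R J \<and> J \<noteq> carrier R) \<and> sorted_wrt (\<subseteq>) Js \<and>
                    I = ideal_list_prod R Js)));
      C3 = (krull_dim R \<le> 1 \<and>
            (\<forall>I. invertible_ideal R I \<longrightarrow>
              (\<exists>Js. (\<forall>J \<in> set Js. radical_ideal R J) \<and> I = ideal_list_prod R Js)));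
      C4 = (\<forall>P. primeideal P R \<and> P \<noteq> {\<zero>} \<longrightarrow>
              maximalideal P R \<and> (\<exists>J. J \<subseteq> P \<and> invertible_ideal R J \<and> radical_ideal R J));
      C5 = (\<forall>I. fg_ideal R I \<and> I \<noteq> {\<zero>} \<longrightarrow> invertible_ideal R (radical R I));
      C6 = (mult_lattice_iso (ideal_lattice R) (Ub (Max_inv R)) \<noteq> {});
      C7 = (prufer_domain R \<and> (\<forall>I. fg_ideal R I \<longrightarrow> fg_ideal R (radical R I)))
    in
      (C1 \<longleftrightarrow> C2) \<and> (C1 \<longleftrightarrow> C3) \<and> (C1 \<longleftrightarrow> C4) \<and> (C1 \<longleftrightarrow> C5) \<and> (C1 \<longleftrightarrow> C7) \<and>
      (\<not> field R \<longrightarrow> (C1 \<longleftrightarrow> C6))"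
    (is "let C1 = ?C1; C2 = ?C2; C3 = ?C3; C4 = ?C4; C5 = ?C5; C6 = ?C6; C7 = ?C7 in
      ?equivalences C1 C2 C3 C4 C5 C6 C7")

proof -
  interpret domain R by fact
  have C1_C4: ?C4 if ?C1
  proof -
    interpret radical_factorization_domain R by unfold_locales (use that in simp)
    show ?thesis
    proof (intro allI impI, elim conjE)
      fix P assume P: "primeideal P R" "P \<noteq> {\<zero>}"
      then obtain y where "y \<in> P" "y \<noteq> \<zero>" using ideal_zero_mem[OF primeideal.axioms(1)[OF P(1)]] by auto
      then obtain K where "invertible_ideal R K" "radical_ideal R K" "K \<subseteq> P"
        using invertible_radical_below[OF P(1)] by auto
      then show "maximalideal P R \<and> (\<exists>J. J \<subseteq> P \<and> invertible_ideal R J \<and> radical_ideal R J)"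
        using nonzero_prime_maximal[OF P] by auto
    qed
  qed
  have C1_C3: ?C3 if C1: ?C1
  proof
    show "krull_dim R \<le> 1" using C1_C4[OF C1] by (subst krull_dim_le_1_iff) auto
    show "\<forall>I. invertible_ideal R I \<longrightarrow>
        (\<exists>Js. (\<forall>J\<in>set Js. radical_ideal R J) \<and> I = ideal_list_prod R Js)"
    proof (intro allI impI)
      fix I assume "invertible_ideal R I"
      then have I: "ideal I R" by (rule invertible_ideal_ideal)
      show "\<exists>Js. (\<forall>J\<in>set Js. radical_ideal R J) \<and> I = ideal_list_prod R Js"
      proof (cases "I = carrier R")
        case True
        then show ?thesis by (intro exI[of _ "[]"]) simp
      qed (use C1 I in simp)
    qed
  qed
  have C3_C4: ?C4 if C3: ?C3
  proof (intro allI impI, elim conjE)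
    fix P assume P: "primeideal P R" "P \<noteq> {\<zero>}"
    note PI = primeideal.axioms(1)[OF P(1)]
    obtain y where y: "y \<in> P" "y \<noteq> \<zero>" using P(2) ideal_zero_mem[OF PI] by auto
    then have yc: "y \<in> carrier R" using ideal_subset_carrier[OF PI] by auto
    \<comment> \<open>A nonzero principal ideal is invertible, so (3) factors it, and one of its
      radical factors lies in \<open>P\<close>.\<close>
    obtain Js where Js: "\<forall>J\<in>set Js. radical_ideal R J" "ideal_list_prod R Js = PIdl y"
      using C3[THEN conjunct2, rule_format, OF invertible_PIdl[OF yc y(2)]] by auto
    have "maximalideal P R" using C3 krull_dim_le_1_iff P by simp
    then show "maximalideal P R \<and> (\<exists>J. J \<subseteq> P \<and> invertible_ideal R J \<and> radical_ideal R J)"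
      using invertible_radical_factor[OF P(1) y Js] by auto
  qed
  have C4_core: "one_dim_radical_domain R" if C4: ?C4 and nf: "\<not> field R"
  proof (intro one_dim_radical_domain.intro domain_axioms one_dim_radical_domain_axioms.intro nf)
    fix P assume "primeideal P R" "P \<noteq> {\<zero>}"
    then show "maximalideal P R" "\<exists>J. J \<subseteq> P \<and> invertible_ideal R J \<and> radical_ideal R J"
      using C4 by simp_all
  qed
  have C4_C2: ?C2 if C4: ?C4
  proof
    have ex1: "\<exists>!Js. (\<forall>J\<in>set Js. radical_ideal R J \<and> J \<noteq> carrier R) \<and> sorted_wrt (\<subseteq>) Js \<and>
        I = ideal_list_prod R Js" if I: "ideal I R" "I \<noteq> {\<zero>}" for I
    proof (cases "field R")
      \<comment> \<open>In a field the only nonzero ideal is the unit ideal, and a nonempty product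
        of proper ideals cannot equal it.\<close>
      case True
      then show ?thesis using I by (rule field.proper_radical_chain_ex1)
    next
      case False
      interpret one_dim_radical_domain R by (rule C4_core[OF C4 False])
      obtain Js where Js: "\<forall>J\<in>set Js. radical_ideal R J \<and> J \<noteq> carrier R" "sorted_wrt (\<subseteq>) Js"
        "I = ideal_list_prod R Js" using proper_radical_chain_exists[OF I] by auto
      show ?thesis
      proof (rule ex1I[of _ Js])
        fix Ks assume "(\<forall>J\<in>set Ks. radical_ideal R J \<and> J \<noteq> carrier R) \<and> sorted_wrt (\<subseteq>) Ks \<and>
          I = ideal_list_prod R Ks"
        then show "Ks = Js" using proper_radical_chain_unique[of Js Ks] Js I(2) by simp
      qed (use Js in simp)
    qed
    then show "\<forall>I. ideal I R \<and> I \<noteq> {\<zero>} \<longrightarrow>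
      (\<exists>!Js. (\<forall>J\<in>set Js. radical_ideal R J \<and> J \<noteq> carrier R) \<and> sorted_wrt (\<subseteq>) Js \<and>
        I = ideal_list_prod R Js)" by simp
    show "\<forall>I. ideal I R \<longrightarrow> (\<exists>Js. (\<forall>J\<in>set Js. radical_ideal R J) \<and> sorted_wrt (\<subseteq>) Js \<and>
        I = ideal_list_prod R Js)"
    proof (intro allI impI)
      fix I assume I: "ideal I R"
      show "\<exists>Js. (\<forall>J\<in>set Js. radical_ideal R J) \<and> sorted_wrt (\<subseteq>) Js \<and> I = ideal_list_prod R Js"
      \<comment> \<open>The zero ideal is prime, hence its own radical factor. It has no unique
        chain, since repeating this factor does not change the product.\<close>
      proof (cases "I = {\<zero>}")
        case True
        then show ?thesis using zero_radical zero_list_prod by (intro exI[of _ "[{\<zero>}]"]) simp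
      next
        case False
        then show ?thesis using ex1_implies_ex[OF ex1[OF I False]] by auto
      qed
    qed
  qed
  have C2_C1: ?C1 if C2: ?C2
  proof (intro allI impI)
    fix I assume "ideal I R \<and> I \<noteq> carrier R"
    then obtain Js where "\<forall>J\<in>set Js. radical_ideal R J" "I = ideal_list_prod R Js"
      using conjunct1[OF C2, rule_format, of I] by auto
    then show "\<exists>Js. (\<forall>J\<in>set Js. radical_ideal R J) \<and> I = ideal_list_prod R Js"
      by (intro exI[of _ Js] conjI)
  qed
  have C4_C7: ?C7 if C4: ?C4
  proof -
    have nz: "invertible_ideal R I \<and> fg_ideal R (radical R I)" if I: "fg_ideal R I" "I \<noteq> {\<zero>}" for I
    proof (cases "field R")
      case True
      have "ideal I R" using I(1) genideal_ideal unfolding fg_ideal_def by auto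
      then have "I = carrier R" using field.ideal_cases[OF True] I(2) by auto
      then show ?thesis using field.radical_carrier[OF True] invertible_carrier I(1) by simp
    next
      case False
      interpret one_dim_radical_domain R by (rule C4_core[OF C4 False])
      show ?thesis using fg_invertible[OF I] fg_radical[OF I] by simp
    qed
    show ?thesis unfolding prufer_domain_def
    proof (intro conjI allI impI domain_axioms)
      fix I assume fg: "fg_ideal R I"
      show "fg_ideal R (radical R I)"
      proof (cases "I = {\<zero>}")
        case True
        then show ?thesis using fg_zero_radical by simp
      next
        case False
        then show ?thesis using nz[OF fg] by simp
      qed
    qed (use nz in simp)
  qed
  have C7_C5: ?C5 if C7: ?C7
  proof (intro allI impI, elim conjE)
    fix I assume I: "fg_ideal R I" "I \<noteq> {\<zero>}"
    then have II: "ideal I R" using genideal_ideal unfolding fg_ideal_def by auto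
    \<comment> \<open>The radical is nonzero and finitely generated, so the invertibility in (7)
      applies to the radical itself.\<close>
    have "radical R I \<noteq> {\<zero>}" using radical_is_ideal(2)[OF II] I(2) ideal_zero_mem[OF II] by auto
    then show "invertible_ideal R (radical R I)" using C7 I(1) unfolding prufer_domain_def by simp
  qed
  have C5_C4: ?C4 if ?C5
    using radical_invertible_imp_prime_maximal that by simp
  have C4_C6: ?C6 if ?C4 "\<not> field R"
    by (rule one_dim_radical_domain.ideal_lattice_iso[OF C4_core[OF that]])
  have C6_C1: ?C1 if C6: ?C6
  proof -
    obtain h where "h \<in> mult_lattice_iso (ideal_lattice R) (Ub (Max_inv R))" using C6 by auto
    then show ?thesis using lattice_iso_imp_radical_factorization by simp
  qed
  have "?equivalences ?C1 ?C2 ?C3 ?C4 ?C5 ?C6 ?C7"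
    using C1_C4 C1_C3 C3_C4 C4_C2 C2_C1 C4_C7 C7_C5 C5_C4 C4_C6 C6_C1 by argo
  then show ?thesis unfolding Let_def .
qed

end
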